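(* Let $(\widetilde X^{(1)}_t)_{t\ge0}$ and $(\widetilde X^{(2)}_t)_{t\ge0}$ be two ground state-transformed processes in $\mathbb R^d$ (each arising from a Lévy process and a potential as in the context) corresponding to the ground states $\varphi_0^{(1)}$ and $\varphi_0^{(2)}$, with path measures $\widetilde{\mathbb P}^{(1)}$ and $\widetilde{\mathbb P}^{(2)}$, respectively. Suppose that there exists $c_0>0$ such that for every $c\ge c_0$ $$\liminf_{|x|\to\infty}\frac{\varphi_0^{(1)}(cx)}{\varphi_0^{(2)}(x)}>0 .$$ Then the following hold. (1) For every non-decreasing function $\tau^{(2)}:[0,\infty)\to(0,\infty)$ for which there is a constant $c_{\varphi_0^{(2)}}\in(0,\infty)$ such that $$\limsup_{n\to\infty}\frac{|\widetilde X^{(2)}_n|}{\tau^{(2)}(n)}=c_{\varphi_0^{(2)}},\qquad \widetilde{\mathbb P}^{(2)}\text{-a.s.},\tag{$*$}$$ it follows that $$\limsup_{n\to\infty}\frac{|\widetilde X^{(1)}_n|}{\tau^{(2)}(n)}=\infty,\qquad \widetilde{\mathbb P}^{(1)}\text{-a.s.}$$ (2) If $\tau^{(2)}:[0,\infty)\to(0,\infty)$ is a non-decreasing function satisfying $( * )$ for some constant $c_{\varphi_0^{(2)}}\in(0,\infty)$, and $\tau^{(1)}:[0,\infty)\to(0,\infty)$ is a non-decreasing function such that $$\widetilde{\mathbb P}^{(1)}\Big(\limsup_{n\to\infty}\frac{|\widetilde X^{(1)}_n|}{\tau^{(1)}(n)}<\infty\Big)>0,$$ then $$\limsup_{n\to\infty}\frac{\tau^{(1)}(n)}{\tau^{(2)}(n)}=\infty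 .$$
   Context: Each of the two GST processes is constructed as follows from its own data (Lévy process $X$, potential $V$). Lévy process: $d\ge1$; $(X_t)_{t\ge0}$ is an $\mathbb R^d$-valued Lévy process ($\mathbb P^x,\mathbb E^x$: law and expectation when started at $x$) with $\mathbb E^0[e^{i\xi\cdot X_t}]=e^{-t\psi(\xi)}$, $\psi(\xi)=A\xi\cdot\xi+\int_{\mathbb R^d}(1-\cos(\xi\cdot z))\,\nu(dz)$, where $A$ is a symmetric non-negative definite $d\times d$ matrix and $\nu$ is a symmetric Lévy measure with $\nu(\mathbb R^d\setminus\{0\})=\infty$ and $\nu(dx)=\nu(x)dx$ with density $\nu(x)>0$. Its $L^2(\mathbb R^d)$-generator $L$ is given by $\widehat{Lf}=-\psi\widehat f$. Potential: a Borel function $V:\mathbb R^d\to\mathbb R$ is of $X$-Kato class if $V_-\in\mathcal K^X$ and $V_+1_C\in\mathcal K^X$ for every compact $C\subset\mathbb R^d$, where $h\in\mathcal K^X$ means $\lim_{t\downarrow0}\sup_{x\in\mathbb R^d}\mathbb E^x\big[\int_0^t|h(X_s)|ds\big]=0$. The operators $T_tf(x)=\mathbb E^x[e^{-\int_0^tV(X_s)ds}f(X_t)]$ form a strongly continuous symmetric semigroup on $L^2(\mathbb R^d)$, and $H=-L+V$ (form sum) is the self-adjoint operator, bounded from below, with $T_t=e^{-tH}$. Standing assumption: $V$ is of $X$-Kato class and $\lambda_0=\inf\operatorname{Spec}H\in\mathbb R$ is an isolated eigenvalue of $H$; $\varphi_0$ (the ground state) denotes its unique strictly positive eigenfunction with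 $\|\varphi_0\|_{L^2}=1$. Ground state-transformed (GST) process: $\widetilde T_tf=\frac{e^{\lambda_0t}}{\varphi_0}T_t(\varphi_0f)$ is a Markov semigroup on $L^2(\mathbb R^d,\varphi_0^2dx)$. The GST process $(\widetilde X_t)_{t\in\mathbb R}$ is the associated stationary càdlàg Markov process on two-sided càdlàg path space; $\widetilde{\mathbb P}^x$ is its law with $\widetilde X_0=x$, and its path measure is $\widetilde{\mathbb P}(\cdot)=\int_{\mathbb R^d}\widetilde{\mathbb P}^x(\cdot)\varphi_0^2(x)dx$. Thus for $t_0\le\dots\le t_n$, $\mathbb E_{\widetilde{\mathbb P}}[\prod_{j=0}^nf_j(\widetilde X_{t_j})]=(f_0,\widetilde T_{t_1-t_0}f_1\cdots\widetilde T_{t_n-t_{n-1}}f_n)_{L^2(\mathbb R^d,\varphi_0^2dx)}$ for $f_0,f_n\in L^2(\mathbb R^d,\varphi_0^2dx)$ and bounded $f_1,\dots,f_{n-1}$. *)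

theory Defs
  imports "HOL-Probability.Probability"
begin

section \<open>Levy processes\<close>

definition cadlag_on :: "real set \<Rightarrow> (real \<Rightarrow> 'a::topological_space) \<Rightarrow> bool" where
  "cadlag_on I f \<longleftrightarrow>
     (\<forall>t\<in>I. (f \<longlongrightarrow> f t) (at t within I \<inter> {t<..}) \<and>
             (\<exists>l. (f \<longlongrightarrow> l) (at t within I \<inter> {..<t})))"

text \<open>
  The process starts at the origin, so the law \<open>P\<^sup>x\<close> is the law of \<open>x + X\<close>.
  Every path (not just almost every path) is cadlag; the time integrals of the paths below
  are then measurable without completing \<open>M\<close>.
\<close>

definition levy_process ::
  "'w measure \<Rightarrow> (real \<Rightarrow> 'w \<Rightarrow> 'a::euclidean_space) \<Rightarrow> bool" where
  "levy_process M X \<longleftrightarrow>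
     prob_space M \<and>
     (\<forall>t\<ge>0. X t \<in> borel_measurable M) \<and>
     (AE \<omega> in M. X 0 \<omega> = 0) \<and>
     (\<forall>(n::nat) (t::nat \<Rightarrow> real). mono t \<and> 0 \<le> t 0 \<longrightarrow>
        prob_space.indep_vars M (\<lambda>_. borel) (\<lambda>i \<omega>. X (t (Suc i)) \<omega> - X (t i) \<omega>) {..<n}) \<and>
     (\<forall>s\<ge>0. \<forall>h\<ge>0.
        distr M borel (\<lambda>\<omega>. X (s + h) \<omega> - X s \<omega>) = distr M borel (X h)) \<and>
     (\<forall>\<omega>\<in>space M. cadlag_on {0..} (\<lambda>t. X t \<omega>))"

definition levy_measure :: "'a::euclidean_space measure \<Rightarrow> bool" where
  "levy_measure \<nu> \<longleftrightarrow>
     sets \<nu> = sets borel \<and> emeasure \<nu> {0} = 0 \<and>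
     (\<integral>\<^sup>+z. ennreal (min 1 ((norm z)\<^sup>2)) \<partial>\<nu>) < \<infinity>"

definition levy_exponent :: "real^'n^'n \<Rightarrow> (real^'n) measure \<Rightarrow> real^'n \<Rightarrow> real" where
  "levy_exponent A \<nu> \<xi> = (A *v \<xi>) \<bullet> \<xi> + (LINT z|\<nu>. 1 - cos (\<xi> \<bullet> z))"

definition admissible_levy_process ::
  "'w measure \<Rightarrow> (real \<Rightarrow> 'w \<Rightarrow> real^'n) \<Rightarrow> real^'n^'n \<Rightarrow> (real^'n) measure \<Rightarrow> bool" where
  "admissible_levy_process M X A \<nu> \<longleftrightarrow>
     levy_process M X \<and>
     transpose A = A \<and> (\<forall>\<xi>. 0 \<le> (A *v \<xi>) \<bullet> \<xi>) \<and>
     levy_measure \<nu> \<and> distr \<nu> borel uminus = \<nu> \<and> emeasure \<nu> (UNIV - {0}) = \<infinity> \<and>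
     (\<exists>\<rho>::real^'n \<Rightarrow> real. \<rho> \<in> borel_measurable borel \<and> (\<forall>z. z \<noteq> 0 \<longrightarrow> 0 < \<rho> z) \<and>
        \<nu> = density lborel (\<lambda>z. ennreal (\<rho> z))) \<and>
     (\<forall>t\<ge>0. \<forall>\<xi>. (LINT \<omega>|M. cis (\<xi> \<bullet> X t \<omega>))
                 = complex_of_real (exp (- t * levy_exponent A \<nu> \<xi>)))"


section \<open>Kato class and the Feynman--Kac semigroup\<close>

definition kato ::
  "'w measure \<Rightarrow> (real \<Rightarrow> 'w \<Rightarrow> 'a::euclidean_space) \<Rightarrow> ('a \<Rightarrow> real) \<Rightarrow> bool" where
  "kato M X h \<longleftrightarrow>
     h \<in> borel_measurable borel \<and>
     ((\<lambda>t. SUP x. \<integral>\<^sup>+\<omega>. (\<integral>\<^sup>+s\<in>{0..t}. ennreal \<bar>h (x + X s \<omega>)\<bar> \<partial>lborel) \<partial>M) \<longlongrightarrow> 0)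
       (at_right 0)"

definition X_kato_class ::
  "'w measure \<Rightarrow> (real \<Rightarrow> 'w \<Rightarrow> 'a::euclidean_space) \<Rightarrow> ('a \<Rightarrow> real) \<Rightarrow> bool" where
  "X_kato_class M X V \<longleftrightarrow>
     V \<in> borel_measurable borel \<and>
     kato M X (\<lambda>x. max 0 (- V x)) \<and>
     (\<forall>C. compact C \<longrightarrow> kato M X (\<lambda>x. max 0 (V x) * indicator C x))"

definition feynman_kac ::
  "'w measure \<Rightarrow> (real \<Rightarrow> 'w \<Rightarrow> 'a::euclidean_space) \<Rightarrow> ('a \<Rightarrow> real) \<Rightarrow>
   real \<Rightarrow> ('a \<Rightarrow> real) \<Rightarrow> 'a \<Rightarrow> real" where
  "feynman_kac M X V t f x =
     (LINT \<omega>|M. exp (- (LBINT s:{0..t}. V (x + X s \<omega>))) * f (x + X t \<omega>))"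


section \<open>Operators in real \<open>L\<^sup>2\<close>\<close>

text \<open>
  Elements of \<open>L\<^sup>2\<close> are represented by functions, identified when equal almost everywhere.
\<close>

definition square_integrable :: "'a measure \<Rightarrow> ('a \<Rightarrow> real) \<Rightarrow> bool" where
  "square_integrable \<mu> f \<longleftrightarrow> f \<in> borel_measurable \<mu> \<and> integrable \<mu> (\<lambda>x. (f x)\<^sup>2)"

definition l2_inner :: "'a measure \<Rightarrow> ('a \<Rightarrow> real) \<Rightarrow> ('a \<Rightarrow> real) \<Rightarrow> real" where
  "l2_inner \<mu> f g = (LINT x|\<mu>. f x * g x)"

definition l2_norm :: "'a measure \<Rightarrow> ('a \<Rightarrow> real) \<Rightarrow> real" where
  "l2_norm \<mu> f = sqrt (l2_inner \<mu> f f)"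

text \<open>
  An unbounded operator in \<open>L\<^sup>2(R\<^sup>d)\<close> is given by its graph, which is closed under almost
  everywhere equality for all operators used below.
\<close>

type_synonym 'a l2_operator = "(('a \<Rightarrow> real) \<times> ('a \<Rightarrow> real)) set"

definition densely_defined :: "'a::euclidean_space l2_operator \<Rightarrow> bool" where
  "densely_defined H \<longleftrightarrow>
     (\<forall>f. square_integrable lborel f \<longrightarrow>
        (\<forall>e>0. \<exists>(u, v)\<in>H. l2_norm lborel (\<lambda>x. f x - u x) < e))"

definition adjoint_graph :: "'a::euclidean_space l2_operator \<Rightarrow> 'a l2_operator" where
  "adjoint_graph H =
     {(f, g). square_integrable lborel f \<and> square_integrable lborel g \<and>
        (\<forall>(u, v)\<in>H. l2_inner lborel v f = l2_inner lborel u g)}"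

definition self_adjoint :: "'a::euclidean_space l2_operator \<Rightarrow> bool" where
  "self_adjoint H \<longleftrightarrow> densely_defined H \<and> adjoint_graph H = H"

definition bounded_from_below :: "'a::euclidean_space l2_operator \<Rightarrow> bool" where
  "bounded_from_below H \<longleftrightarrow>
     (\<exists>b. \<forall>(f, g)\<in>H. b * l2_inner lborel f f \<le> l2_inner lborel f g)"

text \<open>
  \<open>l\<close> is in the resolvent set when \<open>H - l\<close> is a bijection from the domain of \<open>H\<close> onto
  \<open>L\<^sup>2\<close> with bounded inverse; the lower bound expresses injectivity and boundedness of the
  inverse.  Only real \<open>l\<close> are considered, as the spectrum of a self-adjoint operator is real.
\<close>

definition resolvent_set :: "'a::euclidean_space l2_operator \<Rightarrow> real set" where
  "resolvent_set H =
     {l. (\<forall>h. square_integrable lborel h \<longrightarrow>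
            (\<exists>(f, g)\<in>H. AE x in lborel. g x - l * f x = h x)) \<and>
         (\<exists>C. \<forall>(f, g)\<in>H. l2_norm lborel f \<le> C * l2_norm lborel (\<lambda>x. g x - l * f x))}"

definition Spec :: "'a::euclidean_space l2_operator \<Rightarrow> real set" where
  "Spec H = - resolvent_set H"

definition eigenfunction :: "'a::euclidean_space l2_operator \<Rightarrow> real \<Rightarrow> ('a \<Rightarrow> real) \<Rightarrow> bool" where
  "eigenfunction H l f \<longleftrightarrow> (f, \<lambda>x. l * f x) \<in> H \<and> \<not> (AE x in lborel. f x = 0)"

definition isolated_eigenvalue :: "'a::euclidean_space l2_operator \<Rightarrow> real \<Rightarrow> bool" where
  "isolated_eigenvalue H l \<longleftrightarrow> (\<exists>f. eigenfunction H l f) \<and> l isolated_in Spec H"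

text \<open>
  Graph of minus the infinitesimal generator of a family of operators \<open>T\<close>.  The squared
  \<open>L\<^sup>2\<close> distance is a nonnegative integral, hence infinite off \<open>L\<^sup>2\<close>.
\<close>

definition neg_generator :: "(real \<Rightarrow> ('a \<Rightarrow> real) \<Rightarrow> 'a \<Rightarrow> real) \<Rightarrow> 'a::euclidean_space l2_operator"
  where
  "neg_generator T =
     {(f, g). square_integrable lborel f \<and> square_integrable lborel g \<and>
        ((\<lambda>t. \<integral>\<^sup>+x. ennreal (((f x - T t f x) / t - g x)\<^sup>2) \<partial>lborel) \<longlongrightarrow> 0) (at_right 0)}"

text \<open>
  The Schroedinger operator \<open>H = - L + V\<close> is the self-adjoint operator, bounded from below, for
  which the Feynman--Kac semigroup is \<open>exp (- t H)\<close>, that is, is generated by \<open>- H\<close>.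
\<close>

definition schroedinger_operator ::
  "'w measure \<Rightarrow> (real \<Rightarrow> 'w \<Rightarrow> 'a::euclidean_space) \<Rightarrow> ('a \<Rightarrow> real) \<Rightarrow> 'a l2_operator \<Rightarrow> bool"
  where
  "schroedinger_operator M X V H \<longleftrightarrow>
     self_adjoint H \<and> bounded_from_below H \<and> H = neg_generator (feynman_kac M X V)"

definition ground_energy :: "'a::euclidean_space l2_operator \<Rightarrow> real" where
  "ground_energy H = Inf (Spec H)"

definition positive_ground_eigenfunction ::
  "'a::euclidean_space l2_operator \<Rightarrow> ('a \<Rightarrow> real) \<Rightarrow> bool" where
  "positive_ground_eigenfunction H f \<longleftrightarrow>
     eigenfunction H (ground_energy H) f \<and> (\<forall>x. 0 < f x) \<and> l2_norm lborel f = 1"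

text \<open>
  A ground state is a fixed, everywhere positive representative of its \<open>L\<^sup>2\<close> class;
  uniqueness is up to almost everywhere equality.
\<close>

definition ground_state :: "'a::euclidean_space l2_operator \<Rightarrow> ('a \<Rightarrow> real) \<Rightarrow> bool" where
  "ground_state H \<phi> \<longleftrightarrow>
     positive_ground_eigenfunction H \<phi> \<and>
     (\<forall>f. positive_ground_eigenfunction H f \<longrightarrow> (AE x in lborel. f x = \<phi> x))"


section \<open>Ground state-transformed processes\<close>

definition gst_semigroup ::
  "'w measure \<Rightarrow> (real \<Rightarrow> 'w \<Rightarrow> 'a::euclidean_space) \<Rightarrow> ('a \<Rightarrow> real) \<Rightarrow> real \<Rightarrow> ('a \<Rightarrow> real) \<Rightarrow>
   real \<Rightarrow> ('a \<Rightarrow> real) \<Rightarrow> 'a \<Rightarrow> real" where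
  "gst_semigroup M X V l \<phi> t f x =
     exp (l * t) / \<phi> x * feynman_kac M X V t (\<lambda>y. \<phi> y * f y) x"

text \<open>Two-sided cadlag path space with the sigma-algebra generated by the coordinates.\<close>

definition path_space :: "(real \<Rightarrow> 'a::euclidean_space) measure" where
  "path_space = restrict_space (PiM UNIV (\<lambda>_. borel)) {\<omega>. cadlag_on UNIV \<omega>}"

definition ground_measure :: "('a::euclidean_space \<Rightarrow> real) \<Rightarrow> 'a measure" where
  "ground_measure \<phi> = density lborel (\<lambda>x. ennreal ((\<phi> x)\<^sup>2))"

definition gst_path_measure ::
  "('a::euclidean_space \<Rightarrow> real) \<Rightarrow> ('a \<Rightarrow> (real \<Rightarrow> 'a) measure) \<Rightarrow> (real \<Rightarrow> 'a) measure" where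
  "gst_path_measure \<phi> Q = bind (ground_measure \<phi>) Q"

text \<open>
  The function
  \<open>f\<^sub>0 \<cdot> S (t\<^sub>1 - t\<^sub>0) (f\<^sub>1 \<cdot> S (t\<^sub>2 - t\<^sub>1) (f\<^sub>2 \<cdot> \<dots> S (t\<^sub>n - t\<^sub>n\<^sub>-\<^sub>1) f\<^sub>n))\<close>
\<close>

primrec semigroup_chain ::
  "(real \<Rightarrow> ('a \<Rightarrow> real) \<Rightarrow> 'a \<Rightarrow> real) \<Rightarrow> nat \<Rightarrow> (nat \<Rightarrow> real) \<Rightarrow> (nat \<Rightarrow> 'a \<Rightarrow> real) \<Rightarrow> 'a \<Rightarrow> real"
  where
  "semigroup_chain S 0 t f = f 0"
| "semigroup_chain S (Suc n) t f =
     (\<lambda>x. f 0 x * S (t 1 - t 0) (semigroup_chain S n (\<lambda>i. t (Suc i)) (\<lambda>i. f (Suc i))) x)"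

text \<open>
  \<open>Q x\<close> is the law of the process conditioned to be at \<open>x\<close> at time \<open>0\<close>; the process itself is
  the coordinate process on \<open>path_space\<close>.
\<close>

definition gst_process ::
  "'w measure \<Rightarrow> (real \<Rightarrow> 'w \<Rightarrow> 'a::euclidean_space) \<Rightarrow> ('a \<Rightarrow> real) \<Rightarrow> real \<Rightarrow> ('a \<Rightarrow> real) \<Rightarrow>
   ('a \<Rightarrow> (real \<Rightarrow> 'a) measure) \<Rightarrow> bool" where
  "gst_process M X V l \<phi> Q \<longleftrightarrow>
     Q \<in> borel \<rightarrow>\<^sub>M prob_algebra path_space \<and>
     (\<forall>x. AE \<omega> in Q x. \<omega> 0 = x) \<and>
     (\<forall>(n::nat) (t::nat \<Rightarrow> real) (f::nat \<Rightarrow> 'a \<Rightarrow> real).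
        (\<forall>i<n. t i \<le> t (Suc i)) \<and>
        (\<forall>i\<le>n. f i \<in> borel_measurable borel) \<and>
        square_integrable (ground_measure \<phi>) (f 0) \<and>
        square_integrable (ground_measure \<phi>) (f n) \<and>
        (\<forall>i. 0 < i \<and> i < n \<longrightarrow> bounded (range (f i)))
        \<longrightarrow> (LINT \<omega>|gst_path_measure \<phi> Q. (\<Prod>i\<le>n. f i (\<omega> (t i))))
            = (LINT x|ground_measure \<phi>. semigroup_chain (gst_semigroup M X V l \<phi>) n t f x))"

definition gst_setting ::
  "'w measure \<Rightarrow> (real \<Rightarrow> 'w \<Rightarrow> real^'n) \<Rightarrow> real^'n^'n \<Rightarrow> (real^'n) measure \<Rightarrow>
   (real^'n \<Rightarrow> real) \<Rightarrow> (real^'n) l2_operator \<Rightarrow> (real^'n \<Rightarrow> real) \<Rightarrow>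
   (real^'n \<Rightarrow> (real \<Rightarrow> real^'n) measure) \<Rightarrow> bool" where
  "gst_setting M X A \<nu> V H \<phi> Q \<longleftrightarrow>
     admissible_levy_process M X A \<nu> \<and>
     X_kato_class M X V \<and>
     schroedinger_operator M X V H \<and>
     bdd_below (Spec H) \<and> isolated_eigenvalue H (ground_energy H) \<and>
     ground_state H \<phi> \<and>
     gst_process M X V (ground_energy H) \<phi> Q"

end

theory Submission
  imports Defs
begin

text \<open>
  Stationarity reduces both claims to a comparison of the two stationary laws
  \<open>\<phi>1\<^sup>2 dx\<close> and \<open>\<phi>2\<^sup>2 dx\<close>, by means of the two Borel--Cantelli lemmas.

  Suppose that \<open>limsup \<bar>X2 n\<bar> / \<tau> n = c\<close> almost surely, with \<open>0 < c < \<infinity>\<close>.  Then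
  \<open>\<bar>X2 n\<bar> > (c / 2) \<tau> n\<close> infinitely often, so by the first Borel--Cantelli lemma the
  probabilities of these events, which are the \<open>\<phi>2\<^sup>2 dx\<close>-masses of the sets
  \<open>{x. (c / 2) \<tau> n < \<bar>x\<bar>}\<close>, have a divergent sum (\<open>tail_not_summable\<close>).  The decay condition
  at a large factor \<open>k\<close> and the substitution \<open>x = k y\<close> show that the \<open>\<phi>1\<^sup>2 dx\<close>-mass of
  \<open>{x. k r < \<bar>x\<bar>}\<close> is at least a constant times the \<open>\<phi>2\<^sup>2 dx\<close>-mass of \<open>{x. r < \<bar>x\<bar>}\<close> for all
  large \<open>r\<close> (\<open>ground_measure_tail_comparison\<close>).  Hence the probabilities of
  \<open>\<bar>X1 n\<bar> > k (c / 2) \<tau> n\<close> also have a divergent sum.  A second Borel--Cantelli lemma for \<open>X1\<close>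
  (\<open>AE_infinitely_often_in\<close>) shows that these events happen infinitely often, so that
  \<open>limsup \<bar>X1 n\<bar> / \<tau> n \<ge> k c / 2\<close> for all large \<open>k\<close>.  This is the first claim, and the second
  one follows since \<open>\<bar>X1 n\<bar> / \<tau>2 n = (\<bar>X1 n\<bar> / \<tau>1 n) (\<tau>1 n / \<tau>2 n)\<close>.

  The events \<open>X1 n \<in> A n\<close> are not independent, but their correlations decay exponentially
  (\<open>correlation_decay\<close>), which makes the variance of the number of events among the first \<open>N\<close>
  at most a constant times its mean (\<open>borel_cantelli_of_decaying_correlations\<close>).  The decay is
  the spectral gap of \<open>H\<close> above the ground energy \<open>l\<close>.  The operators
  \<open>K t = exp (l t) exp (- t H)\<close> form a contraction semigroup on \<open>L\<^sup>2\<close>, because their matrix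
  elements are correlations of the stationary process.  The kernel of \<open>H - l\<close> is spanned by
  \<open>\<phi>1\<close>, because \<open>K t\<close> is positive and the positive ground state is unique (\<open>kernel_simple\<close>).
  Since \<open>l\<close> is isolated in the spectrum, \<open>H - l\<close> is bounded below on the orthogonal complement
  of \<open>\<phi>1\<close>, and \<open>K t\<close> decays exponentially there (\<open>spectral_gap\<close>).  This last step replaces the
  spectral theorem by elementary estimates for one bounded resolvent of \<open>H - l\<close>.
\<close>

section \<open>Symmetric operators with a gap above the kernel\<close>

text \<open>
  Expanding the form of \<open>D\<close> at \<open>v - D v / L\<close>, which is nonnegative, gives the claim.  The form
  is compared with \<open>L\<close> at the single vector \<open>D v\<close>; this suits an operator whose form is small
  only on an invariant subspace.
\<close>

lemma symmetric_form_bound: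
  fixes D :: "'h::real_inner \<Rightarrow> 'h"
  assumes lin: "linear D"
    and sym: "\<And>u v. D u \<bullet> v = u \<bullet> D v"
    and nonneg: "\<And>v. 0 \<le> D v \<bullet> v"
    and bound: "D (D v) \<bullet> D v \<le> L * (D v \<bullet> D v)"
    and L: "0 < L"
  shows "D v \<bullet> D v \<le> L * (D v \<bullet> v)"
proof -
  let ?w = "D v" and ?c = "1 / L"
  have "0 \<le> D (v - ?c *\<^sub>R ?w) \<bullet> (v - ?c *\<^sub>R ?w)" by (rule nonneg)
  also have "\<dots> = ?w \<bullet> v - 2 * ?c * (?w \<bullet> ?w) + ?c\<^sup>2 * (D ?w \<bullet> ?w)"
    using sym[of ?w v]
    by (simp add: linear_diff[OF lin] linear_scale[OF lin] inner_diff algebra_simps inner_commute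
        power2_eq_square)
  also have "\<dots> \<le> ?w \<bullet> v - 2 * ?c * (?w \<bullet> ?w) + ?c\<^sup>2 * (L * (?w \<bullet> ?w))"
    using bound by (intro add_left_mono mult_left_mono) auto
  also have "\<dots> = ?w \<bullet> v - ?c * (?w \<bullet> ?w)"
    using L by (simp add: power2_eq_square field_simps)
  finally show ?thesis using L by (simp add: field_simps)
qed

text \<open>
  In spectral terms, \<open>A\<close> has no spectrum in \<open>(0, \<gamma>)\<close>, so \<open>\<gamma> s \<le> s\<^sup>2\<close> on its spectrum.  For an
  elementary proof let \<open>B = A - a\<close> with \<open>a = \<gamma> / 2\<close> and let \<open>c\<close> be the best constant in
  \<open>c \<bar>v\<bar> \<le> \<bar>B v\<bar>\<close>.  Suppose \<open>c < a\<close>.  Then \<open>a - c\<close> and \<open>a + c\<close> lie in \<open>(0, \<gamma>)\<close>, so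
  \<open>D = B\<^sup>2 - c\<^sup>2 = (B + c) (B - c)\<close> is bounded below.  As \<open>D\<close> has a nonnegative form, the form is
  bounded below as well by \<open>symmetric_form_bound\<close>, which contradicts the choice of \<open>c\<close>.  Thus
  \<open>a \<bar>v\<bar> \<le> \<bar>A v - a v\<bar>\<close>, and the square of this inequality is the claim.
\<close>

lemma bounded_below_symmetric_inequality:
  fixes A :: "'h::real_inner \<Rightarrow> 'h"
  assumes lin: "linear A"
    and sym: "\<And>u v. A u \<bullet> v = u \<bullet> A v"
    and contr: "\<And>v. norm (A v) \<le> norm v"
    and below: "\<And>a. 0 < a \<Longrightarrow> a < \<gamma> \<Longrightarrow> \<exists>k>0. \<forall>v. k * norm v \<le> norm (A v - a *\<^sub>R v)"
    and \<gamma>: "0 < \<gamma>"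
  shows "\<gamma> * (A v \<bullet> v) \<le> A v \<bullet> A v"
proof -
  define a where "a = \<gamma> / 2"
  define B where "B v = A v - a *\<^sub>R v" for v
  have linB: "linear B"
    unfolding B_def by (intro linear_compose_sub lin linear_scale_self)
  have symB: "B u \<bullet> v = u \<bullet> B v" for u v
    by (simp add: B_def inner_diff sym)
  have normB: "norm (B v) \<le> (1 + a) * norm v" for v
  proof -
    have "norm (B v) \<le> norm (A v) + norm (a *\<^sub>R v)" unfolding B_def by (rule norm_triangle_ineq4)
    also have "\<dots> \<le> (1 + a) * norm v" using contr[of v] \<gamma> by (simp add: a_def algebra_simps)
    finally show ?thesis .
  qed
  define S where "S = {c. 0 \<le> c \<and> (\<forall>v. c * norm v \<le> norm (B v))}"
  have a0: "0 < a" "a < \<gamma>" using \<gamma> by (auto simp: a_def)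
  have key: "a * norm v \<le> norm (B v)" for v
  proof (rule ccontr)
    assume "\<not> a * norm v \<le> norm (B v)"
    then have less: "norm (B v) < a * norm v" by simp
    then have v0: "norm v > 0" 
      by (cases "norm v = 0") auto
    have le_a: "c < a" if "c \<in> S" for c
    proof -
      have "c * norm v < a * norm v" using that less by (auto simp: S_def intro: le_less_trans)
      then show ?thesis using v0 by simp
    qed
    have bdd: "bdd_above S" using le_a by (meson bdd_above.I less_imp_le)
    obtain k0 where k0: "k0 > 0" "k0 \<in> S"
      using below[of a] a0 by (force simp: S_def B_def)
    define c where "c = Sup S"
    have c0: "c > 0" using cSup_upper[OF k0(2) bdd] k0(1) by (simp add: c_def)
    have cB: "c * norm w \<le> norm (B w)" for w
    proof (cases "norm w = 0")
      case True then show ?thesis by simp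
    next
      case False
      then have "c \<le> norm (B w) / norm w"
        unfolding c_def using k0(2)
        by (intro cSup_least) (auto simp: S_def field_simps)
      then show ?thesis using False by (simp add: field_simps)
    qed
    have "c \<in> S" using c0 cB by (auto simp: S_def)
    then have ca: "c < a" by (rule le_a)
    obtain k1 where k1: "k1 > 0" "\<And>w. k1 * norm w \<le> norm (B w + c *\<^sub>R w)"
      using below[of "a - c"] c0 ca \<gamma> by (auto simp: B_def a_def algebra_simps)
    obtain k2 where k2: "k2 > 0" "\<And>w. k2 * norm w \<le> norm (B w - c *\<^sub>R w)"
      using below[of "a + c"] c0 ca \<gamma> by (auto simp: B_def a_def algebra_simps)
    \<comment> \<open>\<open>D = (B + c) (B - c)\<close> is bounded below although its form gets arbitrarily small.\<close>
    define D where "D w = B (B w) - c\<^sup>2 *\<^sub>R w" for w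
    have linD: "linear D"
      unfolding D_def
      by (intro linear_compose_sub linear_scale_self linear_compose[OF linB linB, unfolded o_def])
    have Dfac: "D w = B (B w - c *\<^sub>R w) + c *\<^sub>R (B w - c *\<^sub>R w)" for w
      by (simp add: D_def linear_diff[OF linB] linear_scale[OF linB] algebra_simps power2_eq_square)
    have Dlow: "k1 * k2 * norm w \<le> norm (D w)" for w
    proof -
      have "k1 * (k2 * norm w) \<le> k1 * norm (B w - c *\<^sub>R w)" using k1(1) k2(2) by simp
      also have "\<dots> \<le> norm (D w)" unfolding Dfac by (rule k1(2))
      finally show ?thesis by (simp add: mult.assoc)
    qed
    have Dform: "D w \<bullet> w = (norm (B w))\<^sup>2 - c\<^sup>2 * (norm w)\<^sup>2" for w
      by (simp add: D_def inner_diff symB power2_norm_eq_inner)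
    have D_le: "D w \<bullet> D w \<le> (1 + a)\<^sup>2 * (D w \<bullet> w)" for w
    proof (rule symmetric_form_bound[OF linD])
      show "D u \<bullet> v = u \<bullet> D v" for u v by (simp add: D_def inner_diff symB)
      show "0 \<le> D v \<bullet> v" for v
      proof -
        have "(c * norm v)\<^sup>2 \<le> (norm (B v))\<^sup>2" using cB c0 by (intro power_mono) auto
        then show ?thesis by (simp add: Dform power_mult_distrib)
      qed
      have "(norm (B (D w)))\<^sup>2 \<le> ((1 + a) * norm (D w))\<^sup>2"
        using normB by (intro power_mono) auto
      then show "D (D w) \<bullet> D w \<le> (1 + a)\<^sup>2 * (D w \<bullet> D w)"
        unfolding Dform by (simp add: power_mult_distrib power2_norm_eq_inner)
           (smt (verit) inner_ge_zero mult_nonneg_nonneg zero_le_power2)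
      show "0 < (1 + a)\<^sup>2" using a0 by simp
    qed
    \<comment> \<open>The lower bound for \<open>D\<close> improves the constant \<open>c\<^sup>2\<close> in \<open>c\<^sup>2 \<bar>w\<bar>\<^sup>2 \<le> \<bar>B w\<bar>\<^sup>2\<close> by \<open>\<epsilon>\<close>.\<close>
    define \<epsilon> where "\<epsilon> = (k1 * k2)\<^sup>2 / (1 + a)\<^sup>2"
    have \<epsilon>: "\<epsilon> > 0" using k1(1) k2(1) a0 by (simp add: \<epsilon>_def)
    have improved: "(c\<^sup>2 + \<epsilon>) * (norm w)\<^sup>2 \<le> (norm (B w))\<^sup>2" for w
    proof -
      have "(k1 * k2 * norm w)\<^sup>2 \<le> (norm (D w))\<^sup>2"
        using Dlow k1(1) k2(1) by (intro power_mono) auto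
      also have "\<dots> \<le> (1 + a)\<^sup>2 * ((norm (B w))\<^sup>2 - c\<^sup>2 * (norm w)\<^sup>2)"
        using D_le[of w] by (simp add: Dform power2_norm_eq_inner)
      finally have "\<epsilon> * (norm w)\<^sup>2 \<le> (norm (B w))\<^sup>2 - c\<^sup>2 * (norm w)\<^sup>2"
        using a0 by (simp add: \<epsilon>_def field_simps power_mult_distrib)
      then show ?thesis by (simp add: algebra_simps)
    qed
    have "sqrt (c\<^sup>2 + \<epsilon>) \<in> S"
    proof -
      have "sqrt (c\<^sup>2 + \<epsilon>) * norm w \<le> norm (B w)" for w
      proof (rule power2_le_imp_le)
        show "(sqrt (c\<^sup>2 + \<epsilon>) * norm w)\<^sup>2 \<le> (norm (B w))\<^sup>2"
          using improved[of w] \<epsilon> by (simp add: power_mult_distrib)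
      qed simp
      then show ?thesis using \<epsilon> by (auto simp: S_def)
    qed
    then have "sqrt (c\<^sup>2 + \<epsilon>) \<le> c" unfolding c_def by (intro cSup_upper bdd)
    then have "(sqrt (c\<^sup>2 + \<epsilon>))\<^sup>2 \<le> c\<^sup>2" using \<epsilon> by (intro power_mono) auto
    then show False using \<epsilon> by simp
  qed
  have "(a * norm v)\<^sup>2 \<le> (norm (B v))\<^sup>2" using key a0 by (intro power_mono) auto
  also have "(norm (B v))\<^sup>2 = A v \<bullet> A v - 2 * a * (A v \<bullet> v) + a\<^sup>2 * (norm v)\<^sup>2"
    unfolding power2_norm_eq_inner
    by (simp add: B_def inner_diff inner_commute power2_eq_square algebra_simps)
  finally show ?thesis by (simp add: power_mult_distrib power_divide a_def)
qed

text \<open>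
  Iterate \<open>J = 1 - A\<close>, starting at \<open>v\<close>.  By \<open>ge_form\<close> the energy \<open>A w \<bullet> w\<close> decreases by a factor
  \<open>1 - \<gamma>\<close> in each step, so the steps \<open>A w\<close> are summable and the iterates converge to an element
  of the kernel.  All iterates have the same inner product with a given element of the kernel,
  and this is zero for \<open>v\<close>; hence the limit is zero.  The square of the norm of \<open>v\<close> is therefore
  at most twice the sum of the energies along the iteration.
\<close>

lemma coercive_off_kernel:
  fixes A :: "'h::{real_inner,banach} \<Rightarrow> 'h"
  assumes lin: "linear A"
    and sym: "\<And>u v. A u \<bullet> v = u \<bullet> A v"
    and le_form: "\<And>v. A v \<bullet> A v \<le> A v \<bullet> v"
    and ge_form: "\<And>v. \<gamma> * (A v \<bullet> v) \<le> A v \<bullet> A v"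
    and \<gamma>: "0 < \<gamma>" "\<gamma> < 1"
    and orth: "\<And>w. A w = 0 \<Longrightarrow> w \<bullet> v = 0"
  shows "(norm v)\<^sup>2 \<le> 2 / \<gamma> * (A v \<bullet> v)"
proof -
  define J where "J w = w - A w" for w
  define e where "e w = A w \<bullet> w" for w
  define x where "x n = (J ^^ n) v" for n
  have x_Suc: "x (Suc n) = x n - A (x n)" for n by (simp add: x_def J_def)
  have e_nonneg: "0 \<le> e w" for w
    using le_form[of w] inner_ge_zero[of "A w"] unfolding e_def by linarith
  have contr: "norm (A w) \<le> norm w" for w
  proof -
    have "norm (A w) * norm (A w) \<le> norm (A w) * norm w"
      using le_form[of w] norm_cauchy_schwarz[of "A w" w]
      by (simp add: norm_eq_sqrt_inner)
    then show ?thesis by (metis mult_le_cancel_left_pos norm_ge_zero order_le_less)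
  qed
  have e_step: "e (x (Suc n)) \<le> (1 - \<gamma>) * e (x n)" for n
  proof -
    let ?w = "x n"
    have "e (x (Suc n)) = e ?w - 2 * (A ?w \<bullet> A ?w) + A (A ?w) \<bullet> A ?w"
      using sym[of "A ?w" ?w]
      by (simp add: e_def x_Suc linear_diff[OF lin] inner_diff algebra_simps)
    moreover have "A (A ?w) \<bullet> A ?w \<le> A ?w \<bullet> A ?w"
    proof -
      have "A (A ?w) \<bullet> A ?w \<le> norm (A (A ?w)) * norm (A ?w)" by (rule norm_cauchy_schwarz)
      also have "\<dots> \<le> norm (A ?w) * norm (A ?w)" using contr by (intro mult_right_mono) auto
      finally show ?thesis by (simp add: norm_eq_sqrt_inner)
    qed
    moreover have "\<gamma> * e ?w \<le> A ?w \<bullet> A ?w" using ge_form[of ?w] by (simp add: e_def)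
    ultimately show ?thesis by (simp add: algebra_simps)
  qed
  have e_geo: "e (x n) \<le> (1 - \<gamma>) ^ n * e v" for n
  proof (induction n)
    case 0 then show ?case by (simp add: x_def)
  next
    case (Suc n)
    have "e (x (Suc n)) \<le> (1 - \<gamma>) * e (x n)" by (rule e_step)
    also have "\<dots> \<le> (1 - \<gamma>) * ((1 - \<gamma>) ^ n * e v)" using Suc \<gamma> by (intro mult_left_mono) auto
    finally show ?case by simp
  qed
  have A_small: "norm (A (x n)) \<le> sqrt (e v) * sqrt (1 - \<gamma>) ^ n" for n
  proof -
    have "norm (A (x n)) = sqrt (A (x n) \<bullet> A (x n))" by (rule norm_eq_sqrt_inner)
    also have "\<dots> \<le> sqrt ((1 - \<gamma>) ^ n * e v)"
      using le_form[of "x n"] e_geo[of n] by (simp add: e_def)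
    finally show ?thesis by (simp add: real_sqrt_mult real_sqrt_power mult.commute)
  qed
  have geo: "summable (\<lambda>n. sqrt (e v) * sqrt (1 - \<gamma>) ^ n)"
    using \<gamma> by (intro summable_mult summable_geometric) auto
  have "summable (\<lambda>n. A (x n))"
    by (rule summable_comparison_test'[OF geo, of 0]) (use A_small in auto)
  then have A_sums: "summable (\<lambda>n. x n - x (Suc n))" by (simp add: x_Suc)
  have "(\<lambda>n. \<Sum>i<n. x i - x (Suc i)) \<longlonglongrightarrow> (\<Sum>n. x n - x (Suc n))"
    by (rule summable_LIMSEQ[OF A_sums])
  moreover have "(\<Sum>i<n. x i - x (Suc i)) = v - x n" for n
    by (induction n) (auto simp: x_def)
  ultimately have "(\<lambda>n. v - (v - x n)) \<longlonglongrightarrow> v - (\<Sum>n. x n - x (Suc n))"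
    by (intro tendsto_diff tendsto_const) simp
  then obtain y where y: "x \<longlonglongrightarrow> y" by (auto simp: fun_eq_iff)
  have blA: "bounded_linear A"
    by (intro bounded_linear.intro bounded_linear_axioms.intro lin exI[of _ 1])
      (use contr in auto)
  have "(\<lambda>n. A (x n)) \<longlonglongrightarrow> A y" using y by (rule bounded_linear.tendsto[OF blA])
  moreover have "(\<lambda>n. A (x n)) \<longlonglongrightarrow> 0"
    using summable_LIMSEQ_zero[OF A_sums] by (simp add: x_Suc)
  ultimately have Ay: "A y = 0" by (rule LIMSEQ_unique)
  have "y \<bullet> x n = y \<bullet> v" for n
    by (induction n) (auto simp: x_Suc inner_diff sym[symmetric] Ay, simp add: x_def)
  then have "y \<bullet> x n = 0" for n using orth[OF Ay] by simp
  moreover have "(\<lambda>n. y \<bullet> x n) \<longlonglongrightarrow> y \<bullet> y" using y by (intro tendsto_intros)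
  ultimately have "y \<bullet> y = 0" by (simp add: LIMSEQ_const_iff)
  then have y0: "y = 0" by simp
  have tele: "(norm v)\<^sup>2 \<le> (norm (x N))\<^sup>2 + 2 * (\<Sum>n<N. e (x n))" for N
  proof (induction N)
    case 0 then show ?case by (simp add: x_def)
  next
    case (Suc N)
    have "(norm (x (Suc N)))\<^sup>2 = (norm (x N))\<^sup>2 - 2 * e (x N) + A (x N) \<bullet> A (x N)"
      by (simp add: x_Suc power2_norm_eq_inner inner_diff e_def inner_commute)
    then have "(norm (x N))\<^sup>2 \<le> (norm (x (Suc N)))\<^sup>2 + 2 * e (x N)"
      using inner_ge_zero[of "A (x N)"] by linarith
    then show ?case using Suc by simp
  qed
  have sum_e: "(\<Sum>n<N. e (x n)) \<le> e v / \<gamma>" for N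
  proof -
    have "(\<Sum>n<N. e (x n)) \<le> (\<Sum>n<N. (1 - \<gamma>) ^ n * e v)" by (intro sum_mono e_geo)
    also have "\<dots> = (1 - (1 - \<gamma>) ^ N) / \<gamma> * e v"
      using \<gamma> by (simp flip: sum_distrib_right add: sum_gp_strict)
    also have "\<dots> \<le> 1 / \<gamma> * e v"
      using \<gamma> e_nonneg by (intro mult_right_mono divide_right_mono) auto
    finally show ?thesis by simp
  qed
  have "(norm v)\<^sup>2 \<le> (norm (x N))\<^sup>2 + 2 / \<gamma> * e v" for N
    using tele[of N] sum_e[of N] by simp
  moreover have "(\<lambda>N. (norm (x N))\<^sup>2 + 2 / \<gamma> * e v) \<longlonglongrightarrow> (norm (0::'h))\<^sup>2 + 2 / \<gamma> * e v"
    using y unfolding y0 by (intro tendsto_intros)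
  ultimately show ?thesis
    using Lim_bounded2[of _ "(norm (0::'h))\<^sup>2 + 2 / \<gamma> * e v" 0 "(norm v)\<^sup>2"]
    by (auto simp: e_def)
qed

section \<open>Contraction semigroups\<close>

lemma filterlim_divide_real_at_right_0:
  fixes t :: real
  assumes "0 < t"
  shows "filterlim (\<lambda>n. t / real n) (at_right 0) sequentially"
  unfolding filterlim_at
proof
  show "\<forall>\<^sub>F n in sequentially. t / real n \<in> {0<..} \<and> t / real n \<noteq> 0"
    using eventually_gt_at_top[of 0] by eventually_elim (use assms in auto)
  show "(\<lambda>n. t / real n) \<longlonglongrightarrow> 0" by (rule lim_const_over_n)
qed

locale contraction_semigroup =
  fixes K :: "real \<Rightarrow> 'h::{real_inner,banach} \<Rightarrow> 'h"
  assumes linear: "0 \<le> t \<Longrightarrow> linear (K t)"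
    and contraction: "0 \<le> t \<Longrightarrow> norm (K t u) \<le> norm u"
    and semigroup: "0 \<le> s \<Longrightarrow> 0 \<le> t \<Longrightarrow> K s (K t u) = K (s + t) u"
begin

text \<open>
  Graph of minus the infinitesimal generator: for \<open>K t = exp (- t C)\<close> this is the graph of \<open>C\<close>.
\<close>

definition gen :: "('h \<times> 'h) set" where
  "gen = {(u, v). ((\<lambda>t. (u - K t u) /\<^sub>R t) \<longlongrightarrow> v) (at_right 0)}"

lemma gen_add:
  assumes "(u, v) \<in> gen" "(u', v') \<in> gen"
  shows "(u + u', v + v') \<in> gen"
proof -
  have "((\<lambda>t. (u - K t u) /\<^sub>R t + (u' - K t u') /\<^sub>R t) \<longlongrightarrow> v + v') (at_right 0)"
    using assms by (auto simp: gen_def intro: tendsto_add)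
  moreover have "\<forall>\<^sub>F t in at_right 0. (u - K t u) /\<^sub>R t + (u' - K t u') /\<^sub>R t
      = (u + u' - K t (u + u')) /\<^sub>R t"
    using eventually_at_right_less[of "0::real"]
    by eventually_elim (simp add: linear_add[OF linear] algebra_simps)
  ultimately show ?thesis by (auto simp: gen_def cong: tendsto_cong)
qed

lemma gen_scale:
  assumes "(u, v) \<in> gen"
  shows "(c *\<^sub>R u, c *\<^sub>R v) \<in> gen"
proof -
  have "((\<lambda>t. c *\<^sub>R ((u - K t u) /\<^sub>R t)) \<longlongrightarrow> c *\<^sub>R v) (at_right 0)"
    using assms unfolding gen_def by (intro tendsto_scaleR tendsto_const) simp
  moreover have "\<forall>\<^sub>F t in at_right 0. c *\<^sub>R ((u - K t u) /\<^sub>R t)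
      = (c *\<^sub>R u - K t (c *\<^sub>R u)) /\<^sub>R t"
    using eventually_at_right_less[of "0::real"]
    by eventually_elim (simp add: linear_scale[OF linear] algebra_simps)
  ultimately show ?thesis by (auto simp: gen_def cong: tendsto_cong)
qed

lemma gen_diff:
  assumes "(u, v) \<in> gen" "(u', v') \<in> gen"
  shows "(u - u', v - v') \<in> gen"
  using gen_add[OF assms(1) gen_scale[OF assms(2), of "-1"]] by simp

lemma gen_nonneg:
  assumes "(u, v) \<in> gen"
  shows "0 \<le> v \<bullet> u"
proof -
  have "((\<lambda>t. ((u - K t u) /\<^sub>R t) \<bullet> u) \<longlongrightarrow> v \<bullet> u) (at_right 0)"
    using assms unfolding gen_def by (intro tendsto_inner tendsto_const) simp
  moreover have "\<forall>\<^sub>F t in at_right 0. 0 \<le> ((u - K t u) /\<^sub>R t) \<bullet> u"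
    using eventually_at_right_less[of "0::real"]
  proof eventually_elim
    case (elim t)
    have "K t u \<bullet> u \<le> norm (K t u) * norm u" by (rule norm_cauchy_schwarz)
    also have "\<dots> \<le> norm u * norm u" using contraction[of t u] elim by (intro mult_right_mono) auto
    also have "\<dots> = u \<bullet> u" by (simp add: norm_eq_sqrt_inner)
    finally show ?case using elim by (simp add: inner_diff)
  qed
  ultimately show ?thesis by (intro tendsto_lowerbound) auto
qed

lemma gen_invariant:
  assumes "(u, v) \<in> gen" "0 \<le> s"
  shows "(K s u, K s v) \<in> gen"
proof -
  have bl: "bounded_linear (K s)"
    using linear[OF assms(2)] contraction[OF assms(2)]
    by (intro bounded_linear.intro bounded_linear_axioms.intro exI[of _ 1]) auto
  have "((\<lambda>t. K s ((u - K t u) /\<^sub>R t)) \<longlongrightarrow> K s v) (at_right 0)"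
    using assms by (auto simp: gen_def intro: bounded_linear.tendsto[OF bl])
  moreover have "\<forall>\<^sub>F t in at_right 0. K s ((u - K t u) /\<^sub>R t)
      = (K s u - K t (K s u)) /\<^sub>R t"
    using eventually_at_right_less[of "0::real"]
  proof eventually_elim
    case (elim t)
    then show ?case using assms(2)
      by (simp add: linear_scale[OF linear] linear_diff[OF linear] semigroup add.commute)
  qed
  ultimately show ?thesis by (auto simp: gen_def cong: tendsto_cong)
qed

lemma gen_kernelI:
  assumes "\<And>t. 0 < t \<Longrightarrow> K t u = u"
  shows "(u, 0) \<in> gen"
proof -
  have "((\<lambda>t. (u - K t u) /\<^sub>R t) \<longlongrightarrow> 0) (at_right 0)"
    by (rule tendsto_eventually, rule eventually_mono[OF eventually_at_right_less])
      (simp add: assms)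
  then show ?thesis by (simp add: gen_def)
qed

text \<open>
  By the contraction property \<open>K t u\<close> differs from \<open>u\<close> by at most \<open>n\<close> times the displacement of
  \<open>u\<close> over a time \<open>t / n\<close>, and this displacement is \<open>o (t / n)\<close>.
\<close>

lemma gen_kernelD:
  assumes u: "(u, 0) \<in> gen" and t: "0 < t"
  shows "K t u = u"
proof -
  have step: "norm (K (real (Suc n) * h) u - u) \<le> real (Suc n) * norm (K h u - u)"
    if h: "0 < h" for n h
  proof (induction n)
    case 0 then show ?case by simp
  next
    case (Suc n)
    have "K (real (Suc (Suc n)) * h) u - u = K h (K (real (Suc n) * h) u - u) + (K h u - u)"
      using h by (simp add: linear_diff[OF linear] semigroup algebra_simps)
    also have "norm \<dots> \<le> norm (K (real (Suc n) * h) u - u) + norm (K h u - u)"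
      using h by (intro order_trans[OF norm_triangle_ineq] add_right_mono contraction) simp
    also have "\<dots> \<le> real (Suc (Suc n)) * norm (K h u - u)"
      using Suc by (simp add: algebra_simps)
    finally show ?case .
  qed
  have "((\<lambda>h. (u - K h u) /\<^sub>R h) \<longlongrightarrow> 0) (at_right 0)" using u by (simp add: gen_def)
  then have "(\<lambda>n. (u - K (t / real n) u) /\<^sub>R (t / real n)) \<longlonglongrightarrow> 0"
    by (rule filterlim_compose[OF _ filterlim_divide_real_at_right_0[OF t]])
  then have "(\<lambda>n. (u - K (t / real (Suc n)) u) /\<^sub>R (t / real (Suc n))) \<longlonglongrightarrow> 0"
    by (rule LIMSEQ_Suc)
  then have "(\<lambda>n. t * norm ((u - K (t / real (Suc n)) u) /\<^sub>R (t / real (Suc n)))) \<longlonglongrightarrow> t * norm (0::'h)"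
    by (intro tendsto_mult tendsto_const tendsto_norm)
  moreover have "norm (K t u - u) \<le> t * norm ((u - K (t / real (Suc n)) u) /\<^sub>R (t / real (Suc n)))" for n
  proof -
    define h where "h = t / real (Suc n)"
    have h: "0 < h" and th: "t = real (Suc n) * h" using t by (auto simp: h_def)
    have "norm (K t u - u) \<le> real (Suc n) * norm (K h u - u)"
      unfolding th by (rule step[OF h])
    also have "\<dots> = t * norm ((u - K h u) /\<^sub>R h)"
      using h by (simp add: th norm_minus_commute)
    finally show ?thesis by (simp add: h_def)
  qed
  ultimately have "norm (K t u - u) \<le> t * norm (0::'h)"
    by (intro Lim_bounded2[where N = 0]) auto
  then show ?thesis by simp
qed

text \<open>
  The derivative of the square of the norm of \<open>K t u\<close> is \<open>- 2 (K t v \<bullet> K t u)\<close>, which is at most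
  \<open>- 2 \<kappa>\<close> times that square.  Since each \<open>K s\<close> is a contraction, the difference quotient of
  \<open>K\<close> at \<open>K s u\<close> is as close to \<open>K s v\<close> as the one at \<open>u\<close> is to \<open>v\<close>.  This uniformity in \<open>s\<close>
  allows a discrete Gronwall argument with steps of length \<open>t / n\<close>.
\<close>

lemma norm_decay_of_coercive:
  assumes uv: "(u, v) \<in> gen"
    and \<kappa>: "0 < \<kappa>"
    and coercive: "\<And>s. 0 \<le> s \<Longrightarrow> \<kappa> * (norm (K s u))\<^sup>2 \<le> K s v \<bullet> K s u"
    and t: "0 \<le> t"
  shows "norm (K t u) \<le> exp (- \<kappa> * t) * norm u"
proof (cases "t = 0")
  case True then show ?thesis using contraction[of 0 u] by simp
next
  case False
  with t have t: "0 < t" by simp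
  have main: "(norm (K t u))\<^sup>2 \<le> exp (- 2 * \<kappa> * t) * (norm u)\<^sup>2 + \<epsilon> * (2 * norm u + 1) / (2 * \<kappa>)"
    if \<epsilon>: "0 < \<epsilon>" for \<epsilon>
  proof -
    let ?q = "\<lambda>h. (u - K h u) /\<^sub>R h"
    have q: "(?q \<longlongrightarrow> v) (at_right 0)" using uv by (simp add: gen_def)
    have h_lim: "((\<lambda>h::real. h) \<longlongrightarrow> 0) (at_right 0)" by (rule tendsto_ident_at)
    have "((\<lambda>h. h * (norm (?q h))\<^sup>2) \<longlongrightarrow> 0 * (norm v)\<^sup>2) (at_right 0)"
      by (intro tendsto_mult h_lim tendsto_power tendsto_norm q)
    then have ev2: "\<forall>\<^sub>F h in at_right 0. h * (norm (?q h))\<^sup>2 < \<epsilon>"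
      using \<epsilon> by (intro order_tendstoD(2)) auto
    have ev1: "\<forall>\<^sub>F h in at_right 0. norm (?q h - v) < \<epsilon>"
      using q \<epsilon> by (simp add: tendsto_iff dist_norm)
    have "((\<lambda>h. 2 * \<kappa> * h) \<longlongrightarrow> 2 * \<kappa> * 0) (at_right 0)"
      by (intro tendsto_mult tendsto_const h_lim)
    then have ev3: "\<forall>\<^sub>F h in at_right 0. 2 * \<kappa> * h < 1"
      by (intro order_tendstoD(2)) auto
    have ev: "\<forall>\<^sub>F h in at_right 0. h * (norm (?q h))\<^sup>2 < \<epsilon> \<and> norm (?q h - v) < \<epsilon> \<and> 2 * \<kappa> * h < 1"
      using ev1 ev2 ev3 by eventually_elim simp
    from eventually_conj[OF eventually_compose_filterlim[OF ev filterlim_divide_real_at_right_0[OF t]]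
        eventually_gt_at_top[of 0]]
    obtain n :: nat where n: "n > 0" and
      n': "t / n * (norm (?q (t / n)))\<^sup>2 < \<epsilon>" "norm (?q (t / n) - v) < \<epsilon>" "2 * \<kappa> * (t / n) < 1"
      by (auto dest!: eventually_happens)
    define h where "h = t / n"
    have h: "0 < h" using t n by (simp add: h_def)
    have step: "(norm (K (s + h) u))\<^sup>2 \<le> (1 - 2 * \<kappa> * h) * (norm (K s u))\<^sup>2
        + h * (\<epsilon> * (2 * norm u + 1))" if s: "0 \<le> s" for s
    proof -
      define w r where "w = K s u" and "r = K s (?q h - v)"
      have r: "norm r \<le> \<epsilon>"
        using contraction[OF s, of "?q h - v"] n'(2) by (simp add: r_def h_def)
      have w: "norm w \<le> norm u" using contraction[OF s] by (simp add: w_def)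
      have "h *\<^sub>R (K s v + r) = K s (h *\<^sub>R ?q h)"
        using s by (simp add: r_def linear_diff[OF linear] linear_scale[OF linear])
      also have "h *\<^sub>R ?q h = u - K h u" using h by simp
      also have "K s (u - K h u) = w - K (s + h) u"
        using s h by (simp add: w_def linear_diff[OF linear] semigroup)
      finally have diff: "w - K (s + h) u = h *\<^sub>R (K s v + r)" by simp
      have "w - K (s + h) u = K s (h *\<^sub>R ?q h)"
        using s h by (simp add: w_def linear_diff[OF linear] semigroup)
      then have "norm (w - K (s + h) u) \<le> norm (h *\<^sub>R ?q h)"
        using contraction[OF s, of "h *\<^sub>R ?q h"] by (simp only:)
      then have "(norm (w - K (s + h) u))\<^sup>2 \<le> (norm (h *\<^sub>R ?q h))\<^sup>2" by (intro power_mono) auto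
      also have "(norm (h *\<^sub>R ?q h))\<^sup>2 = h * (h * (norm (?q h))\<^sup>2)"
        unfolding norm_scaleR by (simp only: power2_eq_square abs_of_pos[OF h] mult_ac)
      also have "\<dots> \<le> h * \<epsilon>" using n'(1) h by (intro mult_left_mono) (auto simp: h_def)
      finally have quad: "(norm (w - K (s + h) u))\<^sup>2 \<le> h * \<epsilon>" .
      have "(norm (K (s + h) u))\<^sup>2
          = (norm w)\<^sup>2 - 2 * (w \<bullet> (w - K (s + h) u)) + (norm (w - K (s + h) u))\<^sup>2"
        by (simp add: power2_norm_eq_inner inner_diff inner_commute)
      also have "\<dots> = (norm w)\<^sup>2 - 2 * h * (K s v \<bullet> w) - 2 * h * (r \<bullet> w)
          + (norm (w - K (s + h) u))\<^sup>2"
        unfolding diff by (simp add: inner_add inner_commute algebra_simps)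
      also have "\<dots> \<le> (norm w)\<^sup>2 - 2 * h * (\<kappa> * (norm w)\<^sup>2) + 2 * h * (\<epsilon> * norm u) + h * \<epsilon>"
      proof -
        have "2 * h * (\<kappa> * (norm w)\<^sup>2) \<le> 2 * h * (K s v \<bullet> w)"
          using coercive[OF s] h by (intro mult_left_mono) (auto simp: w_def)
        moreover have "- (2 * h * (r \<bullet> w)) \<le> 2 * h * (\<epsilon> * norm u)"
        proof -
          have "- (r \<bullet> w) \<le> norm r * norm w" using Cauchy_Schwarz_ineq2[of r w] by linarith
          also have "\<dots> \<le> \<epsilon> * norm u" using r w \<epsilon> by (intro mult_mono) auto
          finally have "2 * h * (- (r \<bullet> w)) \<le> 2 * h * (\<epsilon> * norm u)"
            using h by (intro mult_left_mono) auto
          then show ?thesis by simp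
        qed
        ultimately show ?thesis using quad by linarith
      qed
      finally show ?thesis by (simp add: w_def algebra_simps)
    qed
    \<comment> \<open>\<open>b\<close> is the fixed point of the recursion in \<open>step\<close>.\<close>
    define b where "b = \<epsilon> * (2 * norm u + 1) / (2 * \<kappa>)"
    have hb: "h * (\<epsilon> * (2 * norm u + 1)) = 2 * \<kappa> * h * b" using \<kappa> by (simp add: b_def)
    have b0: "0 \<le> b" using \<epsilon> \<kappa> by (simp add: b_def)
    have th: "0 \<le> 1 - 2 * \<kappa> * h" using n'(3) by (simp add: h_def)
    have "(norm (K (real k * h) u))\<^sup>2 \<le> (1 - 2 * \<kappa> * h) ^ k * (norm u)\<^sup>2 + b" for k
    proof (induction k)
      case 0
      have "(norm (K 0 u))\<^sup>2 \<le> (norm u)\<^sup>2" using contraction[of 0 u] by (intro power_mono) auto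
      then have "(norm (K 0 u))\<^sup>2 \<le> (norm u)\<^sup>2 + b" using b0 by linarith
      then show ?case by simp
    next
      case (Suc k)
      have "(norm (K (real (Suc k) * h) u))\<^sup>2 = (norm (K (real k * h + h) u))\<^sup>2"
        by (simp add: algebra_simps)
      also have "\<dots> \<le> (1 - 2 * \<kappa> * h) * (norm (K (real k * h) u))\<^sup>2 + 2 * \<kappa> * h * b"
        using step[of "real k * h"] h unfolding hb by simp
      also have "\<dots> \<le> (1 - 2 * \<kappa> * h) * ((1 - 2 * \<kappa> * h) ^ k * (norm u)\<^sup>2 + b) + 2 * \<kappa> * h * b"
        using Suc th by (intro add_right_mono mult_left_mono) auto
      finally show ?case by (simp add: algebra_simps)
    qed
    from this[of n] have "(norm (K t u))\<^sup>2 \<le> (1 - 2 * \<kappa> * h) ^ n * (norm u)\<^sup>2 + b"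
      using n by (simp add: h_def)
    also have "(1 - 2 * \<kappa> * h) ^ n \<le> exp (- (2 * \<kappa> * h)) ^ n"
      using th exp_ge_add_one_self[of "- (2 * \<kappa> * h)"] by (intro power_mono) auto
    also have "exp (- (2 * \<kappa> * h)) ^ n = exp (- 2 * \<kappa> * t)"
      using n by (simp flip: exp_of_nat_mult add: h_def)
    finally show ?thesis by (simp add: b_def mult_right_mono)
  qed
  have "(norm (K t u))\<^sup>2 \<le> exp (- 2 * \<kappa> * t) * (norm u)\<^sup>2"
  proof (rule field_le_epsilon)
    fix \<delta> :: real assume "0 < \<delta>"
    then have "0 < \<delta> * (2 * \<kappa>) / (2 * norm u + 1)"
      using \<kappa> by (intro divide_pos_pos mult_pos_pos) (auto intro: add_nonneg_pos)
    moreover have "\<delta> * (2 * \<kappa>) / (2 * norm u + 1) * (2 * norm u + 1) / (2 * \<kappa>) = \<delta>"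
    proof -
      have "2 * norm u + 1 \<noteq> 0" using norm_ge_zero[of u] by linarith
      then show ?thesis using \<kappa> by (simp only: times_divide_eq_left nonzero_mult_div_cancel_right) simp
    qed
    ultimately show "(norm (K t u))\<^sup>2 \<le> exp (- 2 * \<kappa> * t) * (norm u)\<^sup>2 + \<delta>"
      using main by metis
  qed
  also have "\<dots> = (exp (- \<kappa> * t) * norm u)\<^sup>2"
    by (simp add: power_mult_distrib flip: exp_double)
  finally show ?thesis by (rule power2_le_imp_le) simp
qed

text \<open>
  Let \<open>C\<close> be the operator with graph \<open>gen\<close>.  The bounded symmetric operator \<open>J = p (C + p)\<^sup>-\<^sup>1\<close>
  satisfies \<open>0 \<le> J \<le> 1\<close>, and \<open>A = 1 - J\<close> has the kernel of \<open>C\<close>.  The lower bounds for \<open>C - c\<close>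
  with \<open>0 < c < 2 p\<close> become lower bounds for \<open>A - a\<close> with \<open>a = c / (p + c)\<close>, which runs
  through \<open>(0, 2 / 3)\<close>.  So \<open>bounded_below_symmetric_inequality\<close> and \<open>coercive_off_kernel\<close> apply
  to \<open>A\<close>; they show that the form of \<open>J\<close> is at most \<open>2 / 3\<close> on the orthogonal complement of
  \<open>e\<close>.  In terms of \<open>C\<close> this is \<open>C \<ge> p / 2\<close> there, and \<open>norm_decay_of_coercive\<close> gives the
  decay on the domain of \<open>C\<close>, hence everywhere by density.
\<close>

theorem spectral_gap:
  assumes sym: "\<And>u v u' v'. (u, v) \<in> gen \<Longrightarrow> (u', v') \<in> gen \<Longrightarrow> v \<bullet> u' = u \<bullet> v'"
    and dense: "\<And>u \<epsilon>. 0 < \<epsilon> \<Longrightarrow> \<exists>(x, y)\<in>gen. norm (u - x) < \<epsilon>"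
    and p: "0 < p"
    and onto: "\<And>w. \<exists>(u, v)\<in>gen. v + p *\<^sub>R u = w"
    and bound: "\<And>c. 0 < c \<Longrightarrow> c < 2 * p \<Longrightarrow> \<exists>k. \<forall>(u, v)\<in>gen. norm u \<le> k * norm (v - c *\<^sub>R u)"
    and e: "(e, 0) \<in> gen" "norm e = 1"
    and simple: "\<And>u. (u, 0) \<in> gen \<Longrightarrow> \<exists>a. u = a *\<^sub>R e"
    and invariant: "\<And>t u. 0 \<le> t \<Longrightarrow> e \<bullet> K t u = e \<bullet> u"
  shows "\<exists>\<kappa>>0. \<forall>t\<ge>0. \<forall>u. e \<bullet> u = 0 \<longrightarrow> norm (K t u) \<le> exp (- \<kappa> * t) * norm u"
proof -
  have "\<exists>x. (x, p *\<^sub>R (v - x)) \<in> gen" for v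
  proof -
    obtain x y where "(x, y) \<in> gen" "y + p *\<^sub>R x = p *\<^sub>R v" using onto[of "p *\<^sub>R v"] by auto
    moreover from this have "y = p *\<^sub>R (v - x)" by (simp add: algebra_simps eq_diff_eq)
    ultimately show ?thesis by auto
  qed
  then obtain J where J: "\<And>v. (J v, p *\<^sub>R (v - J v)) \<in> gen" by metis
  have J_unique: "x = J v" if "(x, p *\<^sub>R (v - x)) \<in> gen" for x v
  proof -
    have "(p *\<^sub>R (v - x) - p *\<^sub>R (v - J v)) \<bullet> (x - J v) \<ge> 0"
      by (rule gen_nonneg[OF gen_diff[OF that J]])
    moreover have "p *\<^sub>R (v - x) - p *\<^sub>R (v - J v) = - (p *\<^sub>R (x - J v))"
      by (simp add: algebra_simps)
    ultimately have "p * ((x - J v) \<bullet> (x - J v)) \<le> 0" by simp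
    then have "(x - J v) \<bullet> (x - J v) \<le> 0" using p by (simp add: mult_le_0_iff)
    then show ?thesis by (metis inner_gt_zero_iff not_le right_minus_eq)
  qed
  have linJ: "linear J"
  proof (rule linearI)
    show "J (u + v) = J u + J v" for u v
      using gen_add[OF J[of u] J[of v]]
      by (intro J_unique[symmetric]) (simp add: algebra_simps)
    show "J (c *\<^sub>R u) = c *\<^sub>R J u" for c u
      using gen_scale[OF J[of u], of c]
      by (intro J_unique[symmetric]) (simp add: algebra_simps)
  qed
  have symJ: "J u \<bullet> v = u \<bullet> J v" for u v
    using sym[OF J[of u] J[of v]] p by (simp add: inner_diff)
  have posJ: "J v \<bullet> J v \<le> J v \<bullet> v" for v
    using gen_nonneg[OF J[of v]] p by (simp add: inner_diff inner_commute zero_le_mult_iff)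
  define A where "A v = v - J v" for v
  have linA: "linear A" unfolding A_def by (intro linear_compose_sub linear_ident linJ)
  have symA: "A u \<bullet> v = u \<bullet> A v" for u v by (simp add: A_def inner_diff symJ)
  have A_form: "A v \<bullet> A v \<le> A v \<bullet> v" for v
    using posJ[of v] by (simp add: A_def inner_diff inner_commute)
  have contrA: "norm (A v) \<le> norm v" for v
  proof -
    have "norm (A v) * norm (A v) \<le> norm (A v) * norm v"
      using A_form[of v] norm_cauchy_schwarz[of "A v" v] by (simp add: norm_eq_sqrt_inner)
    then show ?thesis by (metis mult_le_cancel_left_pos norm_ge_zero order_le_less)
  qed
  have ge_form: "(2 / 3) * (A v \<bullet> v) \<le> A v \<bullet> A v" for v
  proof (rule bounded_below_symmetric_inequality[OF linA symA contrA])
    fix a :: real assume a: "0 < a" "a < 2 / 3"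
    \<comment> \<open>The point \<open>c\<close> with \<open>a = c / (p + c)\<close>; then \<open>(C - c) J = (p + c) (A - a)\<close>.\<close>
    define c where "c = p * (1 / (1 - a) - 1)"
    have c: "0 < c" "c < 2 * p" using a p by (auto simp: c_def field_simps)
    have pc: "p = (p + c) * (1 - a)" using a by (simp add: c_def field_simps)
    obtain k where k: "\<And>u v. (u, v) \<in> gen \<Longrightarrow> norm u \<le> k * norm (v - c *\<^sub>R u)"
      using bound[OF c] by blast
    \<comment> \<open>The bound for \<open>J v\<close> in terms of \<open>A v - a v\<close> yields one for \<open>v\<close>, as \<open>(1 - a) v = (A v - a v) + J v\<close>.\<close>
    define k' where "k' = max k 0 * (p + c) + 1"
    have k': "k' > 0" using p c by (auto simp: k'_def intro!: add_nonneg_pos)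
    have "(1 - a) / k' * norm v \<le> norm (A v - a *\<^sub>R v)" for v
    proof -
      have eq: "A v - a *\<^sub>R v = (1 - a) *\<^sub>R v - J v" by (simp add: A_def algebra_simps)
      have "p *\<^sub>R (v - J v) - c *\<^sub>R J v = p *\<^sub>R v - (p + c) *\<^sub>R J v" by (simp add: algebra_simps)
      also have "\<dots> = (p + c) *\<^sub>R (A v - a *\<^sub>R v)"
        unfolding eq by (subst pc) (simp add: scaleR_right_diff_distrib)
      finally have "norm (J v) \<le> k * norm ((p + c) *\<^sub>R (A v - a *\<^sub>R v))" using k[OF J[of v]] by simp
      also have "\<dots> \<le> max k 0 * norm ((p + c) *\<^sub>R (A v - a *\<^sub>R v))" by (intro mult_right_mono) auto
      finally have nJ: "norm (J v) \<le> max k 0 * (p + c) * norm (A v - a *\<^sub>R v)"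
        using p c by (simp add: mult.assoc)
      have "(1 - a) * norm v = norm ((1 - a) *\<^sub>R v)" using a by simp
      also have "\<dots> = norm ((A v - a *\<^sub>R v) + J v)" by (simp add: eq)
      also have "\<dots> \<le> norm (A v - a *\<^sub>R v) + norm (J v)" by (rule norm_triangle_ineq)
      also have "\<dots> \<le> k' * norm (A v - a *\<^sub>R v)" using nJ by (simp add: k'_def algebra_simps)
      finally show ?thesis using k' by (simp add: field_simps)
    qed
    then show "\<exists>k>0. \<forall>v. k * norm v \<le> norm (A v - a *\<^sub>R v)"
      using a k' by (intro exI[of _ "(1 - a) / k'"]) auto
  qed simp
  have kerA: "w \<bullet> v = 0" if "A w = 0" "e \<bullet> v = 0" for v w
  proof -
    have "J w = w" using that by (simp add: A_def)
    then have "(w, 0) \<in> gen" using J[of w] by simp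
    then show ?thesis using simple[of w] that by auto
  qed
  have J_form: "J v \<bullet> v \<le> (2 / 3) * (v \<bullet> v)" if "e \<bullet> v = 0" for v
    using coercive_off_kernel[OF linA symA A_form ge_form _ _ kerA[OF _ that]]
    by (simp add: power2_norm_eq_inner A_def inner_diff)
  have coercive: "p / 2 * (norm u)\<^sup>2 \<le> v \<bullet> u" if uv: "(u, v) \<in> gen" and u: "e \<bullet> u = 0" for u v
  proof -
    define w where "w = u + v /\<^sub>R p"
    have Jw: "J w = u" using uv p by (intro J_unique[symmetric]) (simp add: w_def)
    \<comment> \<open>The form bound for \<open>J\<close> holds at \<open>J w = u\<close>, which is orthogonal to \<open>e\<close>.\<close>
    have "J w \<bullet> J w \<le> (2 / 3) * (J w \<bullet> w)"
    proof (rule symmetric_form_bound[OF linJ symJ])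
      show "0 \<le> J x \<bullet> x" for x using posJ[of x] inner_ge_zero[of "J x"] by linarith
      show "J (J w) \<bullet> J w \<le> 2 / 3 * (J w \<bullet> J w)" unfolding Jw by (rule J_form[OF u])
    qed simp
    moreover have "J w \<bullet> w = u \<bullet> u + (u \<bullet> v) / p"
      unfolding Jw by (simp add: w_def inner_add divide_inverse)
    ultimately have "u \<bullet> u \<le> 2 * ((u \<bullet> v) / p)" unfolding Jw by linarith
    then have "p * (u \<bullet> u) \<le> 2 * (v \<bullet> u)"
      using p by (simp add: pos_le_divide_eq mult.commute inner_commute)
    then show ?thesis unfolding power2_norm_eq_inner by simp
  qed
  have decay: "norm (K t u) \<le> exp (- (p / 2) * t) * norm u"
    if "0 \<le> t" "(u, v) \<in> gen" "e \<bullet> u = 0" for t u v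
  proof (rule norm_decay_of_coercive[OF that(2)])
    show "p / 2 * (norm (K s u))\<^sup>2 \<le> K s v \<bullet> K s u" if "0 \<le> s" for s
      by (intro coercive gen_invariant \<open>(u, v) \<in> gen\<close> that) (use invariant \<open>e \<bullet> u = 0\<close> that in simp)
  qed (use p that in auto)
  have "norm (K t u) \<le> exp (- (p / 2) * t) * norm u" if t: "0 \<le> t" and u: "e \<bullet> u = 0" for t u
  proof (rule field_le_epsilon)
    fix \<epsilon> :: real assume "0 < \<epsilon>"
    then have "0 < \<epsilon> / 4" by simp
    from dense[OF this] obtain x y where xy: "(x, y) \<in> gen" "norm (u - x) < \<epsilon> / 4" by blast
    \<comment> \<open>The approximation from the domain, made orthogonal to \<open>e\<close>.\<close>
    define z where "z = x - (e \<bullet> x) *\<^sub>R e"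
    have z_gen: "(z, y) \<in> gen"
      using gen_diff[OF xy(1) gen_scale[OF e(1), of "e \<bullet> x"]] by (simp add: z_def)
    have ez: "e \<bullet> z = 0" using e(2) by (simp add: z_def inner_diff norm_eq_sqrt_inner)
    have "u - z = (u - x) - (e \<bullet> (u - x)) *\<^sub>R e" using u by (simp add: z_def inner_diff)
    then have "norm (u - z) \<le> norm (u - x) + norm ((e \<bullet> (u - x)) *\<^sub>R e)"
      by (simp only: norm_triangle_ineq4)
    then have "norm (u - z) \<le> norm (u - x) + \<bar>e \<bullet> (u - x)\<bar>" using e(2) by simp
    then have uz: "norm (u - z) \<le> \<epsilon> / 2"
      using Cauchy_Schwarz_ineq2[of e "u - x"] e(2) xy(2) by simp
    have "norm (K t u) \<le> norm (K t z) + norm (K t (u - z))"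
      using norm_triangle_ineq[of "K t z" "K t (u - z)"] by (simp add: linear_diff[OF linear[OF t]])
    also have "\<dots> \<le> exp (- (p / 2) * t) * norm z + norm (u - z)"
      using decay[OF t z_gen ez] contraction[OF t] by (intro add_mono) auto
    also have "\<dots> \<le> exp (- (p / 2) * t) * (norm u + norm (u - z)) + norm (u - z)"
      using norm_triangle_ineq4[of u "u - z"] by (intro add_right_mono mult_left_mono) auto
    also have "\<dots> \<le> exp (- (p / 2) * t) * norm u + 2 * norm (u - z)"
    proof -
      have "exp (- (p / 2) * t) * norm (u - z) \<le> 1 * norm (u - z)"
        using t p by (intro mult_right_mono) auto
      then show ?thesis by (simp add: algebra_simps)
    qed
    finally show "norm (K t u) \<le> exp (- (p / 2) * t) * norm u + \<epsilon>" using uz by simp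
  qed
  then show ?thesis using p by (intro exI[of _ "p / 2"]) auto
qed

end

section \<open>The Hilbert space of square-integrable functions\<close>

lemma square_integrable_measurable:
  "square_integrable \<mu> f \<Longrightarrow> f \<in> borel_measurable \<mu>"
  by (simp add: square_integrable_def)

lemma integrable_mult_square_integrable:
  assumes "square_integrable \<mu> f" "square_integrable \<mu> g"
  shows "integrable \<mu> (\<lambda>x. f x * g x)"
proof (rule Bochner_Integration.integrable_bound)
  show "integrable \<mu> (\<lambda>x. (f x)\<^sup>2 + (g x)\<^sup>2)"
    using assms by (auto simp: square_integrable_def)
  show "(\<lambda>x. f x * g x) \<in> borel_measurable \<mu>"
    using assms by (auto simp: square_integrable_def)
  show "AE x in \<mu>. norm (f x * g x) \<le> norm ((f x)\<^sup>2 + (g x)\<^sup>2)"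
  proof (intro AE_I2)
    fix x
    have "2 * (\<bar>f x\<bar> * \<bar>g x\<bar>) \<le> (f x)\<^sup>2 + (g x)\<^sup>2"
      using sum_squares_bound[of "\<bar>f x\<bar>" "\<bar>g x\<bar>"] by simp
    moreover have "0 \<le> \<bar>f x\<bar> * \<bar>g x\<bar>" by simp
    ultimately show "norm (f x * g x) \<le> norm ((f x)\<^sup>2 + (g x)\<^sup>2)"
      unfolding real_norm_def abs_mult by linarith
  qed
qed

lemma square_integrable_add:
  assumes "square_integrable \<mu> f" "square_integrable \<mu> g"
  shows "square_integrable \<mu> (\<lambda>x. f x + g x)"
proof -
  have "integrable \<mu> (\<lambda>x. (f x)\<^sup>2 + (g x)\<^sup>2 + 2 * (f x * g x))"
    using assms integrable_mult_square_integrable[OF assms]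
    by (auto simp: square_integrable_def)
  moreover have "(f x + g x)\<^sup>2 = (f x)\<^sup>2 + (g x)\<^sup>2 + 2 * (f x * g x)" for x
    by (simp add: power2_sum)
  ultimately show ?thesis using assms by (auto simp: square_integrable_def)
qed

lemma square_integrable_cmult:
  "square_integrable \<mu> f \<Longrightarrow> square_integrable \<mu> (\<lambda>x. c * f x)"
  by (auto simp: square_integrable_def power_mult_distrib)

lemma square_integrable_diff:
  assumes "square_integrable \<mu> f" "square_integrable \<mu> g"
  shows "square_integrable \<mu> (\<lambda>x. f x - g x)"
  using square_integrable_add[OF assms(1) square_integrable_cmult[OF assms(2), of "-1"]] by simp

lemma square_integrable_zero: "square_integrable \<mu> (\<lambda>x. 0)"
  by (simp add: square_integrable_def)

lemma square_integrable_borel: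
  "square_integrable lborel f \<Longrightarrow> f \<in> borel_measurable borel"
  by (simp add: square_integrable_def)

lemma l2_inner_Cauchy_Schwarz:
  assumes f: "square_integrable \<mu> f" and g: "square_integrable \<mu> g"
  shows "\<bar>l2_inner \<mu> f g\<bar> \<le> l2_norm \<mu> f * l2_norm \<mu> g"
proof -
  define a b c where "a = l2_inner \<mu> f f" "b = l2_inner \<mu> f g" "c = l2_inner \<mu> g g"
  have quad: "0 \<le> a * s\<^sup>2 + 2 * b * s * r + c * r\<^sup>2" for s r
  proof -
    have "0 \<le> (LINT x|\<mu>. (s * f x + r * g x)\<^sup>2)" by simp
    also have "\<dots> = (LINT x|\<mu>. s\<^sup>2 * (f x * f x) + 2 * s * r * (f x * g x) + r\<^sup>2 * (g x * g x))"
      by (intro Bochner_Integration.integral_cong) (auto simp: power2_eq_square algebra_simps)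
    also have "\<dots> = s\<^sup>2 * a + 2 * s * r * b + r\<^sup>2 * c"
      using integrable_mult_square_integrable[OF f f] integrable_mult_square_integrable[OF f g]
        integrable_mult_square_integrable[OF g g]
      by (simp add: a_b_c_def l2_inner_def)
    finally show ?thesis by (simp add: algebra_simps)
  qed
  have pos: "0 \<le> a" "0 \<le> c" by (auto simp: a_b_c_def l2_inner_def)
  have "b\<^sup>2 \<le> a * c"
  proof (cases "a = 0")
    case True
    have "b = 0"
    proof (rule ccontr)
      assume "b \<noteq> 0"
      then show False using quad[of "- (c + 1) / (2 * b)" 1] True by (simp add: field_simps)
    qed
    then show ?thesis using pos by simp
  next
    case False
    have "0 \<le> a * (a * c - b\<^sup>2)"
      using quad[of "- b" a] by (simp add: power2_eq_square algebra_simps)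
    then show ?thesis using False pos by (simp add: zero_le_mult_iff)
  qed
  then have "\<bar>b\<bar> \<le> sqrt (a * c)" by (intro real_le_rsqrt) simp
  then show ?thesis by (simp add: l2_norm_def a_b_c_def real_sqrt_mult)
qed

text \<open>
  The truncations of \<open>h\<close> to bounded sets on which \<open>h\<close> is bounded are square-integrable, and
  pairing \<open>h\<close> with them bounds their norms.  Test functions \<open>F\<close> for which \<open>F h\<close> is not
  integrable are avoided in this way: for them the pairing is the default value \<open>0\<close> of the
  integral.
\<close>

lemma square_integrable_of_bounded_pairing:
  fixes h :: "'a::euclidean_space \<Rightarrow> real"
  assumes [measurable]: "h \<in> borel_measurable borel"
    and pairing: "\<And>F. square_integrable lborel F \<Longrightarrow>
      \<bar>l2_inner lborel F h\<bar> \<le> l2_norm lborel F * B"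
    and B: "0 \<le> B"
  shows "square_integrable lborel h \<and> l2_norm lborel h \<le> B"
proof -
  define A where "A n = {x::'a. norm x \<le> real n \<and> \<bar>h x\<bar> \<le> real n}" for n :: nat
  define F where "F n x = h x * indicator (A n) x" for n x
  have [measurable]: "A n \<in> sets borel" for n unfolding A_def by measurable
  have [measurable]: "F n \<in> borel_measurable borel" for n unfolding F_def by measurable
  have F_sq: "square_integrable lborel (F n)" for n
    unfolding square_integrable_def
  proof
    show "integrable lborel (\<lambda>x. (F n x)\<^sup>2)"
    proof (rule Bochner_Integration.integrable_bound)
      show "integrable lborel (\<lambda>x::'a. (real n)\<^sup>2 * indicator (cball 0 (real n)) x)"
        by (intro integrable_mult_right integrable_real_indicator emeasure_bounded_finite
            bounded_cball) simp
      show "AE x in lborel. norm ((F n x)\<^sup>2) \<le> norm ((real n)\<^sup>2 * indicator (cball 0 (real n)) x :: real)"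
        by (intro AE_I2) (auto simp: F_def A_def indicator_def abs_le_square_iff[symmetric])
    qed simp
  qed simp
  have F_le: "l2_norm lborel (F n) \<le> B" for n
  proof -
    have "l2_inner lborel (F n) h = l2_inner lborel (F n) (F n)"
      unfolding l2_inner_def F_def
      by (intro Bochner_Integration.integral_cong) (auto simp: indicator_def)
    also have "\<dots> = (l2_norm lborel (F n))\<^sup>2" by (simp add: l2_norm_def l2_inner_def)
    finally have "l2_norm lborel (F n) * l2_norm lborel (F n) \<le> l2_norm lborel (F n) * B"
      using pairing[OF F_sq[of n]] by (simp add: power2_eq_square)
    moreover have "0 \<le> l2_norm lborel (F n)" by (simp add: l2_norm_def l2_inner_def)
    ultimately show ?thesis using B by (metis mult_le_cancel_left_pos order_le_less)
  qed
  have lim: "(\<integral>\<^sup>+x. ennreal ((h x)\<^sup>2) \<partial>lborel) = (SUP n. \<integral>\<^sup>+x. ennreal ((F n x)\<^sup>2) \<partial>lborel)"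
  proof -
    have "(SUP n. ennreal ((F n x)\<^sup>2)) = ennreal ((h x)\<^sup>2)" for x
    proof (rule antisym)
      show "(SUP n. ennreal ((F n x)\<^sup>2)) \<le> ennreal ((h x)\<^sup>2)"
        by (intro SUP_least ennreal_leI) (auto simp: F_def indicator_def)
      obtain n :: nat where n: "max (norm x) \<bar>h x\<bar> \<le> real n" using real_arch_simple by blast
      then have "F n x = h x" by (auto simp: F_def A_def)
      then show "ennreal ((h x)\<^sup>2) \<le> (SUP n. ennreal ((F n x)\<^sup>2))"
        by (intro SUP_upper2[of n]) auto
    qed
    then have "(\<integral>\<^sup>+x. ennreal ((h x)\<^sup>2) \<partial>lborel) = (\<integral>\<^sup>+x. (SUP n. ennreal ((F n x)\<^sup>2)) \<partial>lborel)"
      by simp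
    also have "\<dots> = (SUP n. \<integral>\<^sup>+x. ennreal ((F n x)\<^sup>2) \<partial>lborel)"
      by (intro nn_integral_monotone_convergence_SUP)
        (auto simp: incseq_def le_fun_def F_def A_def indicator_def intro!: ennreal_leI)
    finally show ?thesis .
  qed
  have "(\<integral>\<^sup>+x. ennreal ((F n x)\<^sup>2) \<partial>lborel) \<le> ennreal (B\<^sup>2)" for n
  proof -
    have "(\<integral>\<^sup>+x. ennreal ((F n x)\<^sup>2) \<partial>lborel) = ennreal (LINT x|lborel. (F n x)\<^sup>2)"
      using F_sq[of n] unfolding square_integrable_def
      by (intro nn_integral_eq_integral) auto
    also have "(LINT x|lborel. (F n x)\<^sup>2) = (l2_norm lborel (F n))\<^sup>2"
      by (simp add: l2_norm_def l2_inner_def power2_eq_square)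
    also have "\<dots> \<le> B\<^sup>2"
      using F_le[of n] by (intro power_mono) (auto simp: l2_norm_def l2_inner_def)
    finally show ?thesis by (simp add: ennreal_leI)
  qed
  then have bound: "(\<integral>\<^sup>+x. ennreal ((h x)\<^sup>2) \<partial>lborel) \<le> ennreal (B\<^sup>2)"
    unfolding lim by (intro SUP_least)
  have int: "integrable lborel (\<lambda>x. (h x)\<^sup>2)"
    using le_less_trans[OF bound ennreal_less_top] by (intro integrableI_nonneg) simp_all
  then have sq: "square_integrable lborel h" by (simp add: square_integrable_def)
  have "ennreal (LINT x|lborel. (h x)\<^sup>2) \<le> ennreal (B\<^sup>2)"
    using bound nn_integral_eq_integral[OF int] by simp
  then have "(LINT x|lborel. (h x)\<^sup>2) \<le> B\<^sup>2" by (subst (asm) ennreal_le_iff) simp_all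
  then have "l2_norm lborel h \<le> B"
    using B unfolding l2_norm_def l2_inner_def power2_eq_square[symmetric]
    by (intro real_le_lsqrt)
  then show ?thesis using sq by simp
qed

text \<open>
  Classes of square-integrable functions form a type, so that the results above, which are stated
  for Hilbert spaces that are types, apply to them.
\<close>

quotient_type (overloaded) 'a l2 = "'a::euclidean_space \<Rightarrow> real" / partial:
  "\<lambda>f g. square_integrable lborel f \<and> square_integrable lborel g \<and> (AE x in lborel. f x = g x)"
proof (rule part_equivpI)
  show "\<exists>x. square_integrable lborel x \<and> square_integrable lborel x \<and>
      (AE xa in lborel. x xa = x xa)"
    using square_integrable_zero by auto
  show "symp (\<lambda>f g. square_integrable lborel f \<and> square_integrable lborel g \<and>
      (AE x in lborel. f x = g x))"
    by (auto simp: symp_def eq_commute)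
  show "transp (\<lambda>f g. square_integrable lborel f \<and> square_integrable lborel g \<and>
      (AE x in lborel. f x = g x))"
    by (auto simp: transp_def)
qed

instantiation l2 :: (euclidean_space) real_vector
begin

lift_definition zero_l2 :: "'a l2" is "\<lambda>_. 0" by (simp add: square_integrable_zero)

lift_definition plus_l2 :: "'a l2 \<Rightarrow> 'a l2 \<Rightarrow> 'a l2" is "\<lambda>f g x. f x + g x"
  by (auto intro: square_integrable_add)

lift_definition minus_l2 :: "'a l2 \<Rightarrow> 'a l2 \<Rightarrow> 'a l2" is "\<lambda>f g x. f x - g x"
  by (auto intro: square_integrable_diff)

lift_definition uminus_l2 :: "'a l2 \<Rightarrow> 'a l2" is "\<lambda>f x. (-1) * f x"
  using square_integrable_cmult[of lborel _ "-1"] by auto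

lift_definition scaleR_l2 :: "real \<Rightarrow> 'a l2 \<Rightarrow> 'a l2" is "\<lambda>c f x. c * f x"
  by (auto intro: square_integrable_cmult)

instance
proof
  fix u v w :: "'a l2" and a b :: real
  show "u + v + w = u + (v + w)" by transfer (auto intro: square_integrable_add simp: add.assoc)
  show "u + v = v + u" by transfer (auto intro: square_integrable_add simp: add.commute)
  show "0 + u = u" by transfer auto
  show "- u + u = 0" by transfer (auto simp: square_integrable_zero)
  show "u - v = u + - v" by transfer (auto intro: square_integrable_diff)
  show "a *\<^sub>R (u + v) = a *\<^sub>R u + a *\<^sub>R v"
    by transfer (auto intro!: square_integrable_cmult square_integrable_add
        simp: distrib_left)
  show "(a + b) *\<^sub>R u = a *\<^sub>R u + b *\<^sub>R u"
    by transfer (auto intro!: square_integrable_cmult square_integrable_add simp: distrib_right)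
  show "a *\<^sub>R b *\<^sub>R u = (a * b) *\<^sub>R u"
    by transfer (auto intro!: square_integrable_cmult simp: mult.assoc)
  show "1 *\<^sub>R u = u" by transfer auto
qed

end

instantiation l2 :: (euclidean_space) real_inner
begin

lift_definition inner_l2 :: "'a l2 \<Rightarrow> 'a l2 \<Rightarrow> real" is "l2_inner lborel"
  unfolding l2_inner_def
  by (intro integral_cong_AE) (auto intro!: borel_measurable_times dest: square_integrable_measurable)

definition norm_l2 :: "'a l2 \<Rightarrow> real" where "norm_l2 u = sqrt (u \<bullet> u)"

definition sgn_l2 :: "'a l2 \<Rightarrow> 'a l2" where "sgn_l2 u = u /\<^sub>R norm u"

definition dist_l2 :: "'a l2 \<Rightarrow> 'a l2 \<Rightarrow> real" where "dist_l2 u v = norm (u - v)"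

definition uniformity_l2 :: "('a l2 \<times> 'a l2) filter" where
  "uniformity_l2 = (INF e\<in>{0 <..}. principal {(x, y). dist x y < e})"

definition open_l2 :: "'a l2 set \<Rightarrow> bool" where
  "open_l2 U = (\<forall>x\<in>U. \<forall>\<^sub>F (x', y) in uniformity. x' = x \<longrightarrow> y \<in> U)"

instance
proof
  fix u v w :: "'a l2" and a :: real and U :: "'a l2 set"
  show "u \<bullet> v = v \<bullet> u" by transfer (simp add: l2_inner_def mult.commute)
  show "(u + v) \<bullet> w = u \<bullet> w + v \<bullet> w"
    by transfer (simp add: l2_inner_def distrib_right integrable_mult_square_integrable)
  show "(a *\<^sub>R u) \<bullet> v = a * (u \<bullet> v)"
    by transfer (simp add: l2_inner_def mult.assoc)
  show "0 \<le> u \<bullet> u" by transfer (simp add: l2_inner_def)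
  show "u \<bullet> u = 0 \<longleftrightarrow> u = 0"
  proof transfer
    fix f :: "'a \<Rightarrow> real"
    assume "square_integrable lborel f \<and> square_integrable lborel f \<and> (AE x in lborel. f x = f x)"
    then have f: "square_integrable lborel f" by simp
    have "l2_inner lborel f f = 0 \<longleftrightarrow> (AE x in lborel. f x * f x = 0)"
      unfolding l2_inner_def
      using integrable_mult_square_integrable[OF f f] by (intro integral_nonneg_eq_0_iff_AE) auto
    then show "(l2_inner lborel f f = 0) = (square_integrable lborel f \<and>
        square_integrable lborel (\<lambda>_. 0::real) \<and> (AE x in lborel. f x = 0))"
      using f by (simp add: square_integrable_zero)
  qed
  show "norm u = sqrt (u \<bullet> u)" by (rule norm_l2_def)
  show "sgn u = u /\<^sub>R norm u" by (rule sgn_l2_def)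
  show "dist u v = norm (u - v)" by (rule dist_l2_def)
  show "uniformity = (INF e\<in>{0 <..}. principal {(x, y). dist (x::'a l2) y < e})"
    by (rule uniformity_l2_def)
  show "open U = (\<forall>x\<in>U. \<forall>\<^sub>F (x', y) in uniformity. x' = x \<longrightarrow> y \<in> U)" by (rule open_l2_def)
qed

end

lemma norm_abs_l2: "square_integrable lborel f \<Longrightarrow> norm (abs_l2 f) = l2_norm lborel f"
  by (simp add: norm_l2_def l2_norm_def inner_l2.abs_eq)

lemma inner_abs_l2:
  "square_integrable lborel f \<Longrightarrow> square_integrable lborel g \<Longrightarrow>
    abs_l2 f \<bullet> abs_l2 g = l2_inner lborel f g"
  by (simp add: inner_l2.abs_eq)

lemma rep_l2: "square_integrable lborel (rep_l2 u)" "abs_l2 (rep_l2 u) = u"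
  using Quotient_rep_reflp[OF Quotient_l2, of u] Quotient_abs_rep[OF Quotient_l2, of u] by blast+

lemma abs_l2_eq_iff:
  "square_integrable lborel f \<Longrightarrow> square_integrable lborel g \<Longrightarrow>
    abs_l2 f = abs_l2 g \<longleftrightarrow> (AE x in lborel. f x = g x)"
  using Quotient_rel[OF Quotient_l2, of f g] by blast

lemma l2_norm_nn_integral:
  assumes "square_integrable \<mu> f"
  shows "(\<integral>\<^sup>+x. ennreal ((f x)\<^sup>2) \<partial>\<mu>) = ennreal ((l2_norm \<mu> f)\<^sup>2)"
proof -
  have "(l2_norm \<mu> f)\<^sup>2 = (LINT x|\<mu>. (f x)\<^sup>2)"
    by (simp add: l2_norm_def l2_inner_def power2_eq_square)
  moreover have "integrable \<mu> (\<lambda>x. (f x)\<^sup>2)" using assms by (simp add: square_integrable_def)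
  ultimately show ?thesis using nn_integral_eq_integral[of \<mu> "\<lambda>x. (f x)\<^sup>2"] by simp
qed

text \<open>
  Riesz--Fischer.  After multiplication by a fixed positive square-integrable weight a Cauchy
  sequence in \<open>L\<^sup>2\<close> is Cauchy in \<open>L\<^sup>1\<close>, so a subsequence converges almost everywhere.  Fatou's
  lemma shows that the limit is also the limit in \<open>L\<^sup>2\<close>.
\<close>

instance l2 :: (euclidean_space) banach
proof
  fix X :: "nat \<Rightarrow> 'a l2"
  assume cauchy: "Cauchy X"
  define f where "f n = rep_l2 (X n)" for n
  have f: "square_integrable lborel (f n)" and X: "X n = abs_l2 (f n)" for n
    by (simp_all add: f_def rep_l2)
  have [measurable]: "f n \<in> borel_measurable borel" for n
    using square_integrable_measurable[OF f[of n]] by simp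
  have X_diff: "norm (X m - X n) = l2_norm lborel (\<lambda>x. f m x - f n x)" for m n
    using f by (simp add: X minus_l2.abs_eq norm_abs_l2 square_integrable_diff)
  obtain w :: "'a \<Rightarrow> real" where w: "w \<in> borel_measurable lborel" "\<And>x. 0 < w x" "integrable lborel w"
    by (rule sigma_finite_measure.obtain_positive_integrable_function[OF sigma_finite_lborel]) blast
  define g where "g x = sqrt (w x)" for x
  have [measurable]: "g \<in> borel_measurable borel" using w(1) unfolding g_def by simp
  have g: "square_integrable lborel g"
    using w by (simp add: square_integrable_def g_def less_imp_le)
  have g_pos: "0 < g x" for x using w(2) by (simp add: g_def)
  obtain r where r: "strict_mono r" "AE x in lborel. Cauchy (\<lambda>i. f (r i) x * g x)"
  proof (rule cauchy_L1_AE_cauchy_subseq)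
    show "integrable lborel (\<lambda>x. f n x * g x)" for n
      by (rule integrable_mult_square_integrable[OF f g])
    fix e :: real assume e: "0 < e"
    define G where "G = l2_norm lborel g"
    have G: "0 \<le> G" by (simp add: G_def l2_norm_def l2_inner_def)
    then have "0 < e / (G + 1)" using e by simp
    then obtain N where N: "\<And>m n. m \<ge> N \<Longrightarrow> n \<ge> N \<Longrightarrow> norm (X m - X n) < e / (G + 1)"
      using cauchy unfolding Cauchy_def dist_norm by blast
    have "(LINT x|lborel. norm (f i x * g x - f j x * g x)) < e" if "N \<le> i" "N \<le> j" for i j
    proof -
      have sq: "square_integrable lborel (\<lambda>x. \<bar>f i x - f j x\<bar>)"
        using square_integrable_diff[OF f f, of i j] by (simp add: square_integrable_def)
      have "(LINT x|lborel. norm (f i x * g x - f j x * g x))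
          = l2_inner lborel (\<lambda>x. \<bar>f i x - f j x\<bar>) g"
        using g_pos unfolding l2_inner_def
        by (intro Bochner_Integration.integral_cong)
          (auto simp: abs_mult abs_of_pos simp flip: left_diff_distrib)
      also have "\<dots> = abs_l2 (\<lambda>x. \<bar>f i x - f j x\<bar>) \<bullet> abs_l2 g"
        using sq g by (simp add: inner_abs_l2)
      also have "\<dots> \<le> norm (abs_l2 (\<lambda>x. \<bar>f i x - f j x\<bar>)) * norm (abs_l2 g)"
        by (rule norm_cauchy_schwarz)
      also have "norm (abs_l2 (\<lambda>x. \<bar>f i x - f j x\<bar>)) = norm (X i - X j)"
        using sq by (simp add: norm_abs_l2 X_diff l2_norm_def l2_inner_def)
      also have "norm (X i - X j) * norm (abs_l2 g) \<le> e / (G + 1) * G"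
        using less_imp_le[OF N[OF that]] G g e by (intro mult_mono) (auto simp: norm_abs_l2 G_def)
      also have "\<dots> < e" using G e by (simp add: field_simps)
      finally show ?thesis .
    qed
    then show "\<exists>N. \<forall>i\<ge>N. \<forall>j\<ge>N. (LINT x|lborel. norm (f i x * g x - f j x * g x)) < e" by blast
  qed
  define h where "h x = lim (\<lambda>i. f (r i) x * g x) / g x" for x
  have [measurable]: "h \<in> borel_measurable borel" unfolding h_def
    by (intro borel_measurable_divide borel_measurable_lim_metric) measurable
  have h_lim: "AE x in lborel. (\<lambda>i. f (r i) x) \<longlonglongrightarrow> h x"
    using r(2)
  proof eventually_elim
    case (elim x)
    then have "(\<lambda>i. f (r i) x * g x) \<longlonglongrightarrow> lim (\<lambda>i. f (r i) x * g x)"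
      by (simp add: Cauchy_convergent convergent_LIMSEQ_iff[symmetric])
    then have "(\<lambda>i. f (r i) x * g x / g x) \<longlonglongrightarrow> h x"
      unfolding h_def using g_pos[of x] by (intro tendsto_divide tendsto_const) auto
    then show ?case using g_pos[of x] by simp
  qed
  have fatou: "(\<integral>\<^sup>+x. ennreal ((h x - f n x)\<^sup>2) \<partial>lborel) \<le> ennreal (e\<^sup>2)"
    if e: "0 < e" and N: "\<And>m. m \<ge> N \<Longrightarrow> norm (X m - X n) < e" for n e N
  proof -
    have "(\<integral>\<^sup>+x. ennreal ((h x - f n x)\<^sup>2) \<partial>lborel)
        = (\<integral>\<^sup>+x. liminf (\<lambda>i. ennreal ((f (r i) x - f n x)\<^sup>2)) \<partial>lborel)"
    proof (rule nn_integral_cong_AE)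
      show "AE x in lborel. ennreal ((h x - f n x)\<^sup>2) = liminf (\<lambda>i. ennreal ((f (r i) x - f n x)\<^sup>2))"
        using h_lim
      proof eventually_elim
        case (elim x)
        then have "(\<lambda>i. ennreal ((f (r i) x - f n x)\<^sup>2)) \<longlonglongrightarrow> ennreal ((h x - f n x)\<^sup>2)"
          by (intro tendsto_intros)
        then show ?case by (rule lim_imp_Liminf[OF sequentially_bot, symmetric])
      qed
    qed
    also have "\<dots> \<le> liminf (\<lambda>i. \<integral>\<^sup>+x. ennreal ((f (r i) x - f n x)\<^sup>2) \<partial>lborel)"
      by (intro nn_integral_liminf) measurable
    also have "\<dots> \<le> ennreal (e\<^sup>2)"
    proof (rule Liminf_le)
      show "\<forall>\<^sub>F i in sequentially. (\<integral>\<^sup>+x. ennreal ((f (r i) x - f n x)\<^sup>2) \<partial>lborel) \<le> ennreal (e\<^sup>2)"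
        using eventually_ge_at_top[of N]
      proof eventually_elim
        case (elim i)
        then have "N \<le> r i" using r(1) by (meson order_trans seq_suble)
        then have "l2_norm lborel (\<lambda>x. f (r i) x - f n x) \<le> e"
          using N[of "r i"] by (simp add: X_diff)
        then have "(l2_norm lborel (\<lambda>x. f (r i) x - f n x))\<^sup>2 \<le> e\<^sup>2"
          using norm_ge_zero[of "X (r i) - X n"] by (intro power_mono) (auto simp: X_diff)
        then show ?case
          using f by (simp add: l2_norm_nn_integral square_integrable_diff)
      qed
    qed simp
    finally show ?thesis .
  qed
  have h_diff: "square_integrable lborel (\<lambda>x. h x - f n x)
      \<and> norm (abs_l2 (\<lambda>x. h x - f n x)) \<le> e"
    if e: "0 < e" and N: "\<And>m. m \<ge> N \<Longrightarrow> norm (X m - X n) < e" for n e N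
  proof -
    have bound: "(\<integral>\<^sup>+x. ennreal ((h x - f n x)\<^sup>2) \<partial>lborel) \<le> ennreal (e\<^sup>2)"
      by (rule fatou[OF e N])
    have sq: "square_integrable lborel (\<lambda>x. h x - f n x)"
      unfolding square_integrable_def
    proof
      show "integrable lborel (\<lambda>x. (h x - f n x)\<^sup>2)"
        using le_less_trans[OF bound ennreal_less_top] by (intro integrableI_nonneg) simp_all
    qed simp
    have "ennreal ((l2_norm lborel (\<lambda>x. h x - f n x))\<^sup>2) \<le> ennreal (e\<^sup>2)"
      using bound unfolding l2_norm_nn_integral[OF sq] .
    then have "(l2_norm lborel (\<lambda>x. h x - f n x))\<^sup>2 \<le> e\<^sup>2"
      by (subst (asm) ennreal_le_iff) simp_all
    then have "l2_norm lborel (\<lambda>x. h x - f n x) \<le> e"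
      by (rule power2_le_imp_le) (use e in simp)
    then show ?thesis unfolding norm_abs_l2[OF sq] using sq by blast
  qed
  have tail: "\<exists>N. \<forall>m\<ge>N. \<forall>n\<ge>N. norm (X m - X n) < e" if "0 < e" for e
    using cauchy that unfolding Cauchy_def dist_norm by blast
  have h: "square_integrable lborel h"
  proof -
    obtain N where "\<forall>m\<ge>N. \<forall>n\<ge>N. norm (X m - X n) < 1" using tail[of 1] by auto
    then have "square_integrable lborel (\<lambda>x. h x - f N x)" using h_diff[of 1 N N] by auto
    from square_integrable_add[OF this f[of N]] show ?thesis by simp
  qed
  have "X \<longlonglongrightarrow> abs_l2 h"
  proof (rule metric_LIMSEQ_I)
    fix e :: real assume "0 < e"
    then have e2: "0 < e / 2" by simp
    then obtain N where N: "\<forall>m\<ge>N. \<forall>n\<ge>N. norm (X m - X n) < e / 2" using tail by blast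
    have "dist (X n) (abs_l2 h) < e" if "n \<ge> N" for n
    proof -
      have "norm (abs_l2 h - X n) \<le> e / 2"
        using h_diff[OF e2, of N n] N that f h by (simp add: X minus_l2.abs_eq)
      then show ?thesis using \<open>0 < e\<close> by (simp add: dist_norm norm_minus_commute)
    qed
    then show "\<exists>N. \<forall>n\<ge>N. dist (X n) (abs_l2 h) < e" by blast
  qed
  then show "convergent X" by (rule convergentI)
qed

section \<open>Measurability of Feynman--Kac functions\<close>

text \<open>
  The grid point is the first one strictly to the right of \<open>s\<close>, so right continuity applies.
\<close>

lemma cadlag_on_grid_limit:
  fixes f :: "real \<Rightarrow> 'a::topological_space" and s :: real
  assumes "cadlag_on {0..} f" and "0 \<le> s"
  shows "(\<lambda>k. f (real (nat \<lfloor>s * Suc k\<rfloor> + 1) / Suc k)) \<longlonglongrightarrow> f s"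
proof -
  let ?r = "\<lambda>k. real (nat \<lfloor>s * Suc k\<rfloor> + 1) / Suc k"
  have gt: "s < ?r k" for k
  proof -
    have "s * Suc k < real (nat \<lfloor>s * Suc k\<rfloor> + 1)"
      using assms(2) by (simp add: of_nat_nat) linarith
    then show ?thesis by (simp add: pos_less_divide_eq)
  qed
  have le: "?r k \<le> s + 1 / Suc k" for k
  proof -
    have "real (nat \<lfloor>s * Suc k\<rfloor> + 1) \<le> s * Suc k + 1"
      using assms(2) by (simp add: of_nat_nat)
    then show ?thesis by (simp add: divide_le_eq algebra_simps)
  qed
  have "(\<lambda>k. s + 1 / Suc k) \<longlonglongrightarrow> s + 0"
    by (intro tendsto_add tendsto_const LIMSEQ_Suc[OF lim_1_over_n])
  then have "?r \<longlonglongrightarrow> s"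
    using gt le by (intro tendsto_sandwich[of "\<lambda>_. s" ?r sequentially "\<lambda>k. s + 1 / Suc k"])
      (auto intro: always_eventually less_imp_le)
  then have "filterlim ?r (at s within {0..} \<inter> {s<..}) sequentially"
    using gt assms(2) by (auto simp: filterlim_at intro!: always_eventually)
      (metis gt less_irrefl)
  moreover have "(f \<longlongrightarrow> f s) (at s within {0..} \<inter> {s<..})"
    using assms by (auto simp: cadlag_on_def)
  ultimately show ?thesis by (rule filterlim_compose[rotated])
qed

text \<open>
  By right continuity the process is the pointwise limit of processes that are constant in time
  on intervals of length \<open>1 / Suc k\<close>.
\<close>

lemma levy_process_jointly_measurable:
  assumes "levy_process M X"
  shows "(\<lambda>(\<omega>, s::real). X (max s 0) \<omega>) \<in> borel_measurable (M \<Otimes>\<^sub>M borel)"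
proof (rule borel_measurable_LIMSEQ_metric)
  have X: "X t \<in> borel_measurable M" if "0 \<le> t" for t
    using assms that by (auto simp: levy_process_def)
  fix k
  have "(\<lambda>p::_ \<times> real. X (real (nat \<lfloor>max (snd p) 0 * Suc k\<rfloor> + 1) / Suc k) (fst p))
      \<in> borel_measurable (M \<Otimes>\<^sub>M borel)"
  proof (rule measurable_compose_countable[where f = "\<lambda>i p. X (real (i + 1) / Suc k) (fst p)"])
    show "(\<lambda>p::_ \<times> real. X (real (i + 1) / Suc k) (fst p)) \<in> borel_measurable (M \<Otimes>\<^sub>M borel)" for i
      by (rule measurable_compose[OF measurable_fst X]) simp
    show "(\<lambda>p::_ \<times> real. nat \<lfloor>max (snd p) 0 * Suc k\<rfloor>) \<in> M \<Otimes>\<^sub>M borel \<rightarrow>\<^sub>M count_space UNIV"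
      by measurable
  qed
  then show "(\<lambda>(\<omega>, s::real). X (real (nat \<lfloor>max s 0 * Suc k\<rfloor> + 1) / Suc k) \<omega>)
      \<in> borel_measurable (M \<Otimes>\<^sub>M borel)"
    by (simp add: case_prod_beta')
next
  fix p :: "'a \<times> real" assume "p \<in> space (M \<Otimes>\<^sub>M borel)"
  then show "(\<lambda>k. case p of (\<omega>, s) \<Rightarrow> X (real (nat \<lfloor>max s 0 * Suc k\<rfloor> + 1) / Suc k) \<omega>)
      \<longlonglongrightarrow> (case p of (\<omega>, s) \<Rightarrow> X (max s 0) \<omega>)"
    using assms cadlag_on_grid_limit[of "\<lambda>t. X t (fst p)" "max (snd p) 0"]
    by (auto simp: levy_process_def space_pair_measure case_prod_beta')
qed

lemma feynman_kac_measurable: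
  fixes X :: "real \<Rightarrow> 'w \<Rightarrow> 'a::euclidean_space"
  assumes levy: "levy_process M X" and t: "0 \<le> t"
    and [measurable]: "V \<in> borel_measurable borel" "f \<in> borel_measurable borel"
  shows "feynman_kac M X V t f \<in> borel_measurable borel"
proof -
  interpret prob_space M using levy by (simp add: levy_process_def)
  have [measurable]: "X t \<in> borel_measurable M" using levy t by (simp add: levy_process_def)
  have "(\<lambda>q. (\<lambda>(\<omega>, s). X (max s 0) \<omega>) (snd (fst q), snd q))
      \<in> borel_measurable ((borel \<Otimes>\<^sub>M M) \<Otimes>\<^sub>M (lborel :: real measure))"
    by (rule measurable_compose[OF _ levy_process_jointly_measurable[OF levy]]) measurable
  then have [measurable]: "(\<lambda>q. X (max (snd q) 0) (snd (fst q)))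
      \<in> borel_measurable ((borel \<Otimes>\<^sub>M M) \<Otimes>\<^sub>M (lborel :: real measure))" by simp
  have inner: "(\<lambda>p. LINT s|lborel. indicator {0..t} s *\<^sub>R V (fst p + X (max s 0) (snd p)))
      \<in> borel_measurable (borel \<Otimes>\<^sub>M M)"
  proof (rule lborel.borel_measurable_lebesgue_integral)
    show "(\<lambda>(p, s). indicator {0..t} s *\<^sub>R V (fst p + X (max s 0) (snd p)))
      \<in> borel_measurable ((borel \<Otimes>\<^sub>M M) \<Otimes>\<^sub>M lborel)"
      unfolding case_prod_beta' by measurable
  qed
  have "(LINT s|lborel. indicator {0..t} s *\<^sub>R V (x + X (max s 0) \<omega>))
      = (LBINT s:{0..t}. V (x + X s \<omega>))" for x \<omega>
    unfolding set_lebesgue_integral_def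
    by (intro Bochner_Integration.integral_cong) (auto simp: indicator_def max_def)
  with inner have [measurable]: "(\<lambda>p. LBINT s:{0..t}. V (fst p + X s (snd p)))
      \<in> borel_measurable (borel \<Otimes>\<^sub>M M)" by (simp only:)
  show ?thesis
    unfolding feynman_kac_def
  proof (rule borel_measurable_lebesgue_integral)
    show "(\<lambda>(x, \<omega>). exp (- (LBINT s:{0..t}. V (x + X s \<omega>))) * f (x + X t \<omega>))
        \<in> borel_measurable (borel \<Otimes>\<^sub>M M)"
      unfolding case_prod_beta' by measurable
  qed
qed

section \<open>A Borel--Cantelli lemma for weakly correlated events\<close>

text \<open>
  With truncated subtraction, \<open>(i - j) + (j - i)\<close> is the distance of \<open>i\<close> and \<open>j\<close>.
\<close>

lemma sum_geometric_distance_le: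
  fixes q :: real
  assumes q: "0 \<le> q" "q < 1"
  shows "(\<Sum>j<N. q ^ ((i - j) + (j - i))) \<le> 2 / (1 - q)"
proof -
  have geo: "summable (\<lambda>k. q ^ k)" using q by (intro summable_geometric) auto
  have part: "(\<Sum>j\<in>J. q ^ f j) \<le> 1 / (1 - q)" if J: "finite J" "inj_on f J" for J and f :: "nat \<Rightarrow> nat"
  proof -
    have "(\<Sum>j\<in>J. q ^ f j) = (\<Sum>k\<in>f ` J. q ^ k)" using J(2) by (simp add: sum.reindex)
    also have "\<dots> \<le> (\<Sum>k. q ^ k)" using J(1) q by (intro sum_le_suminf geo) auto
    also have "\<dots> = 1 / (1 - q)" using q by (intro suminf_geometric) auto
    finally show ?thesis .
  qed
  have "(\<Sum>j<N. q ^ ((i - j) + (j - i)))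
      = (\<Sum>j\<in>{..<N} \<inter> {..i}. q ^ ((i - j) + (j - i))) + (\<Sum>j\<in>{..<N} - {..i}. q ^ ((i - j) + (j - i)))"
    by (rule sum.Int_Diff) simp
  also have "\<dots> \<le> 1 / (1 - q) + 1 / (1 - q)"
    by (intro add_mono part) (auto simp: inj_on_def)
  finally show ?thesis by simp
qed

text \<open>
  Let \<open>S N\<close> be the number of events among the first \<open>N\<close>.  Bounding the geometric mean of two
  probabilities by their arithmetic mean, the covariances sum up to at most a constant times
  the mean of \<open>S N\<close>.  As the mean tends to infinity, Chebyshev's inequality shows that
  \<open>S N \<le> k\<close> for all \<open>N\<close> has probability zero, for every \<open>k\<close>.
\<close>

lemma (in prob_space) borel_cantelli_of_decaying_correlations:
  fixes B :: "nat \<Rightarrow> 'a set"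
  assumes [measurable]: "\<And>n. B n \<in> events"
    and q: "0 \<le> q" "q < 1"
    and corr: "\<And>m n. m \<le> n \<Longrightarrow> prob (B m \<inter> B n) - prob (B m) * prob (B n)
      \<le> q ^ (n - m) * (sqrt (prob (B m)) * sqrt (prob (B n)))"
    and diverges: "\<not> summable (\<lambda>n. prob (B n))"
  shows "AE x in M. \<exists>\<^sub>\<infinity>n. x \<in> B n"
proof -
  define p where "p n = prob (B n)" for n
  define S where "S N x = (\<Sum>n<N. indicator (B n) x :: real)" for N x
  define m where "m N = (\<Sum>n<N. p n)" for N
  define C where "C = 2 / (1 - q)"
  have C: "0 < C" using q by (simp add: C_def)
  have p0: "0 \<le> p n" for n by (simp add: p_def)
  have [measurable]: "S N \<in> borel_measurable M" for N unfolding S_def by measurable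
  have S_bound: "\<bar>S N x\<bar> \<le> real N" for N x
  proof -
    have "\<bar>S N x\<bar> \<le> (\<Sum>n<N. \<bar>indicator (B n) x :: real\<bar>)" unfolding S_def by (rule sum_abs)
    also have "\<dots> \<le> (\<Sum>n<N. 1)" by (intro sum_mono) (auto simp: indicator_def)
    finally show ?thesis by simp
  qed
  have S_int: "integrable M (S N)" for N
    using S_bound[of N] by (intro integrable_const_bound[where B = "real N"]) auto
  have S_sq_int: "integrable M (\<lambda>x. (S N x)\<^sup>2)" for N
    using S_bound[of N]
    by (intro integrable_const_bound[where B = "(real N)\<^sup>2"]) (auto simp: abs_le_square_iff[symmetric])
  have ind_int: "integrable M (indicator A :: 'a \<Rightarrow> real)" if "A \<in> events" for A
    using that by (intro integrable_real_indicator) (auto simp: less_top[symmetric])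
  have ES: "expectation (S N) = m N" for N
    unfolding S_def m_def p_def
    by (subst Bochner_Integration.integral_sum) (auto intro: ind_int)
  have corr': "prob (B i \<inter> B j) - p i * p j \<le> q ^ ((i - j) + (j - i)) * ((p i + p j) / 2)" for i j
  proof -
    have "prob (B i \<inter> B j) - p i * p j \<le> q ^ ((i - j) + (j - i)) * (sqrt (p i) * sqrt (p j))"
      using corr[of i j] corr[of j i] by (cases "i \<le> j") (auto simp: p_def Int_commute mult.commute)
    also have "\<dots> \<le> q ^ ((i - j) + (j - i)) * ((p i + p j) / 2)"
      using arith_geo_mean_sqrt[OF p0 p0, of i j] q
      by (intro mult_left_mono) (auto simp: real_sqrt_mult)
    finally show ?thesis .
  qed
  have var: "variance (S N) \<le> C * m N" for N
  proof -
    have "expectation (\<lambda>x. (S N x)\<^sup>2) = (\<Sum>i<N. \<Sum>j<N. prob (B i \<inter> B j))"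
      unfolding S_def power2_eq_square sum_product indicator_inter_arith[symmetric]
      by (simp add: Bochner_Integration.integral_sum ind_int)
    moreover have "(m N)\<^sup>2 = (\<Sum>i<N. \<Sum>j<N. p i * p j)"
      unfolding m_def power2_eq_square sum_product by simp
    moreover have "variance (S N) = expectation (\<lambda>x. (S N x)\<^sup>2) - (m N)\<^sup>2"
      unfolding ES[symmetric] by (rule variance_eq[OF S_int S_sq_int])
    ultimately have "variance (S N) = (\<Sum>i<N. \<Sum>j<N. prob (B i \<inter> B j) - p i * p j)"
      by (simp add: sum_subtractf)
    also have "\<dots> \<le> (\<Sum>i<N. \<Sum>j<N. q ^ ((i - j) + (j - i)) * ((p i + p j) / 2))"
      by (intro sum_mono corr')
    also have "\<dots> = (\<Sum>i<N. \<Sum>j<N. q ^ ((i - j) + (j - i)) * (p i / 2))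
        + (\<Sum>i<N. \<Sum>j<N. q ^ ((i - j) + (j - i)) * (p j / 2))"
      by (simp add: add_divide_distrib distrib_left sum.distrib)
    also have "(\<Sum>i<N. \<Sum>j<N. q ^ ((i - j) + (j - i)) * (p j / 2))
        = (\<Sum>i<N. \<Sum>j<N. q ^ ((i - j) + (j - i)) * (p i / 2))"
      by (subst sum.swap) (simp add: add.commute)
    finally have "variance (S N) \<le> 2 * (\<Sum>i<N. \<Sum>j<N. q ^ ((i - j) + (j - i)) * (p i / 2))"
      by linarith
    also have "\<dots> \<le> 2 * (\<Sum>i<N. C * (p i / 2))"
      unfolding sum_distrib_right[symmetric] C_def using p0
      by (intro mult_left_mono sum_mono mult_right_mono sum_geometric_distance_le q) simp_all
    also have "\<dots> = C * m N" by (simp add: m_def sum_distrib_left)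
    finally show ?thesis .
  qed
  have large: "\<exists>N. b < m N" for b
  proof (rule ccontr)
    assume "\<nexists>N. b < m N"
    then have "(\<Sum>k\<le>n. p k) \<le> b" for n
      unfolding m_def lessThan_Suc_atMost[symmetric] by (metis not_le)
    then have "summable p" by (rule bounded_imp_summable[OF p0])
    then show False using diverges unfolding p_def by contradiction
  qed
  have null: "AE x in M. \<exists>N. real k < S N x" for k
  proof -
    define E where "E = {x \<in> space M. \<forall>N. S N x \<le> real k}"
    have E[measurable]: "E \<in> events" unfolding E_def by measurable
    have "prob E \<le> \<epsilon>" if \<epsilon>: "0 < \<epsilon>" for \<epsilon>
    proof -
      obtain N where N: "max (2 * real k) (4 * C / \<epsilon>) < m N" using large by blast
      then have mN: "2 * real k < m N" "4 * C / \<epsilon> < m N" "0 < m N" by auto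
      have "E \<subseteq> {x \<in> space M. m N / 2 \<le> \<bar>S N x - expectation (S N)\<bar>}"
        using mN(1) unfolding E_def ES by (auto simp: abs_if not_less field_simps dest!: spec[of _ N])
      then have "prob E \<le> prob {x \<in> space M. m N / 2 \<le> \<bar>S N x - expectation (S N)\<bar>}"
        by (intro finite_measure_mono) measurable
      also have "\<dots> \<le> variance (S N) / (m N / 2)\<^sup>2"
        using mN(3) by (intro Chebyshev_inequality S_sq_int) auto
      also have "\<dots> \<le> C * m N / (m N / 2)\<^sup>2" by (intro divide_right_mono var) simp
      also have "\<dots> = 4 * C / m N" using mN(3) by (simp add: power2_eq_square field_simps)
      also have "\<dots> \<le> \<epsilon>" using mN(2,3) \<epsilon> by (simp add: field_simps)
      finally show ?thesis .
    qed
    then have "prob E \<le> 0" by (rule field_le_epsilon) simp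
    then have "E \<in> null_sets M" using E by (simp add: null_sets_def emeasure_eq_measure measure_le_0_iff)
    then have "AE x in M. x \<notin> E" by (rule AE_not_in)
    then show ?thesis by (rule AE_mp) (auto simp: E_def not_le)
  qed
  have "AE x in M. \<forall>k. \<exists>N. real k < S N x" using null by (simp add: AE_all_countable)
  then show ?thesis
  proof (rule AE_mp, intro AE_I2 impI)
    fix x assume x: "\<forall>k. \<exists>N. real k < S N x"
    show "\<exists>\<^sub>\<infinity>n. x \<in> B n"
    proof (rule ccontr)
      assume "\<not> (\<exists>\<^sub>\<infinity>n. x \<in> B n)"
      then have fin: "finite {n. x \<in> B n}" by (simp add: frequently_cofinite)
      obtain N where "real (card {n. x \<in> B n}) < S N x" using x by blast
      also have "S N x = real (card {n \<in> {..<N}. x \<in> B n})"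
        unfolding S_def by (simp add: indicator_def of_bool_def[symmetric] sum.If_cases Int_def)
      also have "\<dots> \<le> real (card {n. x \<in> B n})"
        using fin by (intro of_nat_mono card_mono) auto
      finally show False by simp
    qed
  qed
qed

section \<open>The ground state-transformed process\<close>

text \<open>
  Multiplication of a semigroup by \<open>exp (- l t)\<close> adds \<open>l\<close> to minus its generator.
\<close>

lemma tendsto_generator_shift:
  fixes u v :: "'h::real_normed_vector" and k :: "real \<Rightarrow> 'h"
  assumes "((\<lambda>t. (u - k t) /\<^sub>R t) \<longlongrightarrow> v) (at_right 0)"
  shows "((\<lambda>t. (u - exp (- l * t) *\<^sub>R k t) /\<^sub>R t) \<longlongrightarrow> v + l *\<^sub>R u) (at_right 0)"
proof -
  have d: "((\<lambda>t. (1 - exp (- l * t)) / t) \<longlongrightarrow> l) (at_right 0)"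
  proof -
    have "((\<lambda>t. exp (- l * t)) has_real_derivative - l) (at 0)"
      by (auto intro!: derivative_eq_intros)
    then have "((\<lambda>t. (exp (- l * t) - 1) / t) \<longlongrightarrow> - l) (at 0)"
      by (simp add: has_field_derivative_def has_derivative_at DERIV_def flip: has_field_derivative_def)
    then have "((\<lambda>t. - ((exp (- l * t) - 1) / t)) \<longlongrightarrow> l) (at 0)"
      using tendsto_minus by fastforce
    then have "((\<lambda>t. - ((exp (- l * t) - 1) / t)) \<longlongrightarrow> l) (at_right 0)"
      by (rule tendsto_within_subset) simp
    then show ?thesis by (simp add: minus_divide_left)
  qed
  have e: "((\<lambda>t. exp (- l * t)) \<longlongrightarrow> exp (- l * 0)) (at_right 0)" by (intro tendsto_intros)
  have "((\<lambda>t. exp (- l * t) *\<^sub>R ((u - k t) /\<^sub>R t) + ((1 - exp (- l * t)) / t) *\<^sub>R u)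
      \<longlongrightarrow> exp (- l * 0) *\<^sub>R v + l *\<^sub>R u) (at_right 0)"
    by (intro tendsto_add tendsto_scaleR e d assms tendsto_const)
  moreover have "exp (- l * t) *\<^sub>R ((u - k t) /\<^sub>R t) + ((1 - exp (- l * t)) / t) *\<^sub>R u
      = (u - exp (- l * t) *\<^sub>R k t) /\<^sub>R t" for t
    by (simp add: divide_inverse algebra_simps)
  ultimately show ?thesis by simp
qed

text \<open>
  The path measure enters through its finite-dimensional correlations, and the Levy process
  through the measurability of Feynman--Kac functions, which gives meaning to the integrals in
  these correlations.
\<close>

locale ground_state_process =
  fixes M :: "'w measure" and X :: "real \<Rightarrow> 'w \<Rightarrow> 'a::euclidean_space"
    and V :: "'a \<Rightarrow> real" and H :: "'a l2_operator" and \<phi> :: "'a \<Rightarrow> real"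
    and Q :: "'a \<Rightarrow> (real \<Rightarrow> 'a) measure"
  assumes levy: "levy_process M X"
    and V_measurable: "V \<in> borel_measurable borel"
    and schroedinger: "schroedinger_operator M X V H"
    and isolated: "isolated_eigenvalue H (ground_energy H)"
    and ground: "ground_state H \<phi>"
    and gst: "gst_process M X V (ground_energy H) \<phi> Q"
begin

abbreviation P :: "(real \<Rightarrow> 'a) measure" where "P \<equiv> gst_path_measure \<phi> Q"

text \<open>
  Up to conjugation by \<open>\<phi>\<close> this is the semigroup of the process; the factor
  normalises the Feynman--Kac semigroup such that \<open>\<phi>\<close> is invariant.
\<close>

definition T :: "real \<Rightarrow> ('a \<Rightarrow> real) \<Rightarrow> 'a \<Rightarrow> real" where
  "T t f x = exp (ground_energy H * t) * feynman_kac M X V t f x"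

lemma phi_pos: "0 < \<phi> x"
  using ground by (simp add: ground_state_def positive_ground_eigenfunction_def)

lemma phi_norm: "l2_norm lborel \<phi> = 1"
  using ground by (simp add: ground_state_def positive_ground_eigenfunction_def)

lemma phi_eigen: "(\<phi>, \<lambda>x. ground_energy H * \<phi> x) \<in> H"
  using ground
  by (simp add: ground_state_def positive_ground_eigenfunction_def eigenfunction_def)

lemma phi_square_integrable: "square_integrable lborel \<phi>"
proof -
  have "H = neg_generator (feynman_kac M X V)"
    using schroedinger by (simp add: schroedinger_operator_def)
  then show ?thesis using phi_eigen by (auto simp: neg_generator_def)
qed

lemma phi_measurable [measurable]: "\<phi> \<in> borel_measurable borel"
  using square_integrable_measurable[OF phi_square_integrable] by simp

lemma sets_ground_measure [measurable_cong]: "sets (ground_measure \<phi>) = sets borel"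
  by (simp add: ground_measure_def)

lemma integral_ground_measure:
  assumes "f \<in> borel_measurable borel"
  shows "(LINT x|ground_measure \<phi>. f x) = (LINT x|lborel. (\<phi> x)\<^sup>2 * f x)"
  using assms by (simp add: ground_measure_def integral_density)

lemma square_integrable_ground_measure:
  "square_integrable lborel F \<Longrightarrow> square_integrable (ground_measure \<phi>) (\<lambda>x. F x / \<phi> x)"
proof -
  assume F: "square_integrable lborel F"
  have [measurable]: "F \<in> borel_measurable borel" using square_integrable_measurable[OF F] by simp
  have "(\<phi> x)\<^sup>2 * (F x / \<phi> x)\<^sup>2 = (F x)\<^sup>2" for x
    using phi_pos[of x] by (simp add: power_divide)
  then show ?thesis
    using F by (simp add: square_integrable_def ground_measure_def integrable_density)
qed

lemma prob_space_ground_measure: "prob_space (ground_measure \<phi>)"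
proof
  have int: "integrable lborel (\<lambda>x. (\<phi> x)\<^sup>2)"
    using phi_square_integrable by (simp add: square_integrable_def)
  have "emeasure (ground_measure \<phi>) (space (ground_measure \<phi>)) = (\<integral>\<^sup>+x. ennreal ((\<phi> x)\<^sup>2) \<partial>lborel)"
    by (simp add: ground_measure_def emeasure_density)
  also have "\<dots> = ennreal (LINT x|lborel. (\<phi> x)\<^sup>2)" by (rule nn_integral_eq_integral[OF int]) simp
  also have "(LINT x|lborel. (\<phi> x)\<^sup>2) = 1"
    using phi_norm by (simp add: l2_norm_def l2_inner_def power2_eq_square)
  finally show "emeasure (ground_measure \<phi>) (space (ground_measure \<phi>)) = 1" by simp
qed

lemma Q_measurable: "Q \<in> ground_measure \<phi> \<rightarrow>\<^sub>M prob_algebra path_space"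
  using gst by (simp add: gst_process_def measurable_cong_sets[OF sets_ground_measure refl])

lemma ground_measure_prob_algebra: "ground_measure \<phi> \<in> space (prob_algebra (ground_measure \<phi>))"
  by (simp add: space_prob_algebra prob_space_ground_measure)

lemma prob_space_P: "prob_space P"
  unfolding gst_path_measure_def
  by (rule prob_space_bind'[OF ground_measure_prob_algebra Q_measurable])

lemma sets_P [measurable_cong]: "sets P = sets path_space"
  unfolding gst_path_measure_def
  by (rule sets_bind'[OF ground_measure_prob_algebra Q_measurable])

lemma coordinate_measurable [measurable]: "(\<lambda>\<omega>. \<omega> t) \<in> P \<rightarrow>\<^sub>M borel"
proof -
  have "(\<lambda>\<omega>. \<omega> t) \<in> (path_space :: (real \<Rightarrow> 'a) measure) \<rightarrow>\<^sub>M borel"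
    unfolding path_space_def by (intro measurable_restrict_space1 measurable_component_singleton) simp
  then show ?thesis by (simp add: measurable_cong_sets[OF sets_P refl])
qed

lemma correlation_chain:
  assumes "\<forall>i<n. t i \<le> t (Suc i)"
    and "\<forall>i\<le>n. f i \<in> borel_measurable borel"
    and "square_integrable (ground_measure \<phi>) (f 0)"
    and "square_integrable (ground_measure \<phi>) (f n)"
    and "\<forall>i. 0 < i \<and> i < n \<longrightarrow> bounded (range (f i))"
  shows "(LINT \<omega>|P. (\<Prod>i\<le>n. f i (\<omega> (t i)))) =
    (LINT x|ground_measure \<phi>. semigroup_chain (gst_semigroup M X V (ground_energy H) \<phi>) n t f x)"
  using gst assms unfolding gst_process_def by blast

text \<open>
  The process is stationary: the formula for a single time determines the law at that time.
\<close>

lemma distr_coordinate: "distr P borel (\<lambda>\<omega>. \<omega> t) = ground_measure \<phi>"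
proof (rule measure_eqI)
  interpret P: prob_space P by (rule prob_space_P)
  interpret \<mu>: prob_space "ground_measure \<phi>" by (rule prob_space_ground_measure)
  show "sets (distr P borel (\<lambda>\<omega>. \<omega> t)) = sets (ground_measure \<phi>)"
    by (simp add: sets_ground_measure)
  fix B assume "B \<in> sets (distr P borel (\<lambda>\<omega>. \<omega> t))"
  then have [measurable]: "B \<in> sets borel" by simp
  let ?I = "indicator B :: 'a \<Rightarrow> real"
  have "(LINT \<omega>|P. (\<Prod>i\<le>(0::nat). ?I (\<omega> t))) = (LINT x|ground_measure \<phi>. ?I x)"
  proof -
    have I: "?I \<in> borel_measurable (ground_measure \<phi>)"
      by (rule borel_measurable_indicator) (simp add: sets_ground_measure)
    have "square_integrable (ground_measure \<phi>) ?I"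
      unfolding square_integrable_def
      by (intro conjI \<mu>.integrable_const_bound[where B = 1] borel_measurable_power I)
        (auto split: split_indicator)
    then show ?thesis
      using correlation_chain[of 0 "\<lambda>_. t" "\<lambda>_. ?I"] by simp
  qed
  then have "(LINT \<omega>|P. ?I (\<omega> t)) = measure (ground_measure \<phi>) B"
    by (simp add: sets_ground_measure)
  moreover have "(LINT \<omega>|P. ?I (\<omega> t)) = measure P ((\<lambda>\<omega>. \<omega> t) -` B \<inter> space P)"
  proof -
    have "(LINT \<omega>|P. ?I (\<omega> t)) = (LINT \<omega>|P. indicator ((\<lambda>\<omega>. \<omega> t) -` B \<inter> space P) \<omega>)"
      by (intro Bochner_Integration.integral_cong) (auto simp: indicator_def)
    then show ?thesis by simp
  qed
  ultimately show "emeasure (distr P borel (\<lambda>\<omega>. \<omega> t)) B = emeasure (ground_measure \<phi>) B"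
    by (simp add: emeasure_distr P.emeasure_eq_measure \<mu>.emeasure_eq_measure)
qed

lemma T_measurable:
  "0 \<le> t \<Longrightarrow> f \<in> borel_measurable borel \<Longrightarrow> T t f \<in> borel_measurable borel"
  unfolding T_def using feynman_kac_measurable[OF levy _ V_measurable] by auto

lemma gst_semigroup_eq:
  "gst_semigroup M X V (ground_energy H) \<phi> t (\<lambda>x. G x / \<phi> x) x = T t G x / \<phi> x"
proof -
  have "(\<lambda>y. \<phi> y * (G y / \<phi> y)) = G" using phi_pos less_imp_neq by (force simp: fun_eq_iff)
  then show ?thesis by (simp add: gst_semigroup_def T_def)
qed

text \<open>
  The matrix elements of the semigroup are two-point correlations of the process.  All properties
  of \<open>T\<close> on square-integrable functions are read off from this identity.
\<close>

lemma correlation: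
  assumes F: "square_integrable lborel F" and G: "square_integrable lborel G" and t: "0 \<le> t"
  shows "(LINT \<omega>|P. (F (\<omega> s) / \<phi> (\<omega> s)) * (G (\<omega> (s + t)) / \<phi> (\<omega> (s + t))))
    = l2_inner lborel F (T t G)"
proof -
  have [measurable]: "F \<in> borel_measurable borel" "G \<in> borel_measurable borel"
    using F G by (auto intro: square_integrable_borel)
  have [measurable]: "T t G \<in> borel_measurable borel" by (rule T_measurable[OF t]) simp
  define f where "f i = (if i = 0 then (\<lambda>x. F x / \<phi> x) else (\<lambda>x. G x / \<phi> x))" for i :: nat
  define \<theta> where "\<theta> i = (if i = 0 then s else s + t)" for i :: nat
  have "(LINT \<omega>|P. (\<Prod>i\<le>Suc 0. f i (\<omega> (\<theta> i)))) = (LINT x|ground_measure \<phi>.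
      semigroup_chain (gst_semigroup M X V (ground_energy H) \<phi>) (Suc 0) \<theta> f x)"
    using t F G
    by (intro correlation_chain) (auto simp: f_def \<theta>_def square_integrable_ground_measure)
  also have "\<dots> = (LINT x|ground_measure \<phi>. F x / \<phi> x * (T t G x / \<phi> x))"
    by (simp add: f_def \<theta>_def gst_semigroup_eq)
  also have "\<dots> = (LINT x|lborel. (\<phi> x)\<^sup>2 * (F x / \<phi> x * (T t G x / \<phi> x)))"
    by (intro integral_ground_measure) measurable
  also have "\<dots> = l2_inner lborel F (T t G)"
    unfolding l2_inner_def
    by (intro Bochner_Integration.integral_cong)
      (use phi_pos in \<open>auto simp: power2_eq_square less_imp_neq[symmetric]\<close>)
  finally show ?thesis by (simp add: f_def \<theta>_def)
qed

text \<open>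
  The three-time formula with the constant function \<open>1\<close> at the middle time yields the semigroup
  property from the law of the process.
\<close>

lemma correlation_semigroup:
  assumes F: "square_integrable lborel F" and G: "square_integrable lborel G"
    and s: "0 \<le> s" and t: "0 \<le> t"
  shows "l2_inner lborel F (T s (T t G)) = l2_inner lborel F (T (s + t) G)"
proof -
  have [measurable]: "F \<in> borel_measurable borel" "G \<in> borel_measurable borel"
    using F G by (auto intro: square_integrable_borel)
  have [measurable]: "T s (T t G) \<in> borel_measurable borel"
    by (intro T_measurable s t) simp
  define f where "f i = (if i = 0 then (\<lambda>x. F x / \<phi> x) else if i = 1 then (\<lambda>_. 1) else (\<lambda>x. G x / \<phi> x))"
    for i :: nat
  define \<theta> where "\<theta> i = (if i = 0 then 0 else if i = 1 then s else s + t)" for i :: nat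
  have "(LINT \<omega>|P. (\<Prod>i\<le>Suc (Suc 0). f i (\<omega> (\<theta> i)))) = (LINT x|ground_measure \<phi>.
      semigroup_chain (gst_semigroup M X V (ground_energy H) \<phi>) (Suc (Suc 0)) \<theta> f x)"
    using s t F G
    by (intro correlation_chain) (auto simp: f_def \<theta>_def square_integrable_ground_measure)
  also have "\<dots> = (LINT x|ground_measure \<phi>. F x / \<phi> x * (T s (T t G) x / \<phi> x))"
    by (simp add: f_def \<theta>_def gst_semigroup_eq)
  also have "\<dots> = (LINT x|lborel. (\<phi> x)\<^sup>2 * (F x / \<phi> x * (T s (T t G) x / \<phi> x)))"
    by (intro integral_ground_measure) measurable
  also have "\<dots> = l2_inner lborel F (T s (T t G))"
    unfolding l2_inner_def
    by (intro Bochner_Integration.integral_cong)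
      (use phi_pos in \<open>auto simp: power2_eq_square less_imp_neq[symmetric]\<close>)
  finally show ?thesis
    using correlation[OF F G, of "s + t" 0] s t by (simp add: f_def \<theta>_def)
qed

lemma coordinate_square_integrable:
  assumes F: "square_integrable lborel F"
  shows "square_integrable P (\<lambda>\<omega>. F (\<omega> t) / \<phi> (\<omega> t))"
    and "l2_norm P (\<lambda>\<omega>. F (\<omega> t) / \<phi> (\<omega> t)) = l2_norm lborel F"
proof -
  have [measurable]: "F \<in> borel_measurable borel"
    using F by (rule square_integrable_borel)
  have "integrable (distr P borel (\<lambda>\<omega>. \<omega> t)) (\<lambda>x. (F x / \<phi> x)\<^sup>2)"
    unfolding distr_coordinate
    using square_integrable_ground_measure[OF F] by (simp add: square_integrable_def)
  then show "square_integrable P (\<lambda>\<omega>. F (\<omega> t) / \<phi> (\<omega> t))"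
    by (simp add: square_integrable_def integrable_distr_eq)
  have "l2_inner P (\<lambda>\<omega>. F (\<omega> t) / \<phi> (\<omega> t)) (\<lambda>\<omega>. F (\<omega> t) / \<phi> (\<omega> t))
      = (LINT x|distr P borel (\<lambda>\<omega>. \<omega> t). F x / \<phi> x * (F x / \<phi> x))"
    unfolding l2_inner_def by (subst integral_distr) auto
  also have "\<dots> = (LINT x|lborel. (\<phi> x)\<^sup>2 * (F x / \<phi> x * (F x / \<phi> x)))"
    unfolding distr_coordinate by (intro integral_ground_measure) measurable
  also have "\<dots> = l2_inner lborel F F"
    unfolding l2_inner_def
    by (intro Bochner_Integration.integral_cong)
      (use phi_pos in \<open>auto simp: power2_eq_square less_imp_neq[symmetric]\<close>)
  finally show "l2_norm P (\<lambda>\<omega>. F (\<omega> t) / \<phi> (\<omega> t)) = l2_norm lborel F"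
    by (simp add: l2_norm_def)
qed

lemma T_contraction:
  assumes G: "square_integrable lborel G" and t: "0 \<le> t"
  shows "square_integrable lborel (T t G)" "l2_norm lborel (T t G) \<le> l2_norm lborel G"
proof -
  have "\<bar>l2_inner lborel F (T t G)\<bar> \<le> l2_norm lborel F * l2_norm lborel G"
    if F: "square_integrable lborel F" for F
    using l2_inner_Cauchy_Schwarz[OF coordinate_square_integrable(1)[OF F, of 0]
        coordinate_square_integrable(1)[OF G, of t]]
      correlation[OF F G t, of 0]
    by (simp add: coordinate_square_integrable(2) F G) (simp add: l2_inner_def)
  moreover have "T t G \<in> borel_measurable borel"
    using square_integrable_measurable[OF G] by (intro T_measurable t) simp
  ultimately show "square_integrable lborel (T t G)" "l2_norm lborel (T t G) \<le> l2_norm lborel G"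
    using square_integrable_of_bounded_pairing[of "T t G" "l2_norm lborel G"]
    by (simp_all add: l2_norm_def l2_inner_def)
qed

lemma correlation_abs:
  assumes F: "square_integrable lborel F" and G: "square_integrable lborel G" and t: "0 \<le> t"
  shows "\<bar>l2_inner lborel F (T t G)\<bar> \<le> l2_inner lborel (\<lambda>x. \<bar>F x\<bar>) (T t (\<lambda>x. \<bar>G x\<bar>))"
proof -
  have F': "square_integrable lborel (\<lambda>x. \<bar>F x\<bar>)" and G': "square_integrable lborel (\<lambda>x. \<bar>G x\<bar>)"
    using F G by (auto simp: square_integrable_def)
  have "\<bar>l2_inner lborel F (T t G)\<bar>
      \<le> (LINT \<omega>|P. \<bar>(F (\<omega> 0) / \<phi> (\<omega> 0)) * (G (\<omega> (0 + t)) / \<phi> (\<omega> (0 + t)))\<bar>)"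
    unfolding correlation[OF F G t, of 0, symmetric] by (rule integral_abs_bound)
  also have "\<dots> = (LINT \<omega>|P. (\<bar>F (\<omega> 0)\<bar> / \<phi> (\<omega> 0)) * (\<bar>G (\<omega> (0 + t))\<bar> / \<phi> (\<omega> (0 + t))))"
    using phi_pos by (simp add: abs_mult abs_of_pos)
  also have "\<dots> = l2_inner lborel (\<lambda>x. \<bar>F x\<bar>) (T t (\<lambda>x. \<bar>G x\<bar>))"
    by (rule correlation[OF F' G' t])
  finally show ?thesis .
qed

lemma correlation_phi:
  assumes G: "square_integrable lborel G" and t: "0 \<le> t"
  shows "l2_inner lborel \<phi> (T t G) = l2_inner lborel \<phi> G"
proof -
  have [measurable]: "G \<in> borel_measurable borel"
    using G by (rule square_integrable_borel)
  have "l2_inner lborel \<phi> (T t G) = (LINT \<omega>|P. G (\<omega> t) / \<phi> (\<omega> t))"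
    using correlation[OF phi_square_integrable G t, of 0] phi_pos
    by (simp add: less_imp_neq[symmetric])
  also have "\<dots> = (LINT x|distr P borel (\<lambda>\<omega>. \<omega> t). G x / \<phi> x)"
    by (subst integral_distr) auto
  also have "\<dots> = (LINT x|lborel. (\<phi> x)\<^sup>2 * (G x / \<phi> x))"
    unfolding distr_coordinate by (intro integral_ground_measure) measurable
  also have "\<dots> = l2_inner lborel \<phi> G"
    unfolding l2_inner_def
    by (intro Bochner_Integration.integral_cong)
      (use phi_pos in \<open>auto simp: power2_eq_square less_imp_neq[symmetric]\<close>)
  finally show ?thesis .
qed

subsection \<open>The semigroup on square-integrable classes\<close>

definition K :: "real \<Rightarrow> 'a l2 \<Rightarrow> 'a l2" where
  "K t u = abs_l2 (T t (rep_l2 u))"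

lemma correlation_inner:
  assumes F: "square_integrable lborel F" and G: "square_integrable lborel G" and t: "0 \<le> t"
  shows "abs_l2 F \<bullet> abs_l2 (T t G)
    = (LINT \<omega>|P. (F (\<omega> s) / \<phi> (\<omega> s)) * (G (\<omega> (s + t)) / \<phi> (\<omega> (s + t))))"
  using correlation[OF F G t] inner_abs_l2[OF F T_contraction(1)[OF G t]] by simp

lemma AE_coordinate:
  assumes "AE x in lborel. R x"
  shows "AE \<omega> in P. R (\<omega> t)"
proof -
  have "AE x in ground_measure \<phi>. R x"
    using assms unfolding ground_measure_def by (subst AE_density) auto
  then have "AE x in distr P borel (\<lambda>\<omega>. \<omega> t). R x" by (simp only: distr_coordinate)
  then show ?thesis by (rule AE_distrD[OF coordinate_measurable])
qed

text \<open>
  Functions that agree almost everywhere agree almost surely along the process, so \<open>T\<close> acts on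
  classes.
\<close>

lemma abs_l2_T_cong:
  assumes G: "square_integrable lborel G" and G': "square_integrable lborel G'"
    and eq: "AE x in lborel. G x = G' x" and t: "0 \<le> t"
  shows "abs_l2 (T t G) = abs_l2 (T t G')"
proof -
  have [measurable]: "G \<in> borel_measurable borel" "G' \<in> borel_measurable borel"
    using G G' by (auto intro: square_integrable_borel)
  have "u \<bullet> abs_l2 (T t G) = u \<bullet> abs_l2 (T t G')" for u
  proof -
    have F: "square_integrable lborel (rep_l2 u)" by (rule rep_l2)
    have [measurable]: "rep_l2 u \<in> borel_measurable borel" by (rule square_integrable_borel[OF F])
    have "abs_l2 (rep_l2 u) \<bullet> abs_l2 (T t G) = abs_l2 (rep_l2 u) \<bullet> abs_l2 (T t G')"
      unfolding correlation_inner[OF F G t, of 0] correlation_inner[OF F G' t, of 0]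
    proof (rule integral_cong_AE)
      show "AE \<omega> in P. rep_l2 u (\<omega> 0) / \<phi> (\<omega> 0) * (G (\<omega> (0 + t)) / \<phi> (\<omega> (0 + t)))
          = rep_l2 u (\<omega> 0) / \<phi> (\<omega> 0) * (G' (\<omega> (0 + t)) / \<phi> (\<omega> (0 + t)))"
        using AE_coordinate[OF eq, of "0 + t"] by eventually_elim simp
    qed measurable
    then show ?thesis by (simp add: rep_l2)
  qed
  then show ?thesis by (metis vector_eq_ldot)
qed

lemma K_abs:
  assumes G: "square_integrable lborel G" and t: "0 \<le> t"
  shows "K t (abs_l2 G) = abs_l2 (T t G)"
proof -
  have "AE x in lborel. rep_l2 (abs_l2 G) x = G x"
    using abs_l2_eq_iff[OF rep_l2(1) G] rep_l2(2) by blast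
  then show ?thesis unfolding K_def by (rule abs_l2_T_cong[OF rep_l2(1) G _ t])
qed

lemma abs_l2_T_linear:
  assumes F: "square_integrable lborel F" and G: "square_integrable lborel G" and t: "0 \<le> t"
  shows "abs_l2 (T t (\<lambda>x. a * F x + G x)) = a *\<^sub>R abs_l2 (T t F) + abs_l2 (T t G)"
proof -
  have FG: "square_integrable lborel (\<lambda>x. a * F x + G x)"
    by (intro square_integrable_add square_integrable_cmult F G)
  have "u \<bullet> abs_l2 (T t (\<lambda>x. a * F x + G x)) = u \<bullet> (a *\<^sub>R abs_l2 (T t F) + abs_l2 (T t G))" for u
  proof -
    let ?U = "\<lambda>\<omega>. rep_l2 u (\<omega> 0) / \<phi> (\<omega> 0)"
    have U: "square_integrable lborel (rep_l2 u)" by (rule rep_l2)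
    have int: "integrable P (\<lambda>\<omega>. ?U \<omega> * (E (\<omega> (0 + t)) / \<phi> (\<omega> (0 + t))))"
      if "square_integrable lborel E" for E
      by (intro integrable_mult_square_integrable coordinate_square_integrable U that)
    have "abs_l2 (rep_l2 u) \<bullet> abs_l2 (T t (\<lambda>x. a * F x + G x))
        = (LINT \<omega>|P. a * (?U \<omega> * (F (\<omega> (0 + t)) / \<phi> (\<omega> (0 + t))))
          + ?U \<omega> * (G (\<omega> (0 + t)) / \<phi> (\<omega> (0 + t))))"
      unfolding correlation_inner[OF U FG t, of 0]
      by (intro Bochner_Integration.integral_cong) (auto simp: add_divide_distrib algebra_simps)
    also have "\<dots> = abs_l2 (rep_l2 u) \<bullet> (a *\<^sub>R abs_l2 (T t F) + abs_l2 (T t G))"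
      unfolding inner_add_right inner_scaleR_right
        correlation_inner[OF U F t, of 0] correlation_inner[OF U G t, of 0]
      by (simp only: Bochner_Integration.integral_add[OF integrable_mult_right[OF int[OF F]] int[OF G]]
          integral_mult_right_zero)
    finally show ?thesis by (simp add: rep_l2)
  qed
  then show ?thesis by (metis vector_eq_ldot)
qed

sublocale K: contraction_semigroup K
proof (rule contraction_semigroup.intro)
  fix s t :: real and u :: "'a l2"
  assume t: "0 \<le> t"
  have lin: "K t (a *\<^sub>R v + w) = a *\<^sub>R K t v + K t w" for a v w
  proof -
    have vw: "square_integrable lborel (rep_l2 v)" "square_integrable lborel (rep_l2 w)"
      by (rule rep_l2)+
    have "abs_l2 (\<lambda>x. a * rep_l2 v x + rep_l2 w x)
        = abs_l2 (\<lambda>x. a * rep_l2 v x) + abs_l2 (rep_l2 w)"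
      by (rule plus_l2.abs_eq[symmetric]) (auto intro: square_integrable_cmult vw)
    also have "abs_l2 (\<lambda>x. a * rep_l2 v x) = a *\<^sub>R abs_l2 (rep_l2 v)"
      by (rule scaleR_l2.abs_eq[symmetric]) (auto intro: vw)
    finally have eq: "a *\<^sub>R v + w = abs_l2 (\<lambda>x. a * rep_l2 v x + rep_l2 w x)"
      by (simp only: rep_l2(2))
    have "K t (a *\<^sub>R v + w) = abs_l2 (T t (\<lambda>x. a * rep_l2 v x + rep_l2 w x))"
      unfolding eq by (intro K_abs t square_integrable_add square_integrable_cmult vw)
    also have "\<dots> = a *\<^sub>R K t v + K t w"
      unfolding K_def by (rule abs_l2_T_linear[OF vw t])
    finally show ?thesis .
  qed
  have "K t 0 = 0" using lin[of 1 0 0] by simp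
  then show "linear (K t)" using lin[of 1] lin[of _ _ 0] by (intro linearI) simp_all
  show "norm (K t u) \<le> norm u"
    using T_contraction(2)[OF rep_l2(1)[of u] t] norm_abs_l2[OF rep_l2(1)[of u]]
      norm_abs_l2[OF T_contraction(1)[OF rep_l2(1)[of u] t]]
    unfolding K_def rep_l2(2) by linarith
  assume s: "0 \<le> s"
  have "v \<bullet> K s (K t u) = v \<bullet> K (s + t) u" for v
  proof -
    have V: "square_integrable lborel (rep_l2 v)" and U: "square_integrable lborel (rep_l2 u)"
      by (rule rep_l2)+
    have TU: "square_integrable lborel (T t (rep_l2 u))"
      "square_integrable lborel (T s (T t (rep_l2 u)))"
      "square_integrable lborel (T (s + t) (rep_l2 u))"
      using s t by (auto intro!: T_contraction U)
    have "abs_l2 (rep_l2 v) \<bullet> abs_l2 (T s (T t (rep_l2 u)))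
        = abs_l2 (rep_l2 v) \<bullet> abs_l2 (T (s + t) (rep_l2 u))"
      using correlation_semigroup[OF V U s t] inner_abs_l2[OF V TU(2)] inner_abs_l2[OF V TU(3)]
      by (simp only:)
    then show ?thesis
      by (simp only: rep_l2(2) K_abs[OF TU(1) s] K_def[of t u] K_def[of "s + t" u])
  qed
  then show "K s (K t u) = K (s + t) u" by (metis vector_eq_ldot)
qed

lemma K_inner_phi:
  assumes "0 \<le> t"
  shows "abs_l2 \<phi> \<bullet> K t u = abs_l2 \<phi> \<bullet> u"
proof -
  have U: "square_integrable lborel (rep_l2 u)" by (rule rep_l2)
  have "abs_l2 \<phi> \<bullet> abs_l2 (T t (rep_l2 u)) = abs_l2 \<phi> \<bullet> abs_l2 (rep_l2 u)"
    using correlation_phi[OF U assms] inner_abs_l2[OF phi_square_integrable U]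
      inner_abs_l2[OF phi_square_integrable T_contraction(1)[OF U assms]]
    by (simp only:)
  then show ?thesis by (simp only: K_def rep_l2(2))
qed

lemma abs_l2_quotient:
  assumes f: "square_integrable lborel f" and g: "square_integrable lborel g" and t: "0 < t"
  shows "(\<integral>\<^sup>+x. ennreal (((f x - feynman_kac M X V t f x) / t - g x)\<^sup>2) \<partial>lborel)
    = ennreal ((norm ((abs_l2 f - exp (- ground_energy H * t) *\<^sub>R K t (abs_l2 f)) /\<^sub>R t - abs_l2 g))\<^sup>2)"
proof -
  define h where "h x = (1 / t) * (f x - exp (- ground_energy H * t) * T t f x) - g x" for x
  have T: "square_integrable lborel (T t f)" using t by (intro T_contraction f) simp
  have h: "square_integrable lborel h"
    unfolding h_def by (intro square_integrable_diff square_integrable_cmult f g T)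
  have "feynman_kac M X V t f x = exp (- ground_energy H * t) * T t f x" for x
    by (simp add: T_def flip: exp_add)
  then have "(\<integral>\<^sup>+x. ennreal (((f x - feynman_kac M X V t f x) / t - g x)\<^sup>2) \<partial>lborel)
      = (\<integral>\<^sup>+x. ennreal ((h x)\<^sup>2) \<partial>lborel)"
    by (simp add: h_def)
  also have "\<dots> = ennreal ((norm (abs_l2 h))\<^sup>2)"
    by (simp add: l2_norm_nn_integral[OF h] norm_abs_l2[OF h])
  also have "abs_l2 h = (abs_l2 f - exp (- ground_energy H * t) *\<^sub>R K t (abs_l2 f)) /\<^sub>R t - abs_l2 g"
  proof -
    let ?c = "exp (- ground_energy H * t)"
    have sq: "square_integrable lborel (\<lambda>x. ?c * T t f x)"
      "square_integrable lborel (\<lambda>x. f x - ?c * T t f x)"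
      "square_integrable lborel (\<lambda>x. (1 / t) * (f x - ?c * T t f x))"
      by (intro square_integrable_diff square_integrable_cmult f T)+
    have "abs_l2 h = abs_l2 (\<lambda>x. (1 / t) * (f x - ?c * T t f x)) - abs_l2 g"
      unfolding h_def by (rule minus_l2.abs_eq[symmetric]) (use sq g in auto)
    also have "abs_l2 (\<lambda>x. (1 / t) * (f x - ?c * T t f x))
        = (1 / t) *\<^sub>R abs_l2 (\<lambda>x. f x - ?c * T t f x)"
      by (rule scaleR_l2.abs_eq[symmetric]) (use sq in auto)
    also have "abs_l2 (\<lambda>x. f x - ?c * T t f x) = abs_l2 f - abs_l2 (\<lambda>x. ?c * T t f x)"
      by (rule minus_l2.abs_eq[symmetric]) (use sq f in auto)
    also have "abs_l2 (\<lambda>x. ?c * T t f x) = ?c *\<^sub>R abs_l2 (T t f)"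
      by (rule scaleR_l2.abs_eq[symmetric]) (use T in auto)
    also have "abs_l2 (T t f) = K t (abs_l2 f)" using t by (simp add: K_abs[OF f])
    finally show ?thesis by (simp add: divide_inverse)
  qed
  finally show ?thesis .
qed

text \<open>
  In the normalisation of \<open>K\<close> the ground energy is moved to zero: the generator of \<open>K\<close> is
  \<open>- (H - ground_energy H)\<close>.
\<close>

lemma mem_H_iff:
  "(f, g) \<in> H \<longleftrightarrow> square_integrable lborel f \<and> square_integrable lborel g \<and>
    (abs_l2 f, abs_l2 g - ground_energy H *\<^sub>R abs_l2 f) \<in> K.gen"
proof -
  let ?l = "ground_energy H"
  have H: "H = neg_generator (feynman_kac M X V)"
    using schroedinger by (simp add: schroedinger_operator_def)
  have "((\<lambda>t. \<integral>\<^sup>+x. ennreal (((f x - feynman_kac M X V t f x) / t - g x)\<^sup>2) \<partial>lborel) \<longlongrightarrow> 0) (at_right 0)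
      \<longleftrightarrow> (abs_l2 f, abs_l2 g - ?l *\<^sub>R abs_l2 f) \<in> K.gen" (is "?L \<longleftrightarrow> ?R")
    if f: "square_integrable lborel f" and g: "square_integrable lborel g"
  proof -
    let ?k = "\<lambda>t. exp (- ?l * t) *\<^sub>R K t (abs_l2 f)"
    let ?q = "\<lambda>t. (abs_l2 f - ?k t) /\<^sub>R t"
    have "?L \<longleftrightarrow> ((\<lambda>t. ennreal ((norm (?q t - abs_l2 g))\<^sup>2)) \<longlongrightarrow> ennreal 0) (at_right 0)"
      unfolding ennreal_0
      by (rule tendsto_cong, rule eventually_mono[OF eventually_at_right_less])
        (simp add: abs_l2_quotient[OF f g])
    also have "\<dots> \<longleftrightarrow> ((\<lambda>t. (norm (?q t - abs_l2 g))\<^sup>2) \<longlongrightarrow> 0) (at_right 0)"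
      by (rule tendsto_ennreal_iff) auto
    also have "\<dots> \<longleftrightarrow> ((\<lambda>t. norm (?q t - abs_l2 g)) \<longlongrightarrow> 0) (at_right 0)"
    proof
      assume "((\<lambda>t. (norm (?q t - abs_l2 g))\<^sup>2) \<longlongrightarrow> 0) (at_right 0)"
      from tendsto_real_sqrt[OF this] show "((\<lambda>t. norm (?q t - abs_l2 g)) \<longlongrightarrow> 0) (at_right 0)" by simp
    next
      assume "((\<lambda>t. norm (?q t - abs_l2 g)) \<longlongrightarrow> 0) (at_right 0)"
      from tendsto_power[OF this, of 2] show "((\<lambda>t. (norm (?q t - abs_l2 g))\<^sup>2) \<longlongrightarrow> 0) (at_right 0)"
        by simp
    qed
    also have "\<dots> \<longleftrightarrow> (?q \<longlongrightarrow> abs_l2 g) (at_right 0)"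
      unfolding tendsto_norm_zero_iff by (rule LIM_zero_iff)
    also have "\<dots> \<longleftrightarrow> ?R"
    proof
      assume "(?q \<longlongrightarrow> abs_l2 g) (at_right 0)"
      from tendsto_generator_shift[OF this, of "- ?l"] show ?R
        by (simp add: K.gen_def flip: exp_add)
    next
      assume ?R
      then have "((\<lambda>t. (abs_l2 f - K t (abs_l2 f)) /\<^sub>R t)
          \<longlongrightarrow> abs_l2 g - ?l *\<^sub>R abs_l2 f) (at_right 0)"
        by (simp add: K.gen_def)
      from tendsto_generator_shift[OF this, of ?l] show "(?q \<longlongrightarrow> abs_l2 g) (at_right 0)" by simp
    qed
    finally show ?thesis .
  qed
  then show ?thesis unfolding H neg_generator_def by auto
qed

subsection \<open>Simplicity of the ground energy and decay of correlations\<close>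

abbreviation e :: "'a l2" where "e \<equiv> abs_l2 \<phi>"

lemma norm_e: "norm e = 1"
  by (simp add: norm_abs_l2 phi_square_integrable phi_norm)

text \<open>
  A contraction that preserves the inner product with the unit vector \<open>e\<close> fixes \<open>e\<close>.
\<close>

lemma K_e: "0 \<le> t \<Longrightarrow> K t e = e"
proof -
  assume t: "0 \<le> t"
  have ee: "e \<bullet> e = 1" using norm_e by (simp add: norm_eq_sqrt_inner)
  have "K t e \<bullet> K t e \<le> 1"
    using K.contraction[OF t, of e] norm_e by (simp add: norm_eq_sqrt_inner)
  moreover have "e \<bullet> K t e = 1" using K_inner_phi[OF t, of e] ee by simp
  ultimately have "(K t e - e) \<bullet> (K t e - e) \<le> 0"
    using ee by (simp add: inner_diff inner_commute[of "K t e" e])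
  then show ?thesis by (metis inner_gt_zero_iff not_le right_minus_eq)
qed

text \<open>
  By positivity, passing from \<open>f\<close> to \<open>\<bar>f\<bar>\<close> can only increase \<open>f \<bullet> K t f\<close>, which has already its
  largest possible value, the square of the norm of \<open>f\<close>.  For a contraction equality holds only
  at fixed vectors.
\<close>

lemma kernel_abs:
  assumes f: "square_integrable lborel f" and u: "(abs_l2 f, 0) \<in> K.gen"
  shows "(abs_l2 (\<lambda>x. \<bar>f x\<bar>), 0) \<in> K.gen"
proof (rule K.gen_kernelI)
  fix t :: real assume t: "0 < t"
  define a where "a = abs_l2 (\<lambda>x. \<bar>f x\<bar>)"
  have f': "square_integrable lborel (\<lambda>x. \<bar>f x\<bar>)" using f by (auto simp: square_integrable_def)
  have t0: "0 \<le> t" using t by simp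
  have aa: "a \<bullet> a = abs_l2 f \<bullet> abs_l2 f"
    unfolding a_def inner_abs_l2[OF f f] inner_abs_l2[OF f' f'] by (simp add: l2_inner_def)
  have "abs_l2 f \<bullet> abs_l2 f = abs_l2 f \<bullet> K t (abs_l2 f)" using K.gen_kernelD[OF u t] by simp
  also have "\<dots> = l2_inner lborel f (T t f)"
    unfolding K_abs[OF f t0] by (rule inner_abs_l2[OF f T_contraction(1)[OF f t0]])
  also have "\<dots> \<le> l2_inner lborel (\<lambda>x. \<bar>f x\<bar>) (T t (\<lambda>x. \<bar>f x\<bar>))"
    using correlation_abs[OF f f t0] by linarith
  also have "\<dots> = a \<bullet> K t a"
    unfolding a_def K_abs[OF f' t0]
    by (rule inner_abs_l2[OF f' T_contraction(1)[OF f' t0], symmetric])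
  finally have "a \<bullet> a \<le> a \<bullet> K t a" by (simp add: aa)
  moreover have "K t a \<bullet> K t a \<le> a \<bullet> a"
    using K.contraction[OF t0, of a] by (simp add: norm_eq_sqrt_inner)
  ultimately have "(K t a - a) \<bullet> (K t a - a) \<le> 0"
    by (simp add: inner_diff inner_commute[of "K t a" a])
  then show "K t (abs_l2 (\<lambda>x. \<bar>f x\<bar>)) = abs_l2 (\<lambda>x. \<bar>f x\<bar>)"
    unfolding a_def[symmetric] by (metis inner_gt_zero_iff not_le right_minus_eq)
qed

lemma e_gen: "(e, 0) \<in> K.gen"
  by (rule K.gen_kernelI) (simp add: K_e)

text \<open>
  The sum of \<open>\<phi>\<close> and a nonnegative element of the kernel is everywhere positive, so its
  normalisation is again a positive ground state and agrees with \<open>\<phi>\<close>.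
\<close>

lemma kernel_nonneg:
  assumes f: "square_integrable lborel f" and nonneg: "\<And>x. 0 \<le> f x"
    and u: "(abs_l2 f, 0) \<in> K.gen"
  shows "\<exists>a. abs_l2 f = a *\<^sub>R e"
proof -
  let ?\<psi> = "\<lambda>x. \<phi> x + f x"
  let ?l = "ground_energy H"
  have \<psi>: "square_integrable lborel ?\<psi>" by (intro square_integrable_add phi_square_integrable f)
  have \<psi>_abs: "abs_l2 ?\<psi> = e + abs_l2 f"
    by (rule plus_l2.abs_eq[symmetric]) (auto intro: phi_square_integrable f)
  have "0 \<le> e \<bullet> abs_l2 f"
    unfolding inner_abs_l2[OF phi_square_integrable f] l2_inner_def
    using phi_pos nonneg by (intro integral_nonneg_AE AE_I2) (simp add: less_imp_le)
  moreover have "e \<bullet> e = 1" using norm_e by (simp add: norm_eq_sqrt_inner)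
  ultimately have "e \<bullet> abs_l2 ?\<psi> \<noteq> 0" by (simp add: \<psi>_abs inner_add)
  then have \<psi>0: "abs_l2 ?\<psi> \<noteq> 0" by auto
  define c where "c = norm (abs_l2 ?\<psi>)"
  have c: "0 < c" using \<psi>0 by (simp add: c_def)
  define g where "g x = (1 / c) * ?\<psi> x" for x
  have g: "square_integrable lborel g" unfolding g_def by (intro square_integrable_cmult \<psi>)
  have g_abs: "abs_l2 g = (1 / c) *\<^sub>R abs_l2 ?\<psi>"
    unfolding g_def by (rule scaleR_l2.abs_eq[symmetric]) (auto intro: \<psi>)
  have g_norm: "norm (abs_l2 g) = 1" using c by (simp add: g_abs c_def)
  have lg: "square_integrable lborel (\<lambda>x. ?l * g x)" by (intro square_integrable_cmult g)
  have lg_abs: "abs_l2 (\<lambda>x. ?l * g x) = ?l *\<^sub>R abs_l2 g"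
    by (rule scaleR_l2.abs_eq[symmetric]) (auto intro: g)
  have "(abs_l2 ?\<psi>, 0) \<in> K.gen" using K.gen_add[OF e_gen u] by (simp add: \<psi>_abs)
  then have "(abs_l2 g, 0) \<in> K.gen" using K.gen_scale[of "abs_l2 ?\<psi>" 0 "1 / c"] by (simp add: g_abs)
  then have "(g, \<lambda>x. ?l * g x) \<in> H" by (simp add: mem_H_iff g lg lg_abs)
  moreover have "\<not> (AE x in lborel. g x = 0)"
  proof
    assume "AE x in lborel. g x = 0"
    then have "abs_l2 g = abs_l2 (\<lambda>_. 0)"
      by (simp add: abs_l2_eq_iff[OF g square_integrable_zero])
    then have "abs_l2 g = 0" by (simp add: zero_l2.abs_eq)
    then show False using g_norm by simp
  qed
  moreover have "0 < g x" for x
    using c phi_pos[of x] nonneg[of x] by (simp add: g_def add_pos_nonneg)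
  moreover have "l2_norm lborel g = 1" using g_norm norm_abs_l2[OF g] by simp
  ultimately have "positive_ground_eigenfunction H g"
    by (simp add: positive_ground_eigenfunction_def eigenfunction_def)
  then have "AE x in lborel. g x = \<phi> x" using ground by (simp add: ground_state_def)
  then have "abs_l2 g = e" by (simp add: abs_l2_eq_iff[OF g phi_square_integrable])
  then have "c *\<^sub>R abs_l2 g = c *\<^sub>R e" by simp
  then have "e + abs_l2 f = c *\<^sub>R e" using c by (simp add: g_abs \<psi>_abs)
  then have "abs_l2 f = (c - 1) *\<^sub>R e" by (simp add: algebra_simps eq_diff_eq)
  then show ?thesis by blast
qed

text \<open>
  The positive and the negative part of an element of the kernel lie in the kernel, so that
  \<open>kernel_nonneg\<close> applies to both.  The factor \<open>2\<close> in the proof avoids fractions.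
\<close>

lemma kernel_simple:
  assumes "(u, 0) \<in> K.gen"
  shows "\<exists>a. u = a *\<^sub>R e"
proof -
  define f where "f = rep_l2 u"
  have f: "square_integrable lborel f" and u: "abs_l2 f = u" by (simp_all add: f_def rep_l2)
  have f': "square_integrable lborel (\<lambda>x. \<bar>f x\<bar>)" using f by (auto simp: square_integrable_def)
  define a where "a = abs_l2 (\<lambda>x. \<bar>f x\<bar>)"
  have a: "(a, 0) \<in> K.gen" unfolding a_def by (rule kernel_abs[OF f]) (simp add: u assms)
  have sq: "square_integrable lborel (\<lambda>x. \<bar>f x\<bar> + f x)" "square_integrable lborel (\<lambda>x. \<bar>f x\<bar> - f x)"
    by (intro square_integrable_add square_integrable_diff f f')+
  have plus: "abs_l2 (\<lambda>x. \<bar>f x\<bar> + f x) = a + u"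
    unfolding a_def u[symmetric] by (rule plus_l2.abs_eq[symmetric]) (auto intro: f f')
  have minus: "abs_l2 (\<lambda>x. \<bar>f x\<bar> - f x) = a - u"
    unfolding a_def u[symmetric] by (rule minus_l2.abs_eq[symmetric]) (auto intro: f f')
  have nonneg: "0 \<le> \<bar>f x\<bar> + f x" "0 \<le> \<bar>f x\<bar> - f x" for x by auto
  obtain p where p: "a + u = p *\<^sub>R e"
    using kernel_nonneg[OF sq(1) nonneg(1)] K.gen_add[OF a assms] unfolding plus by auto
  obtain q where q: "a - u = q *\<^sub>R e"
    using kernel_nonneg[OF sq(2) nonneg(2)] K.gen_diff[OF a assms] unfolding minus by auto
  have "2 *\<^sub>R u = (a + u) - (a - u)" by (simp add: scaleR_2)
  also have "\<dots> = (p - q) *\<^sub>R e" by (simp only: p q scaleR_left_diff_distrib)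
  finally have "(1 / 2) *\<^sub>R (2 *\<^sub>R u) = (1 / 2) *\<^sub>R ((p - q) *\<^sub>R e)" by (simp only:)
  then have "u = ((p - q) / 2) *\<^sub>R e" by simp
  then show ?thesis by blast
qed

text \<open>
  The hypotheses of \<open>spectral_gap\<close> are those on \<open>H\<close>, shifted by the ground energy.  The points at
  distance less than \<open>\<delta>\<close> from the ground energy belong to the resolvent set, on both sides; the
  one at distance \<open>\<delta> / 2\<close> below it provides the bounded resolvent.
\<close>

lemma exponential_decay:
  "\<exists>\<kappa>>0. \<forall>t\<ge>0. \<forall>u. e \<bullet> u = 0 \<longrightarrow> norm (K t u) \<le> exp (- \<kappa> * t) * norm u"
proof -
  let ?l = "ground_energy H"
  obtain \<delta> where \<delta>: "0 < \<delta>" "\<And>y. y \<in> Spec H \<Longrightarrow> dist ?l y < \<delta> \<Longrightarrow> y = ?l"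
    using isolated unfolding isolated_eigenvalue_def isolated_in_dist_Ex_iff by blast
  have resolvent: "?l + c \<in> resolvent_set H" if "c \<noteq> 0" "\<bar>c\<bar> < \<delta>" for c
    using \<delta>(2)[of "?l + c"] that by (auto simp: Spec_def dist_real_def)
  have adj: "adjoint_graph H = H" and dense: "densely_defined H"
    using schroedinger by (auto simp: schroedinger_operator_def self_adjoint_def)
  have gen_rep: "\<exists>f g. (f, g) \<in> H \<and> square_integrable lborel f \<and> square_integrable lborel g
      \<and> u = abs_l2 f \<and> v + ?l *\<^sub>R u = abs_l2 g" if "(u, v) \<in> K.gen" for u v
  proof (intro exI conjI)
    show "(rep_l2 u, rep_l2 (v + ?l *\<^sub>R u)) \<in> H"
      using that by (simp add: mem_H_iff rep_l2)
  qed (simp_all add: rep_l2)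
  have abs_shift: "abs_l2 (\<lambda>x. g x - c * f x) = abs_l2 g - c *\<^sub>R abs_l2 f"
    if f: "square_integrable lborel f" and g: "square_integrable lborel g" for f g c
  proof -
    have cf: "square_integrable lborel (\<lambda>x. c * f x)" by (rule square_integrable_cmult[OF f])
    have "abs_l2 (\<lambda>x. g x - c * f x) = abs_l2 g - abs_l2 (\<lambda>x. c * f x)"
      by (rule minus_l2.abs_eq[symmetric]) (auto intro: g cf)
    also have "abs_l2 (\<lambda>x. c * f x) = c *\<^sub>R abs_l2 f"
      by (rule scaleR_l2.abs_eq[symmetric]) (auto intro: f)
    finally show ?thesis .
  qed
  show ?thesis
  proof (rule K.spectral_gap[where p = "\<delta> / 2"])
    fix u v u' v' assume "(u, v) \<in> K.gen" "(u', v') \<in> K.gen"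
    then obtain f g f' g' where fg: "(f, g) \<in> H" "(f', g') \<in> H"
      and sq: "square_integrable lborel f" "square_integrable lborel g"
        "square_integrable lborel f'" "square_integrable lborel g'"
      and uv: "u = abs_l2 f" "v + ?l *\<^sub>R u = abs_l2 g" "u' = abs_l2 f'" "v' + ?l *\<^sub>R u' = abs_l2 g'"
      using gen_rep by metis
    have "(f', g') \<in> adjoint_graph H" using fg adj by simp
    then have "l2_inner lborel g f' = l2_inner lborel f g'"
      using fg(1) unfolding adjoint_graph_def by blast
    then have "abs_l2 g \<bullet> abs_l2 f' = abs_l2 f \<bullet> abs_l2 g'"
      unfolding inner_abs_l2[OF sq(2,3)] inner_abs_l2[OF sq(1,4)] .
    then have "(v + ?l *\<^sub>R u) \<bullet> u' = u \<bullet> (v' + ?l *\<^sub>R u')"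
      by (simp only: uv(1,3)[symmetric] uv(2,4)[symmetric])
    then show "v \<bullet> u' = u \<bullet> v'" by (simp add: inner_add)
  next
    fix u :: "'a l2" and \<epsilon> :: real assume \<epsilon>: "0 < \<epsilon>"
    obtain f g where fg: "(f, g) \<in> H" "l2_norm lborel (\<lambda>x. rep_l2 u x - f x) < \<epsilon>"
      using dense \<epsilon> rep_l2(1)[of u] unfolding densely_defined_def by blast
    have f: "square_integrable lborel f" using fg(1) by (simp add: mem_H_iff)
    have "norm (u - abs_l2 f) = norm (abs_l2 (\<lambda>x. rep_l2 u x - 1 * f x))"
      unfolding abs_shift[OF f rep_l2(1)] by (simp add: rep_l2)
    also have "\<dots> < \<epsilon>"
      using fg(2) norm_abs_l2[OF square_integrable_diff[OF rep_l2(1)[of u] f]] by simp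
    finally show "\<exists>(x, y)\<in>K.gen. norm (u - x) < \<epsilon>" using fg(1) by (auto simp: mem_H_iff)
  next
    fix w :: "'a l2"
    have "?l + (- (\<delta> / 2)) \<in> resolvent_set H" using \<delta>(1) by (intro resolvent) auto
    then obtain f g where fg: "(f, g) \<in> H"
      and ae: "AE x in lborel. g x - (?l + (- (\<delta> / 2))) * f x = rep_l2 w x"
      using rep_l2(1)[of w] unfolding resolvent_set_def by blast
    have sq: "square_integrable lborel f" "square_integrable lborel g"
      and gen: "(abs_l2 f, abs_l2 g - ?l *\<^sub>R abs_l2 f) \<in> K.gen"
      using fg by (auto simp: mem_H_iff)
    have "abs_l2 (\<lambda>x. g x - (?l + (- (\<delta> / 2))) * f x) = abs_l2 (rep_l2 w)"
      using ae abs_l2_eq_iff[OF square_integrable_diff[OF sq(2) square_integrable_cmult[OF sq(1)]]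
          rep_l2(1)[of w]] by blast
    then have "abs_l2 g - (?l + (- (\<delta> / 2))) *\<^sub>R abs_l2 f = w"
      unfolding abs_shift[OF sq] rep_l2(2) .
    then have "(abs_l2 g - ?l *\<^sub>R abs_l2 f) + (\<delta> / 2) *\<^sub>R abs_l2 f = w"
      by (simp add: algebra_simps)
    with gen show "\<exists>(u, v)\<in>K.gen. v + (\<delta> / 2) *\<^sub>R u = w" by blast
  next
    fix c :: real assume c: "0 < c" "c < 2 * (\<delta> / 2)"
    then have "?l + c \<in> resolvent_set H" by (intro resolvent) auto
    then obtain k where k: "\<And>f g. (f, g) \<in> H \<Longrightarrow>
        l2_norm lborel f \<le> k * l2_norm lborel (\<lambda>x. g x - (?l + c) * f x)"
      unfolding resolvent_set_def by blast
    have "norm u \<le> k * norm (v - c *\<^sub>R u)" if gen: "(u, v) \<in> K.gen" for u v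
    proof -
      obtain f g where fg: "(f, g) \<in> H" and f: "square_integrable lborel f"
        and g: "square_integrable lborel g" and uv: "u = abs_l2 f" "v + ?l *\<^sub>R u = abs_l2 g"
        using gen_rep[OF gen] by blast
      have "norm (abs_l2 f) \<le> k * norm (abs_l2 (\<lambda>x. g x - (?l + c) * f x))"
        using k[OF fg] norm_abs_l2[OF f]
          norm_abs_l2[OF square_integrable_diff[OF g square_integrable_cmult[OF f]]] by simp
      then have "norm u \<le> k * norm (v + ?l *\<^sub>R u - (?l + c) *\<^sub>R u)"
        unfolding abs_shift[OF f g] by (simp only: uv(1)[symmetric] uv(2)[symmetric])
      then show ?thesis by (simp add: algebra_simps)
    qed
    then show "\<exists>k. \<forall>(u, v)\<in>K.gen. norm u \<le> k * norm (v - c *\<^sub>R u)" by blast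
  qed (use \<delta>(1) e_gen norm_e kernel_simple K_inner_phi in auto)
qed

text \<open>
  The functions \<open>\<phi> 1\<^sub>A\<close> and \<open>\<phi> 1\<^sub>B\<close> have inner products \<open>\<mu> A\<close> and \<open>\<mu> B\<close> with \<open>\<phi>\<close>.  Removing from
  the second its component along \<open>\<phi>\<close>, which is fixed by \<open>K t\<close>, removes exactly the product
  \<open>\<mu> A \<cdot> \<mu> B\<close> from the correlation.
\<close>

lemma correlation_decay:
  "\<exists>\<kappa>>0. \<forall>s t A B. 0 \<le> t \<longrightarrow> A \<in> sets borel \<longrightarrow> B \<in> sets borel \<longrightarrow>
    \<bar>measure P {\<omega> \<in> space P. \<omega> s \<in> A \<and> \<omega> (s + t) \<in> B}
      - measure (ground_measure \<phi>) A * measure (ground_measure \<phi>) B\<bar>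
    \<le> exp (- \<kappa> * t) * (sqrt (measure (ground_measure \<phi>) A) * sqrt (measure (ground_measure \<phi>) B))"
proof -
  obtain \<kappa> where \<kappa>: "0 < \<kappa>"
    and decay: "\<And>t u. 0 \<le> t \<Longrightarrow> e \<bullet> u = 0 \<Longrightarrow> norm (K t u) \<le> exp (- \<kappa> * t) * norm u"
    using exponential_decay by blast
  let ?\<mu> = "ground_measure \<phi>"
  have ind: "square_integrable lborel (\<lambda>x. \<phi> x * indicator A x)
      \<and> e \<bullet> abs_l2 (\<lambda>x. \<phi> x * indicator A x) = measure ?\<mu> A
      \<and> norm (abs_l2 (\<lambda>x. \<phi> x * indicator A x)) = sqrt (measure ?\<mu> A)"
    if [measurable]: "A \<in> sets borel" for A
  proof -
    let ?F = "\<lambda>x. \<phi> x * indicator A x"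
    have "integrable lborel (\<lambda>x. (\<phi> x)\<^sup>2)" using phi_square_integrable by (simp add: square_integrable_def)
    then have "integrable lborel (\<lambda>x. (?F x)\<^sup>2)"
      by (rule Bochner_Integration.integrable_bound) (auto simp: indicator_def)
    then have F: "square_integrable lborel ?F" by (simp add: square_integrable_def)
    have "measure ?\<mu> A = (LINT x|?\<mu>. indicator A x)" by (simp add: sets_ground_measure)
    also have "\<dots> = (LINT x|lborel. (\<phi> x)\<^sup>2 * indicator A x)" by (rule integral_ground_measure) simp
    finally have \<mu>A: "measure ?\<mu> A = (LINT x|lborel. (\<phi> x)\<^sup>2 * indicator A x)" .
    have "e \<bullet> abs_l2 ?F = measure ?\<mu> A"
      unfolding inner_abs_l2[OF phi_square_integrable F] l2_inner_def \<mu>A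
      by (intro Bochner_Integration.integral_cong) (auto simp: power2_eq_square)
    moreover have "l2_inner lborel ?F ?F = measure ?\<mu> A"
      unfolding l2_inner_def \<mu>A
      by (intro Bochner_Integration.integral_cong) (auto simp: power2_eq_square indicator_def)
    ultimately show ?thesis using F by (simp add: norm_abs_l2[OF F] l2_norm_def)
  qed
  have "\<bar>measure P {\<omega> \<in> space P. \<omega> s \<in> A \<and> \<omega> (s + t) \<in> B} - measure ?\<mu> A * measure ?\<mu> B\<bar>
      \<le> exp (- \<kappa> * t) * (sqrt (measure ?\<mu> A) * sqrt (measure ?\<mu> B))"
    if t: "0 \<le> t" and [measurable]: "A \<in> sets borel" "B \<in> sets borel" for s t A B
  proof -
    let ?F = "\<lambda>x. \<phi> x * indicator A x" and ?G = "\<lambda>x. \<phi> x * indicator B x"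
    define u v where "u = abs_l2 ?F" and "v = abs_l2 ?G"
    have F: "square_integrable lborel ?F" and eu: "e \<bullet> u = measure ?\<mu> A"
      and nu: "norm u = sqrt (measure ?\<mu> A)" using ind[of A] by (auto simp: u_def)
    have G: "square_integrable lborel ?G" and ev: "e \<bullet> v = measure ?\<mu> B"
      and nv: "norm v = sqrt (measure ?\<mu> B)" using ind[of B] by (auto simp: v_def)
    have "u \<bullet> K t v = (LINT \<omega>|P. ?F (\<omega> s) / \<phi> (\<omega> s) * (?G (\<omega> (s + t)) / \<phi> (\<omega> (s + t))))"
      unfolding u_def v_def K_abs[OF G t] by (rule correlation_inner[OF F G t])
    also have "\<dots> = (LINT \<omega>|P. indicator {\<omega> \<in> space P. \<omega> s \<in> A \<and> \<omega> (s + t) \<in> B} \<omega>)"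
      using phi_pos
      by (intro Bochner_Integration.integral_cong) (auto simp: indicator_def less_imp_neq[symmetric])
    also have "\<dots> = measure P {\<omega> \<in> space P. \<omega> s \<in> A \<and> \<omega> (s + t) \<in> B}" by simp
    finally have joint: "measure P {\<omega> \<in> space P. \<omega> s \<in> A \<and> \<omega> (s + t) \<in> B} = u \<bullet> K t v" by simp
    define w where "w = v - (e \<bullet> v) *\<^sub>R e"
    have ee: "e \<bullet> e = 1" using norm_e by (simp add: norm_eq_sqrt_inner)
    have ew: "e \<bullet> w = 0" by (simp add: w_def inner_diff ee)
    have "(norm w)\<^sup>2 = (norm v)\<^sup>2 - (e \<bullet> v)\<^sup>2"
      unfolding power2_norm_eq_inner
      by (simp add: w_def inner_diff ee inner_commute[of v e] power2_eq_square)
    then have "(norm w)\<^sup>2 \<le> (norm v)\<^sup>2" by simp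
    then have nw: "norm w \<le> norm v" by (rule power2_le_imp_le) simp
    have "K t w = K t v - (e \<bullet> v) *\<^sub>R e"
      unfolding w_def by (simp add: linear_diff[OF K.linear[OF t]] linear_scale[OF K.linear[OF t]] K_e[OF t])
    then have "u \<bullet> K t v - measure ?\<mu> A * measure ?\<mu> B = u \<bullet> K t w"
      by (simp add: inner_diff eu[symmetric] ev[symmetric] inner_commute[of u e])
    moreover have "\<bar>u \<bullet> K t w\<bar> \<le> norm u * (exp (- \<kappa> * t) * norm v)"
    proof -
      have "norm (K t w) \<le> exp (- \<kappa> * t) * norm w" by (rule decay[OF t ew])
      also have "\<dots> \<le> exp (- \<kappa> * t) * norm v" using nw by simp
      finally have "norm u * norm (K t w) \<le> norm u * (exp (- \<kappa> * t) * norm v)"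
        by (intro mult_left_mono) auto
      then show ?thesis using Cauchy_Schwarz_ineq2[of u "K t w"] by linarith
    qed
    ultimately show ?thesis unfolding joint nu nv by (simp add: mult_ac)
  qed
  then show ?thesis using \<kappa> by blast
qed

subsection \<open>Visits at integer times\<close>

lemma measure_coordinate:
  assumes "A \<in> sets borel"
  shows "measure P {\<omega> \<in> space P. \<omega> t \<in> A} = measure (ground_measure \<phi>) A"
proof -
  have "measure (distr P borel (\<lambda>\<omega>. \<omega> t)) A = measure P ((\<lambda>\<omega>. \<omega> t) -` A \<inter> space P)"
    using assms by (intro measure_distr coordinate_measurable)
  also have "(\<lambda>\<omega>. \<omega> t) -` A \<inter> space P = {\<omega> \<in> space P. \<omega> t \<in> A}" by auto
  finally show ?thesis by (simp add: distr_coordinate)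
qed

lemma AE_eventually_not_in:
  assumes A: "\<And>n. A n \<in> sets borel" and "summable (\<lambda>n. measure (ground_measure \<phi>) (A n))"
  shows "AE \<omega> in P. \<forall>\<^sub>F n in sequentially. \<omega> (real n) \<notin> A n"
proof -
  interpret P: prob_space P by (rule prob_space_P)
  define B where "B n = {\<omega> \<in> space P. \<omega> (real n) \<in> A n}" for n
  have "B n \<in> sets P" for n
    unfolding B_def using measurable_sets[OF coordinate_measurable[of "real n"] A[of n]]
    by (simp add: vimage_def Int_def conj_commute)
  then have "AE \<omega> in P. \<forall>\<^sub>F n in sequentially. \<omega> \<in> space P - B n"
    using assms by (intro borel_cantelli_AE1) (auto simp: B_def measure_coordinate P.emeasure_eq_measure)
  then show ?thesis
    by (rule AE_mp) (auto intro!: AE_I2 elim!: eventually_mono simp: B_def)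
qed

lemma AE_infinitely_often_in:
  assumes A: "\<And>n. A n \<in> sets borel" and "\<not> summable (\<lambda>n. measure (ground_measure \<phi>) (A n))"
  shows "AE \<omega> in P. \<exists>\<^sub>\<infinity>n. \<omega> (real n) \<in> A n"
proof -
  interpret P: prob_space P by (rule prob_space_P)
  obtain \<kappa> where \<kappa>: "0 < \<kappa>" and decay: "\<And>s t A B. 0 \<le> t \<Longrightarrow> A \<in> sets borel \<Longrightarrow> B \<in> sets borel \<Longrightarrow>
      \<bar>measure P {\<omega> \<in> space P. \<omega> s \<in> A \<and> \<omega> (s + t) \<in> B}
        - measure (ground_measure \<phi>) A * measure (ground_measure \<phi>) B\<bar>
      \<le> exp (- \<kappa> * t) * (sqrt (measure (ground_measure \<phi>) A) * sqrt (measure (ground_measure \<phi>) B))"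
    using correlation_decay by blast
  define B where "B n = {\<omega> \<in> space P. \<omega> (real n) \<in> A n}" for n
  have PB: "P.prob (B n) = measure (ground_measure \<phi>) (A n)" for n
    unfolding B_def by (rule measure_coordinate[OF A])
  have "AE \<omega> in P. \<exists>\<^sub>\<infinity>n. \<omega> \<in> B n"
  proof (rule P.borel_cantelli_of_decaying_correlations[where q = "exp (- \<kappa>)"])
    show "B n \<in> sets P" for n
      unfolding B_def using measurable_sets[OF coordinate_measurable[of "real n"] A[of n]]
      by (simp add: vimage_def Int_def conj_commute)
    show "\<not> summable (\<lambda>n. P.prob (B n))" using assms(2) by (simp add: PB)
    fix m n :: nat assume mn: "m \<le> n"
    have "B m \<inter> B n = {\<omega> \<in> space P. \<omega> (real m) \<in> A m \<and> \<omega> (real m + real (n - m)) \<in> A n}"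
      using mn by (auto simp: B_def of_nat_diff)
    moreover have "exp (- \<kappa> * real (n - m)) = exp (- \<kappa>) ^ (n - m)"
      by (simp flip: exp_of_nat_mult add: mult.commute)
    ultimately show "P.prob (B m \<inter> B n) - P.prob (B m) * P.prob (B n)
        \<le> exp (- \<kappa>) ^ (n - m) * (sqrt (P.prob (B m)) * sqrt (P.prob (B n)))"
      unfolding PB using decay[OF _ A[of m] A[of n], of "real (n - m)" "real m"] by simp
  qed (use \<kappa> in auto)
  then show ?thesis
    by (rule AE_mp) (auto intro!: AE_I2 elim!: frequently_mono[rotated] simp: B_def)
qed

lemma emeasure_ground_measure:
  "A \<in> sets borel \<Longrightarrow>
    emeasure (ground_measure \<phi>) A = (\<integral>\<^sup>+x. ennreal ((\<phi> x)\<^sup>2) * indicator A x \<partial>lborel)"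
  unfolding ground_measure_def by (subst emeasure_density) auto

text \<open>
  A ground state is positive and the complement of a ball has positive Lebesgue measure.
\<close>

lemma ground_measure_tail_pos: "0 < measure (ground_measure \<phi>) {x. r < norm x}"
proof (rule ccontr)
  interpret \<mu>: prob_space "ground_measure \<phi>" by (rule prob_space_ground_measure)
  have A: "{x::'a. r < norm x} \<in> sets borel" by measurable
  assume "\<not> ?thesis"
  then have "emeasure (ground_measure \<phi>) {x. r < norm x} = 0"
    by (simp add: \<mu>.emeasure_eq_measure not_less measure_le_0_iff)
  then have "AE x in lborel. ennreal ((\<phi> x)\<^sup>2) * indicator {x. r < norm x} x = 0"
    unfolding emeasure_ground_measure[OF A] using A by (subst (asm) nn_integral_0_iff_AE) auto
  then have "AE x::'a in lborel. x \<in> cball 0 r"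
    using phi_pos by (auto elim!: eventually_mono simp: indicator_def less_imp_neq[symmetric] split: if_splits)
  then have "emeasure lborel (UNIV::'a set) \<le> emeasure lborel (cball (0::'a) r)"
    by (intro emeasure_mono_AE) auto
  moreover have "emeasure lborel (cball (0::'a) r) < \<infinity>"
    by (intro emeasure_bounded_finite bounded_cball)
  ultimately show False by simp
qed

text \<open>
  Otherwise, by the first Borel--Cantelli lemma, \<open>\<bar>X n\<bar> \<le> (c / 2) \<tau> n\<close> for all large \<open>n\<close>, and
  the upper limit would be at most \<open>c / 2\<close>.
\<close>

lemma tail_not_summable:
  assumes \<tau>: "\<And>n. 0 < \<tau> n" and c: "0 < c"
    and limsup: "AE \<omega> in P. limsup (\<lambda>n. ereal (norm (\<omega> (real n)) / \<tau> n)) = ereal c"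
  shows "\<not> summable (\<lambda>n. measure (ground_measure \<phi>) {x. c / 2 * \<tau> n < norm x})"
proof
  interpret P: prob_space P by (rule prob_space_P)
  assume "summable (\<lambda>n. measure (ground_measure \<phi>) {x. c / 2 * \<tau> n < norm x})"
  then have "AE \<omega> in P. \<forall>\<^sub>F n in sequentially. \<omega> (real n) \<notin> {x. c / 2 * \<tau> n < norm x}"
    by (intro AE_eventually_not_in) measurable
  with limsup have "AE \<omega> in P. False"
  proof eventually_elim
    case (elim \<omega>)
    have "\<forall>\<^sub>F n in sequentially. ereal (norm (\<omega> (real n)) / \<tau> n) \<le> ereal (c / 2)"
      using elim(2) by eventually_elim (use \<tau> in \<open>simp add: pos_divide_le_eq not_less\<close>)
    then have "limsup (\<lambda>n. ereal (norm (\<omega> (real n)) / \<tau> n)) \<le> ereal (c / 2)"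
      by (rule Limsup_bounded)
    then show False using elim(1) c by simp
  qed
  then show False by simp
qed

end

section \<open>Comparison of two processes\<close>

lemma nn_integral_lborel_scale:
  fixes f :: "'a::euclidean_space \<Rightarrow> ennreal"
  assumes [measurable]: "f \<in> borel_measurable borel" and c: "c \<noteq> 0"
  shows "(\<integral>\<^sup>+x. f x \<partial>lborel) = ennreal (\<bar>c\<bar> ^ DIM('a)) * (\<integral>\<^sup>+x. f (c *\<^sub>R x) \<partial>lborel)"
  by (subst lborel_affine[OF c, of 0])
    (simp add: nn_integral_density nn_integral_distr nn_integral_cmult)

text \<open>
  Substitute \<open>x = c y\<close> in the integral of \<open>\<phi>1\<^sup>2\<close> over \<open>{x. c r < \<bar>x\<bar>}\<close> and use that
  \<open>\<phi>1 (c y) \<ge> \<epsilon> \<phi>2 y\<close> for large \<open>y\<close>.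
\<close>

lemma ground_measure_tail_comparison:
  fixes \<phi>1 \<phi>2 :: "'a::euclidean_space \<Rightarrow> real"
  assumes gsp1: "ground_state_process M1 X1 V1 H1 \<phi>1 Q1"
    and gsp2: "ground_state_process M2 X2 V2 H2 \<phi>2 Q2"
    and c: "0 < c" and decay: "0 < Liminf at_infinity (\<lambda>x. ereal (\<phi>1 (c *\<^sub>R x) / \<phi>2 x))"
  shows "\<exists>k>0. \<exists>R. \<forall>r\<ge>R. k * measure (ground_measure \<phi>2) {x. r < norm x}
    \<le> measure (ground_measure \<phi>1) {x. c * r < norm x}"
proof -
  interpret one: ground_state_process M1 X1 V1 H1 \<phi>1 Q1 by (rule gsp1)
  interpret two: ground_state_process M2 X2 V2 H2 \<phi>2 Q2 by (rule gsp2)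
  interpret \<mu>1: prob_space "ground_measure \<phi>1" by (rule one.prob_space_ground_measure)
  interpret \<mu>2: prob_space "ground_measure \<phi>2" by (rule two.prob_space_ground_measure)
  obtain \<epsilon> where \<epsilon>: "0 < ereal \<epsilon>" "ereal \<epsilon> < Liminf at_infinity (\<lambda>x. ereal (\<phi>1 (c *\<^sub>R x) / \<phi>2 x))"
    using ereal_dense2[OF decay] by blast
  from less_LiminfD[OF \<epsilon>(2)] obtain R where R: "\<And>x. R \<le> norm x \<Longrightarrow> \<epsilon> < \<phi>1 (c *\<^sub>R x) / \<phi>2 x"
    by (auto simp: eventually_at_infinity)
  define k where "k = c ^ DIM('a) * \<epsilon>\<^sup>2"
  have k: "0 < k" using c \<epsilon>(1) by (simp add: k_def)
  have "k * measure (ground_measure \<phi>2) {x. r < norm x} \<le> measure (ground_measure \<phi>1) {x. c * r < norm x}"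
    if r: "R \<le> r" for r
  proof -
    have [measurable]: "{x::'a. s < norm x} \<in> sets borel" for s by measurable
    have "ennreal k * emeasure (ground_measure \<phi>2) {x. r < norm x}
        = ennreal (c ^ DIM('a)) * (\<integral>\<^sup>+x. ennreal (\<epsilon>\<^sup>2) * (ennreal ((\<phi>2 x)\<^sup>2) * indicator {x. r < norm x} x) \<partial>lborel)"
      using c by (simp add: two.emeasure_ground_measure nn_integral_cmult k_def ennreal_mult mult.assoc)
    also have "\<dots> \<le> ennreal (c ^ DIM('a)) *
        (\<integral>\<^sup>+x. ennreal ((\<phi>1 (c *\<^sub>R x))\<^sup>2) * indicator {x. c * r < norm x} (c *\<^sub>R x) \<partial>lborel)"
    proof (intro mult_left_mono nn_integral_mono)
      fix x :: 'a
      show "ennreal (\<epsilon>\<^sup>2) * (ennreal ((\<phi>2 x)\<^sup>2) * indicator {x. r < norm x} x)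
          \<le> ennreal ((\<phi>1 (c *\<^sub>R x))\<^sup>2) * indicator {x. c * r < norm x} (c *\<^sub>R x)"
      proof (cases "r < norm x")
        case True
        then have "\<epsilon> * \<phi>2 x \<le> \<phi>1 (c *\<^sub>R x)"
          using R[of x] r two.phi_pos[of x] by (simp add: pos_less_divide_eq less_imp_le)
        then have "(\<epsilon> * \<phi>2 x)\<^sup>2 \<le> (\<phi>1 (c *\<^sub>R x))\<^sup>2"
          using \<epsilon>(1) two.phi_pos[of x] by (intro power_mono) (auto simp: less_imp_le)
        then show ?thesis
          using True c by (simp add: power_mult_distrib ennreal_mult[symmetric] ennreal_leI)
      qed simp
    qed simp
    also have "\<dots> = emeasure (ground_measure \<phi>1) {x. c * r < norm x}"
      using c nn_integral_lborel_scale[of "\<lambda>x. ennreal ((\<phi>1 x)\<^sup>2) * indicator {x. c * r < norm x} x" c]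
      by (simp add: one.emeasure_ground_measure)
    finally show ?thesis
      using k by (simp add: \<mu>1.emeasure_eq_measure \<mu>2.emeasure_eq_measure ennreal_mult[symmetric])
  qed
  then show ?thesis using k by blast
qed

lemma frequently_imp_le_Limsup:
  fixes f :: "'b \<Rightarrow> ereal"
  assumes "\<exists>\<^sub>F x in F. C \<le> f x"
  shows "C \<le> Limsup F f"
proof (rule ccontr)
  assume "\<not> C \<le> Limsup F f"
  then have "\<forall>\<^sub>F x in F. f x < C" by (intro Limsup_lessD) simp
  then show False using assms by (simp add: frequently_def not_le)
qed

lemma gst_setting_ground_state_process:
  "gst_setting M X A \<nu> V H \<phi> Q \<Longrightarrow> ground_state_process M X V H \<phi> Q"
  by (simp add: gst_setting_def admissible_levy_process_def X_kato_class_def ground_state_process_def)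

text \<open>
  If \<open>\<tau>\<close> stays bounded, the tail comparison says nothing, but then the terms do not tend to
  zero because every tail has positive mass.
\<close>

lemma not_summable_tail_transfer:
  fixes \<phi>1 \<phi>2 :: "'a::euclidean_space \<Rightarrow> real" and \<tau> :: "nat \<Rightarrow> real"
  assumes gsp1: "ground_state_process M1 X1 V1 H1 \<phi>1 Q1"
    and gsp2: "ground_state_process M2 X2 V2 H2 \<phi>2 Q2"
    and c: "0 < c" and decay: "0 < Liminf at_infinity (\<lambda>x. ereal (\<phi>1 (c *\<^sub>R x) / \<phi>2 x))"
    and \<tau>: "mono \<tau>"
    and diverges: "\<not> summable (\<lambda>n. measure (ground_measure \<phi>2) {x. \<tau> n < norm x})"
  shows "\<not> summable (\<lambda>n. measure (ground_measure \<phi>1) {x. c * \<tau> n < norm x})"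
proof
  interpret one: ground_state_process M1 X1 V1 H1 \<phi>1 Q1 by (rule gsp1)
  interpret \<mu>1: prob_space "ground_measure \<phi>1" by (rule one.prob_space_ground_measure)
  assume sum: "summable (\<lambda>n. measure (ground_measure \<phi>1) {x. c * \<tau> n < norm x})"
  obtain k R where k: "0 < k" and R: "\<And>r. R \<le> r \<Longrightarrow>
      k * measure (ground_measure \<phi>2) {x. r < norm x} \<le> measure (ground_measure \<phi>1) {x. c * r < norm x}"
    using ground_measure_tail_comparison[OF gsp1 gsp2 c decay] by blast
  show False
  proof (cases "\<exists>N. R \<le> \<tau> N")
    case True
    then obtain N where N: "R \<le> \<tau> N" by blast
    have "summable (\<lambda>n. k * measure (ground_measure \<phi>2) {x. \<tau> n < norm x})"
    proof (rule summable_comparison_test'[OF sum])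
      fix n assume "N \<le> n"
      then have "R \<le> \<tau> n" using N monoD[OF \<tau>, of N n] by simp
      then show "norm (k * measure (ground_measure \<phi>2) {x. \<tau> n < norm x})
          \<le> measure (ground_measure \<phi>1) {x. c * \<tau> n < norm x}"
        using R k by simp
    qed
    then show False using diverges k by simp
  next
    case False
    define p where "p = measure (ground_measure \<phi>1) {x. c * R < norm x}"
    have "p \<le> measure (ground_measure \<phi>1) {x. c * \<tau> n < norm x}" for n
      unfolding p_def
    proof (rule \<mu>1.finite_measure_mono)
      have "c * \<tau> n \<le> c * R" using False c by (simp add: not_le less_imp_le)
      then show "{x::'a. c * R < norm x} \<subseteq> {x. c * \<tau> n < norm x}" by auto
      show "{x::'a. c * \<tau> n < norm x} \<in> sets (ground_measure \<phi>1)"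
        unfolding one.sets_ground_measure by measurable
    qed
    then have "p \<le> 0"
      using summable_LIMSEQ_zero[OF sum] by (intro LIMSEQ_le_const[of _ 0 p]) auto
    then show False using one.ground_measure_tail_pos[of "c * R"] by (simp add: p_def)
  qed
qed

lemma limsup_infinite_of_slower_decay:
  fixes \<phi>1 \<phi>2 :: "'a::euclidean_space \<Rightarrow> real" and \<tau> :: "nat \<Rightarrow> real"
  assumes gsp1: "ground_state_process M1 X1 V1 H1 \<phi>1 Q1"
    and gsp2: "ground_state_process M2 X2 V2 H2 \<phi>2 Q2"
    and decay: "\<And>c. c0 \<le> c \<Longrightarrow> 0 < Liminf at_infinity (\<lambda>x. ereal (\<phi>1 (c *\<^sub>R x) / \<phi>2 x))"
    and \<tau>: "mono \<tau>" "\<And>n. 0 < \<tau> n"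
    and c: "0 < c"
    and limsup: "AE \<omega> in gst_path_measure \<phi>2 Q2.
      limsup (\<lambda>n. ereal (norm (\<omega> (real n)) / \<tau> n)) = ereal c"
  shows "AE \<omega> in gst_path_measure \<phi>1 Q1. limsup (\<lambda>n. ereal (norm (\<omega> (real n)) / \<tau> n)) = \<infinity>"
proof -
  interpret one: ground_state_process M1 X1 V1 H1 \<phi>1 Q1 by (rule gsp1)
  interpret two: ground_state_process M2 X2 V2 H2 \<phi>2 Q2 by (rule gsp2)
  \<comment> \<open>Countably many factors suffice for the almost sure statement; all are positive and at least \<open>c0\<close>.\<close>
  define k where "k j = max 1 c0 + real j" for j :: nat
  have k: "0 < k j" "c0 \<le> k j" for j by (auto simp: k_def)
  have "AE \<omega> in gst_path_measure \<phi>1 Q1. \<exists>\<^sub>\<infinity>n. \<omega> (real n) \<in> {x. k j * (c / 2 * \<tau> n) < norm x}" for j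
  proof (rule one.AE_infinitely_often_in)
    show "\<not> summable (\<lambda>n. measure (ground_measure \<phi>1) {x. k j * (c / 2 * \<tau> n) < norm x})"
    proof (rule not_summable_tail_transfer[OF gsp1 gsp2 k(1) decay[OF k(2)]])
      show "mono (\<lambda>n. c / 2 * \<tau> n)" using \<tau>(1) c by (auto simp: mono_def)
      show "\<not> summable (\<lambda>n. measure (ground_measure \<phi>2) {x. c / 2 * \<tau> n < norm x})"
        by (rule two.tail_not_summable[OF \<tau>(2) c limsup])
    qed
  qed measurable
  then have "AE \<omega> in gst_path_measure \<phi>1 Q1. \<forall>j. \<exists>\<^sub>\<infinity>n. \<omega> (real n) \<in> {x. k j * (c / 2 * \<tau> n) < norm x}"
    by (simp add: AE_all_countable)
  then show ?thesis
  proof eventually_elim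
    case (elim \<omega>)
    have ge: "ereal (k j * (c / 2)) \<le> limsup (\<lambda>n. ereal (norm (\<omega> (real n)) / \<tau> n))" for j
    proof (rule frequently_imp_le_Limsup)
      have "\<exists>\<^sub>F n in sequentially. \<omega> (real n) \<in> {x. k j * (c / 2 * \<tau> n) < norm x}"
        using elim by (simp add: cofinite_eq_sequentially)
      then show "\<exists>\<^sub>F n in sequentially. ereal (k j * (c / 2)) \<le> ereal (norm (\<omega> (real n)) / \<tau> n)"
        by (rule frequently_mono[rotated])
          (use \<tau>(2) in \<open>auto simp: pos_le_divide_eq mult.assoc less_imp_le\<close>)
    qed
    show ?case
    proof (rule ereal_top)
      fix B :: real
      obtain j :: nat where "B / (c / 2) \<le> real j" using real_arch_simple by blast
      then have "B / (c / 2) \<le> k j" by (simp add: k_def)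
      then have "B \<le> k j * (c / 2)" using c by (simp add: pos_divide_le_eq)
      then show "ereal B \<le> limsup (\<lambda>n. ereal (norm (\<omega> (real n)) / \<tau> n))"
        using ge[of j] order_trans ereal_less_eq(3) by blast
    qed
  qed
qed

text \<open>
  If \<open>\<tau>1 n / \<tau>2 n\<close> were bounded, \<open>\<bar>X n\<bar> / \<tau>2 n\<close> would be bounded on the event in question, which
  would then be a null set.
\<close>

lemma limsup_ratio_infinite:
  fixes \<tau>1 \<tau>2 :: "nat \<Rightarrow> real"
  assumes P: "AE \<omega> in P. limsup (\<lambda>n. ereal (norm (\<omega> (real n)) / \<tau>2 n)) = \<infinity>"
    and \<tau>: "\<And>n. 0 < \<tau>1 n" "\<And>n. 0 < \<tau>2 n"
    and pos: "0 < measure P {\<omega> \<in> space P. limsup (\<lambda>n. ereal (norm (\<omega> (real n)) / \<tau>1 n)) < \<infinity>}"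
  shows "limsup (\<lambda>n. ereal (\<tau>1 n / \<tau>2 n)) = \<infinity>"
proof (rule ccontr)
  assume "limsup (\<lambda>n. ereal (\<tau>1 n / \<tau>2 n)) \<noteq> \<infinity>"
  then have "limsup (\<lambda>n. ereal (\<tau>1 n / \<tau>2 n)) < \<infinity>" by simp
  then obtain C where "limsup (\<lambda>n. ereal (\<tau>1 n / \<tau>2 n)) < ereal C" using ereal_dense2 by blast
  from Limsup_lessD[OF this] have C: "\<forall>\<^sub>F n in sequentially. \<tau>1 n / \<tau>2 n < C" by simp
  let ?E = "{\<omega> \<in> space P. limsup (\<lambda>n. ereal (norm (\<omega> (real n)) / \<tau>1 n)) < \<infinity>}"
  have "AE \<omega> in P. \<omega> \<notin> ?E"
    using P
  proof eventually_elim
    case (elim \<omega>)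
    show "\<omega> \<notin> ?E"
    proof
      assume "\<omega> \<in> ?E"
      then obtain D where "limsup (\<lambda>n. ereal (norm (\<omega> (real n)) / \<tau>1 n)) < ereal D"
        using ereal_dense2 by blast
      from Limsup_lessD[OF this] have "\<forall>\<^sub>F n in sequentially. norm (\<omega> (real n)) / \<tau>1 n < D" by simp
      with C have "\<forall>\<^sub>F n in sequentially. ereal (norm (\<omega> (real n)) / \<tau>2 n) \<le> ereal (D * C)"
      proof eventually_elim
        case (elim n)
        have "norm (\<omega> (real n)) / \<tau>2 n = norm (\<omega> (real n)) / \<tau>1 n * (\<tau>1 n / \<tau>2 n)"
          using \<tau>(1)[of n] by simp
        also have "\<dots> \<le> D * C"
        proof (rule mult_mono)
          have "0 \<le> norm (\<omega> (real n)) / \<tau>1 n" using \<tau>(1)[of n] by simp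
          then show "0 \<le> D" using elim by linarith
        qed (use elim \<tau>(1)[of n] \<tau>(2)[of n] in auto)
        finally show ?case by simp
      qed
      then have "limsup (\<lambda>n. ereal (norm (\<omega> (real n)) / \<tau>2 n)) \<le> ereal (D * C)"
        by (rule Limsup_bounded)
      then show False using elim by simp
    qed
  qed
  then have "measure P ?E = 0"
  \<comment> \<open>The measure of a set outside the sigma-algebra is \<open>0\<close> by convention.\<close>
  proof (cases "?E \<in> sets P")
    case True
    then have "?E \<in> null_sets P" using \<open>AE \<omega> in P. \<omega> \<notin> ?E\<close> by (simp only: AE_iff_null_sets)
    then show ?thesis by (simp add: measure_def null_setsD1)
  qed (rule measure_notin_sets)
  then show False using pos by simp
qed

theorem theorem3p2:
  fixes M1 :: "'w1 measure" and M2 :: "'w2 measure"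
    and X1 :: "real \<Rightarrow> 'w1 \<Rightarrow> real^'n" and X2 :: "real \<Rightarrow> 'w2 \<Rightarrow> real^'n"
    and A1 A2 :: "real^'n^'n"
    and \<nu>1 \<nu>2 :: "(real^'n) measure"
    and V1 V2 :: "real^'n \<Rightarrow> real"
    and H1 H2 :: "(real^'n) l2_operator"
    and \<phi>1 \<phi>2 :: "real^'n \<Rightarrow> real"
    and Q1 Q2 :: "real^'n \<Rightarrow> (real \<Rightarrow> real^'n) measure"
    and P1 P2 :: "(real \<Rightarrow> real^'n) measure"
  assumes gst1: "gst_setting M1 X1 A1 \<nu>1 V1 H1 \<phi>1 Q1"
    and gst2: "gst_setting M2 X2 A2 \<nu>2 V2 H2 \<phi>2 Q2"
    and P1: "P1 = gst_path_measure \<phi>1 Q1"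
    and P2: "P2 = gst_path_measure \<phi>2 Q2"
    and decay: "\<exists>c0>0. \<forall>c\<ge>c0. 0 < Liminf at_infinity (\<lambda>x. ereal (\<phi>1 (c *\<^sub>R x) / \<phi>2 x))"
  shows
    "(\<forall>\<tau>2::real \<Rightarrow> real.
        mono_on {0..} \<tau>2 \<and> (\<forall>t\<ge>0. 0 < \<tau>2 t) \<and>
        (\<exists>c>0. AE \<omega> in P2. limsup (\<lambda>n. ereal (norm (\<omega> (real n)) / \<tau>2 (real n))) = ereal c)
        \<longrightarrow> (AE \<omega> in P1. limsup (\<lambda>n. ereal (norm (\<omega> (real n)) / \<tau>2 (real n))) = \<infinity>))
     \<and>
     (\<forall>(\<tau>2::real \<Rightarrow> real) (\<tau>1::real \<Rightarrow> real).
        mono_on {0..} \<tau>2 \<and> (\<forall>t\<ge>0. 0 < \<tau>2 t) \<and>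
        (\<exists>c>0. AE \<omega> in P2. limsup (\<lambda>n. ereal (norm (\<omega> (real n)) / \<tau>2 (real n))) = ereal c) \<and>
        mono_on {0..} \<tau>1 \<and> (\<forall>t\<ge>0. 0 < \<tau>1 t) \<and>
        measure P1 {\<omega> \<in> space P1.
          limsup (\<lambda>n. ereal (norm (\<omega> (real n)) / \<tau>1 (real n))) < \<infinity>} > 0
        \<longrightarrow> limsup (\<lambda>n. ereal (\<tau>1 (real n) / \<tau>2 (real n))) = \<infinity>)"
proof -
  note gsp1 = gst_setting_ground_state_process[OF gst1]
  note gsp2 = gst_setting_ground_state_process[OF gst2]
  obtain c0 where decay: "\<And>c. c0 \<le> c \<Longrightarrow> 0 < Liminf at_infinity (\<lambda>x. ereal (\<phi>1 (c *\<^sub>R x) / \<phi>2 x))"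
    using decay by blast
  have divergent: "AE \<omega> in P1. limsup (\<lambda>n. ereal (norm (\<omega> (real n)) / \<tau>2 (real n))) = \<infinity>"
    if mono: "mono_on {0..} \<tau>2" and pos: "\<forall>t\<ge>0. 0 < \<tau>2 t"
      and limsup: "\<exists>c>0. AE \<omega> in P2. limsup (\<lambda>n. ereal (norm (\<omega> (real n)) / \<tau>2 (real n))) = ereal c"
    for \<tau>2 :: "real \<Rightarrow> real"
  proof -
    obtain c where "0 < c"
      "AE \<omega> in P2. limsup (\<lambda>n. ereal (norm (\<omega> (real n)) / \<tau>2 (real n))) = ereal c"
      using limsup by blast
    moreover have "mono (\<lambda>n. \<tau>2 (real n))" using mono by (auto simp: mono_def monotone_on_def)
    moreover have "0 < \<tau>2 (real n)" for n using pos by simp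
    ultimately show ?thesis
      unfolding P1 P2 by (intro limsup_infinite_of_slower_decay[OF gsp1 gsp2 decay])
  qed
  show ?thesis
  proof (intro conjI allI impI)
    fix \<tau>2 \<tau>1 :: "real \<Rightarrow> real"
    assume *: "mono_on {0..} \<tau>2 \<and> (\<forall>t\<ge>0. 0 < \<tau>2 t) \<and>
        (\<exists>c>0. AE \<omega> in P2. limsup (\<lambda>n. ereal (norm (\<omega> (real n)) / \<tau>2 (real n))) = ereal c) \<and>
        mono_on {0..} \<tau>1 \<and> (\<forall>t\<ge>0. 0 < \<tau>1 t) \<and>
        measure P1 {\<omega> \<in> space P1.
          limsup (\<lambda>n. ereal (norm (\<omega> (real n)) / \<tau>1 (real n))) < \<infinity>} > 0"
    show "limsup (\<lambda>n. ereal (\<tau>1 (real n) / \<tau>2 (real n))) = \<infinity>"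
      by (rule limsup_ratio_infinite[OF divergent[of \<tau>2]]) (use * in auto)
  qed (use divergent in blast)
qed

end
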